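(* Let $M$ be a connected three-dimensional non-Riemannian Finsler manifold with Finsler metric $F$, let $\gamma$ be its averaged Riemannian metric and let $\nabla^*$ be the Lévi-Civita connection of $\gamma$. If $\nabla$ is a linear connection on $M$ that is compatible to $F$ and has totally anti-symmetric torsion tensor, then on any coordinate neighbourhood $U\subset M$ (with coordinates $u^1,u^2,u^3$, oriented so that the coordinate vector fields form a positive basis) $\nabla$ must be of the form $$\nabla_X Y=\nabla^*_X Y+\frac{f}{2}\, X\times_\gamma Y ,$$ where the function $f\colon U\to\mathbb{R}$ is given by $$f(p)=\frac{1}{\sigma(p)}\int_{\partial K_p} VE\ \mu,\qquad V=\sum_{i=1}^3 (V_iE)\,X_i^{h^*},\qquad \sigma(p)=\sum_{i=1}^3\int_{\partial K_p}(V_iE)^2\,\mu,\qquad V_i=\frac12\,\frac{\partial}{\partial y^i}\times_{g^*} C .$$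
   Context: Finsler metric: a continuous function $F\colon TM\to[0,\infty)$, smooth off the zero section, with $F(tv)=tF(v)$ for $t>0$, such that with $E=\frac12F^2$ the Hessian $g_{ij}=\frac{\partial^2E}{\partial y^i\partial y^j}$ is positive definite at every nonzero tangent vector. Here $x^1,x^2,x^3,y^1,y^2,y^3$ are the coordinates on $TM$ induced by local coordinates $u^1,u^2,u^3$ on $M$: $x^i=u^i\circ\pi$, $y^i(v)=v(u^i)$, with $\pi\colon TM\to M$ the projection. The Finsler manifold is Riemannian if $F^2$ is quadratic on every tangent space, i.e. $F$ is the norm of a Riemannian metric; otherwise it is non-Riemannian. The indicatrix at $p$ is $\partial K_p=F^{-1}(1)\cap T_pM$, with induced volume form $\mu=\sqrt{\det g_{ij}}\,\sum_{i=1}^3(-1)^{i-1}\frac{y^i}{F}\,dy^1\wedge\ldots\wedge\widehat{dy^i}\wedge\ldots\wedge dy^3$ (hat means omission; $\partial K_p$ is oriented so that $\mu$ is a positive volume form). The averaged Riemannian metric is $\gamma_p(v,w)=v^iw^j\int_{\partial K_p}g_{ij}\,\mu$ for $v,w\in T_pM$. A linear connection $\nabla$ on $M$ is compatible to $F$ if its parallel transports preserve the Finslerian length $F$ of tangent vectors. Its torsion $T$ is totally anti-symmetric if $T_\flat(X,Y,Z)=\gamma(T(X,Y),Z)$ is a 3-form. The cross product $\times_\gamma$ on $U$ is the bilinear product with $\gamma\big(\frac{\partial}{\partial u^i}\times_\gamma\frac{\partial}{\partial u^j},\frac{\partial}{\partial u^k}\big)=\varepsilon_{ijk}\sqrt{\det\gamma_{rs}}$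 ($\varepsilon_{ijk}$ the Levi-Civita symbol), i.e. the usual cross product of the oriented Riemannian metric $\gamma$. With $g^*_{ij}=\gamma_{ij}\circ\pi$, the cross product $\times_{g^*}$ of vertical vector fields is the bilinear product with $g^*\big(\frac{\partial}{\partial y^i}\times_{g^*}\frac{\partial}{\partial y^j},\frac{\partial}{\partial y^k}\big)=\varepsilon_{ijk}\sqrt{\det g^*_{rs}}$. $C=\sum_i y^i\frac{\partial}{\partial y^i}$ is the Liouville vector field, and $X_i^{h^*}=\frac{\partial}{\partial x^i}-y^j\,({\Gamma^*}_{ij}^l\circ\pi)\frac{\partial}{\partial y^l}$, where ${\Gamma^*}_{ij}^l$ are the Christoffel symbols of $\nabla^*$ (summation over repeated $j,l$). *)

theory Defs
  imports "HOL-Analysis.Analysis"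
begin

section \<open>Smooth maps between normed spaces\<close>

fun times_differentiable_on ::
  "nat \<Rightarrow> 'a::real_normed_vector set \<Rightarrow> ('a \<Rightarrow> 'b::real_normed_vector) \<Rightarrow> bool" where
  "times_differentiable_on 0 S f \<longleftrightarrow> continuous_on S f"
| "times_differentiable_on (Suc n) S f \<longleftrightarrow>
     (\<forall>x\<in>S. f differentiable (at x)) \<and>
     (\<forall>v. times_differentiable_on n S (\<lambda>x. frechet_derivative f (at x) v))"

text \<open>Infinitely differentiable; only meant for open \<open>S\<close> (of finite-dimensional spaces).\<close>

definition smooth_on :: "'a::real_normed_vector set \<Rightarrow> ('a \<Rightarrow> 'b::real_normed_vector) \<Rightarrow> bool" where
  "smooth_on S f \<longleftrightarrow> (\<forall>n. times_differentiable_on n S f)"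

definition pderiv_at :: "3 \<Rightarrow> (real^3 \<Rightarrow> real) \<Rightarrow> real^3 \<Rightarrow> real" where
  "pderiv_at i f x = frechet_derivative f (at x) (axis i 1)"


section \<open>Three-dimensional manifolds\<close>

text \<open>The manifold is a whole type of class \<open>{t2_space, second_countable_topology}\<close>. A chart is
  a pair \<open>(U, u)\<close>; the values of \<open>u\<close> outside \<open>U\<close> are irrelevant.\<close>

type_synonym 'a chart = "'a set \<times> ('a \<Rightarrow> real^3)"

definition is_chart :: "'a::topological_space chart \<Rightarrow> bool" where
  "is_chart = (\<lambda>(U, u). open U \<and> open (u ` U) \<and> homeomorphism U (u ` U) u (inv_into U u))"

definition smoothly_compatible :: "'a chart \<Rightarrow> 'a chart \<Rightarrow> bool" where
  "smoothly_compatible = (\<lambda>(U, u) (V, v).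
     smooth_on (u ` (U \<inter> V)) (v \<circ> inv_into U u) \<and>
     smooth_on (v ` (U \<inter> V)) (u \<circ> inv_into V v))"

definition smooth_atlas :: "'a::topological_space chart set \<Rightarrow> bool" where
  "smooth_atlas A \<longleftrightarrow> (\<forall>\<kappa>\<in>A. is_chart \<kappa>) \<and> (\<Union>(U, u)\<in>A. U) = UNIV \<and>
     (\<forall>\<kappa>\<in>A. \<forall>\<kappa>'\<in>A. smoothly_compatible \<kappa> \<kappa>')"

text \<open>The maximal atlas, i.e. all coordinate systems of the manifold.\<close>

definition charts :: "'a::topological_space chart set \<Rightarrow> 'a chart set" where
  "charts A = {\<kappa>. is_chart \<kappa> \<and> (\<forall>\<kappa>'\<in>A. smoothly_compatible \<kappa> \<kappa>')}"

text \<open>\<open>f\<close> is smooth in a neighbourhood of \<open>p\<close>.\<close>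

definition smooth_near :: "'a::topological_space chart set \<Rightarrow> 'a \<Rightarrow> ('a \<Rightarrow> real) \<Rightarrow> bool" where
  "smooth_near A p f \<longleftrightarrow>
     (\<exists>(U, u)\<in>charts A. p \<in> U \<and> smooth_on (u ` U) (f \<circ> inv_into U u))"


section \<open>Tangent vectors and vector fields\<close>

text \<open>Tangent vectors at \<open>p\<close> are the derivations of the functions that are smooth near \<open>p\<close>. On
  all other functions they are \<open>0\<close>, so that a derivation determines its HOL function uniquely.\<close>

type_synonym 'a tvec = "('a \<Rightarrow> real) \<Rightarrow> real"

definition tangent_space :: "'a::topological_space chart set \<Rightarrow> 'a \<Rightarrow> 'a tvec set" where
  "tangent_space A p = {v.
     (\<forall>f. \<not> smooth_near A p f \<longrightarrow> v f = 0) \<and>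
     (\<forall>f g a b. smooth_near A p f \<longrightarrow> smooth_near A p g \<longrightarrow>
        v (\<lambda>q. a * f q + b * g q) = a * v f + b * v g) \<and>
     (\<forall>f g. smooth_near A p f \<longrightarrow> smooth_near A p g \<longrightarrow>
        v (\<lambda>q. f q * g q) = v f * g p + f p * v g)}"

text \<open>The coordinate vector \<open>\<partial>/\<partial>u\<^sup>i\<close> at \<open>p\<close>.\<close>

definition coord_vec ::
  "'a::topological_space chart set \<Rightarrow> 'a set \<Rightarrow> ('a \<Rightarrow> real^3) \<Rightarrow> 3 \<Rightarrow> 'a \<Rightarrow> 'a tvec" where
  "coord_vec A U u i p =
     (\<lambda>f. if smooth_near A p f then pderiv_at i (f \<circ> inv_into U u) (u p) else 0)"

text \<open>The fibre coordinates \<open>y\<^sup>i(v) = v(u\<^sup>i)\<close>, and the tangent vector with given fibre coordinates.\<close>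

definition fibre_coords :: "('a \<Rightarrow> real^3) \<Rightarrow> 'a tvec \<Rightarrow> real^3" where
  "fibre_coords u v = (\<chi> i. v (\<lambda>q. u q $ i))"

definition coords_tvec ::
  "'a::topological_space chart set \<Rightarrow> 'a set \<Rightarrow> ('a \<Rightarrow> real^3) \<Rightarrow> 'a \<Rightarrow> real^3 \<Rightarrow> 'a tvec" where
  "coords_tvec A U u p y = (\<lambda>f. \<Sum>i\<in>UNIV. y $ i * coord_vec A U u i p f)"

type_synonym 'a vfield = "'a \<Rightarrow> 'a tvec"

text \<open>\<open>X\<close> restricts to a smooth vector field on the open set \<open>W\<close>.\<close>

definition smooth_vfield :: "'a::topological_space chart set \<Rightarrow> 'a set \<Rightarrow> 'a vfield \<Rightarrow> bool" where
  "smooth_vfield A W X \<longleftrightarrow> (\<forall>p\<in>W. X p \<in> tangent_space A p \<and>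
     (\<forall>f. smooth_near A p f \<longrightarrow> smooth_near A p (\<lambda>q. X q f)))"

definition lie_bracket ::
  "'a::topological_space chart set \<Rightarrow> 'a vfield \<Rightarrow> 'a vfield \<Rightarrow> 'a vfield" where
  "lie_bracket A X Y p =
     (\<lambda>f. if smooth_near A p f then X p (\<lambda>q. Y q f) - Y p (\<lambda>q. X q f) else 0)"


section \<open>Linear connections\<close>

text \<open>A connection acts on vector fields over arbitrary open sets \<open>W\<close>. Vector fields are total
  functions, but the value at \<open>p\<close> of \<open>D X Y\<close> only depends on \<open>X\<close> and \<open>Y\<close> near \<open>p\<close>: this follows
  from the rules for \<open>h X\<close> and \<open>h Y\<close>, where \<open>h\<close> is the indicator function of a neighbourhood
  of \<open>p\<close>, which is smooth near \<open>p\<close>.\<close>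

definition linear_connection ::
  "'a::topological_space chart set \<Rightarrow> ('a vfield \<Rightarrow> 'a vfield \<Rightarrow> 'a vfield) \<Rightarrow> bool" where
  "linear_connection A D \<longleftrightarrow>
     (\<forall>W X Y. open W \<longrightarrow> smooth_vfield A W X \<longrightarrow> smooth_vfield A W Y \<longrightarrow>
        smooth_vfield A W (D X Y) \<and>
        (\<forall>Z. smooth_vfield A W Z \<longrightarrow> (\<forall>p\<in>W.
           D (\<lambda>q f. X q f + Z q f) Y p = (\<lambda>f. D X Y p f + D Z Y p f) \<and>
           D X (\<lambda>q f. Y q f + Z q f) p = (\<lambda>f. D X Y p f + D X Z p f))) \<and>
        (\<forall>h. (\<forall>p\<in>W. smooth_near A p h) \<longrightarrow> (\<forall>p\<in>W.
           D (\<lambda>q f. h q * X q f) Y p = (\<lambda>f. h p * D X Y p f) \<and>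
           D X (\<lambda>q f. h q * Y q f) p = (\<lambda>f. X p h * Y p f + h p * D X Y p f))))"

definition torsion ::
  "'a::topological_space chart set \<Rightarrow> ('a vfield \<Rightarrow> 'a vfield \<Rightarrow> 'a vfield) \<Rightarrow>
     'a vfield \<Rightarrow> 'a vfield \<Rightarrow> 'a vfield" where
  "torsion A D X Y p = (\<lambda>f. D X Y p f - D Y X p f - lie_bracket A X Y p f)"

text \<open>\<open>christoffel A U u D i j l\<close> is \<open>\<Gamma>\<^sub>i\<^sub>j\<^sup>l\<close>: the derivative of the \<open>j\<close>-th coordinate field along the
  \<open>i\<close>-th one has \<open>l\<close>-th component \<open>\<Gamma>\<^sub>i\<^sub>j\<^sup>l\<close>.\<close>

definition christoffel ::
  "'a::topological_space chart set \<Rightarrow> 'a set \<Rightarrow> ('a \<Rightarrow> real^3) \<Rightarrow>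
     ('a vfield \<Rightarrow> 'a vfield \<Rightarrow> 'a vfield) \<Rightarrow> 3 \<Rightarrow> 3 \<Rightarrow> 3 \<Rightarrow> 'a \<Rightarrow> real" where
  "christoffel A U u D i j l p =
     fibre_coords u (D (coord_vec A U u i) (coord_vec A U u j) p) $ l"

definition smooth_curve_on ::
  "'a::topological_space chart set \<Rightarrow> real set \<Rightarrow> (real \<Rightarrow> 'a) \<Rightarrow> bool" where
  "smooth_curve_on A I c \<longleftrightarrow> continuous_on I c \<and>
     (\<forall>(U, u)\<in>charts A. smooth_on {t\<in>I. c t \<in> U} (u \<circ> c))"

text \<open>\<open>X\<close> is a vector field along the curve \<open>c\<close> that is parallel on the open interval \<open>I\<close>.\<close>

definition parallel_along ::
  "'a::topological_space chart set \<Rightarrow> ('a vfield \<Rightarrow> 'a vfield \<Rightarrow> 'a vfield) \<Rightarrow>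
     real set \<Rightarrow> (real \<Rightarrow> 'a) \<Rightarrow> (real \<Rightarrow> 'a tvec) \<Rightarrow> bool" where
  "parallel_along A D I c X \<longleftrightarrow> (\<forall>t\<in>I. X t \<in> tangent_space A (c t) \<and>
     (\<forall>(U, u)\<in>charts A. c t \<in> U \<longrightarrow> (\<forall>l.
        ((\<lambda>s. fibre_coords u (X s) $ l) has_real_derivative
          - (\<Sum>i\<in>UNIV. \<Sum>j\<in>UNIV. christoffel A U u D i j l (c t) *
               deriv (\<lambda>s. u (c s) $ i) t * fibre_coords u (X t) $ j)) (at t))))"


section \<open>Finsler metrics\<close>

text \<open>A function on the tangent bundle takes the base point as a separate argument (the zero
  vectors of all tangent spaces are the same HOL function). \<open>in_chart A U u F\<close> is its expression in
  the induced coordinates \<open>(x, y)\<close> of the tangent bundle.\<close>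

definition in_chart ::
  "'a::topological_space chart set \<Rightarrow> 'a set \<Rightarrow> ('a \<Rightarrow> real^3) \<Rightarrow> ('a \<Rightarrow> 'a tvec \<Rightarrow> real) \<Rightarrow>
     (real^3) \<times> (real^3) \<Rightarrow> real" where
  "in_chart A U u F = (\<lambda>(x, y). F (inv_into U u x) (coords_tvec A U u (inv_into U u x) y))"

text \<open>The matrix \<open>g\<^sub>i\<^sub>j\<close> at \<open>y\<close> of a norm-like function \<open>\<phi>\<close>.\<close>

definition fundamental_matrix :: "(real^3 \<Rightarrow> real) \<Rightarrow> real^3 \<Rightarrow> real^3^3" where
  "fundamental_matrix \<phi> y = (\<chi> i j. pderiv_at i (pderiv_at j (\<lambda>z. 1/2 * (\<phi> z)\<^sup>2)) y)"

definition finsler_metric ::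
  "'a::topological_space chart set \<Rightarrow> ('a \<Rightarrow> 'a tvec \<Rightarrow> real) \<Rightarrow> bool" where
  "finsler_metric A F \<longleftrightarrow>
     (\<forall>p. \<forall>v\<in>tangent_space A p. F p v \<ge> 0 \<and> (\<forall>t>0. F p (\<lambda>f. t * v f) = t * F p v)) \<and>
     (\<forall>(U, u)\<in>charts A.
        continuous_on (u ` U \<times> UNIV) (in_chart A U u F) \<and>
        smooth_on (u ` U \<times> (UNIV - {0})) (in_chart A U u F) \<and>
        (\<forall>x\<in>u ` U. \<forall>y. y \<noteq> 0 \<longrightarrow> (\<forall>w. w \<noteq> 0 \<longrightarrow>
           w \<bullet> (fundamental_matrix (\<lambda>z. in_chart A U u F (x, z)) y *v w) > 0)))"

definition riemannian ::
  "'a::topological_space chart set \<Rightarrow> ('a \<Rightarrow> 'a tvec \<Rightarrow> real) \<Rightarrow> bool" where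
  "riemannian A F \<longleftrightarrow> (\<forall>(U, u)\<in>charts A. \<forall>x\<in>u ` U.
     \<exists>Q :: real^3^3. \<forall>y. (in_chart A U u F (x, y))\<^sup>2 = y \<bullet> (Q *v y))"

text \<open>Parallel transports preserve \<open>F\<close>: the parallel transport along \<open>c\<close> from \<open>c s\<close> to \<open>c t\<close> maps
  \<open>X s\<close> to \<open>X t\<close> for every parallel vector field \<open>X\<close> along \<open>c\<close>.\<close>

definition compatible_connection ::
  "'a::topological_space chart set \<Rightarrow> ('a \<Rightarrow> 'a tvec \<Rightarrow> real) \<Rightarrow>
     ('a vfield \<Rightarrow> 'a vfield \<Rightarrow> 'a vfield) \<Rightarrow> bool" where
  "compatible_connection A F D \<longleftrightarrow>
     (\<forall>I c X. open I \<longrightarrow> is_interval I \<longrightarrow> smooth_curve_on A I c \<longrightarrow> parallel_along A D I c X \<longrightarrow>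
        (\<forall>s\<in>I. \<forall>t\<in>I. F (c s) (X s) = F (c t) (X t)))"


section \<open>Integration over the indicatrix\<close>

text \<open>In this section \<open>\<phi>\<close> is the restriction of \<open>F\<close> to a tangent space, in the coordinates \<open>y\<close>.
  The indicatrix \<open>\<phi> = 1\<close> is parametrised, up to a null set, by the radial projection of spherical
  coordinates. The volume form is positive for this parametrisation.\<close>

definition indicatrix_param :: "(real^3 \<Rightarrow> real) \<Rightarrow> real \<times> real \<Rightarrow> real^3" where
  "indicatrix_param \<phi> = (\<lambda>(\<theta>, \<psi>).
     let n = vector [sin \<theta> * cos \<psi>, sin \<theta> * sin \<psi>, cos \<theta>] in n /\<^sub>R \<phi> n)"

definition indicatrix_form :: "(real^3 \<Rightarrow> real) \<Rightarrow> real^3 \<Rightarrow> real^3 \<Rightarrow> real^3 \<Rightarrow> real" where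
  "indicatrix_form \<phi> y a b = sqrt (det (fundamental_matrix \<phi> y)) *
     (y$1 / \<phi> y * (a$2 * b$3 - a$3 * b$2)
    - y$2 / \<phi> y * (a$1 * b$3 - a$3 * b$1)
    + y$3 / \<phi> y * (a$1 * b$2 - a$2 * b$1))"

text \<open>The integral of \<open>h \<mu>\<close>, as the integral of the pull-back by the parametrisation.\<close>

definition indicatrix_integral :: "(real^3 \<Rightarrow> real) \<Rightarrow> (real^3 \<Rightarrow> real) \<Rightarrow> real" where
  "indicatrix_integral \<phi> h =
     (let P = indicatrix_param \<phi> in
      integral (box (0, 0) (pi, 2 * pi))
        (\<lambda>s. h (P s) * indicatrix_form \<phi> (P s)
           (frechet_derivative P (at s) (1, 0)) (frechet_derivative P (at s) (0, 1))))"

text \<open>The definition of \<open>\<gamma>\<^sub>p(v, w)\<close> does not depend on the chart around \<open>p\<close>, so we choose one.\<close>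

definition averaged_metric ::
  "'a::topological_space chart set \<Rightarrow> ('a \<Rightarrow> 'a tvec \<Rightarrow> real) \<Rightarrow> 'a \<Rightarrow> 'a tvec \<Rightarrow> 'a tvec \<Rightarrow> real" where
  "averaged_metric A F p v w =
     (let (U, u) = (SOME (U, u). (U, u) \<in> charts A \<and> p \<in> U);
          \<phi> = (\<lambda>y. in_chart A U u F (u p, y))
      in \<Sum>i\<in>UNIV. \<Sum>j\<in>UNIV. fibre_coords u v $ i * fibre_coords u w $ j *
           indicatrix_integral \<phi> (\<lambda>y. fundamental_matrix \<phi> y $ i $ j))"


section \<open>Connections and metrics\<close>

text \<open>Applying \<open>X p\<close> to \<open>q \<mapsto> \<gamma>\<^sub>q(Y, Z)\<close> is only meaningful where this function is smooth, i.e. for smooth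
  \<open>\<gamma>\<close>; the averaged metric of a Finsler metric is smooth.\<close>

definition levi_civita_connection ::
  "'a::topological_space chart set \<Rightarrow> ('a \<Rightarrow> 'a tvec \<Rightarrow> 'a tvec \<Rightarrow> real) \<Rightarrow>
     ('a vfield \<Rightarrow> 'a vfield \<Rightarrow> 'a vfield) \<Rightarrow> bool" where
  "levi_civita_connection A \<gamma> D \<longleftrightarrow> linear_connection A D \<and>
     (\<forall>W X Y. open W \<longrightarrow> smooth_vfield A W X \<longrightarrow> smooth_vfield A W Y \<longrightarrow> (\<forall>p\<in>W.
        torsion A D X Y p = (\<lambda>f. 0) \<and>
        (\<forall>Z. smooth_vfield A W Z \<longrightarrow>
           X p (\<lambda>q. \<gamma> q (Y q) (Z q)) = \<gamma> p (D X Y p) (Z p) + \<gamma> p (Y p) (D X Z p))))"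

text \<open>\<open>T X Y Z p\<close> is tensorial in \<open>X\<close>, \<open>Y\<close>, \<open>Z\<close> for every linear connection, so it is a 3-form as
  soon as it changes sign under transpositions of neighbouring arguments.\<close>

definition totally_antisymmetric_torsion ::
  "'a::topological_space chart set \<Rightarrow> ('a \<Rightarrow> 'a tvec \<Rightarrow> 'a tvec \<Rightarrow> real) \<Rightarrow>
     ('a vfield \<Rightarrow> 'a vfield \<Rightarrow> 'a vfield) \<Rightarrow> bool" where
  "totally_antisymmetric_torsion A \<gamma> D \<longleftrightarrow>
     (let T = (\<lambda>X Y Z p. \<gamma> p (torsion A D X Y p) (Z p)) in
      \<forall>W X Y Z. open W \<longrightarrow> smooth_vfield A W X \<longrightarrow> smooth_vfield A W Y \<longrightarrow> smooth_vfield A W Z \<longrightarrow>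
        (\<forall>p\<in>W. T X Y Z p = - T Y X Z p \<and> T X Y Z p = - T X Z Y p))"


section \<open>Cross products\<close>

text \<open>The Levi-Civita symbol. The index type \<open>3\<close> has arithmetic modulo 3, so \<open>j = i + 1\<close> singles out
  the cyclic permutations among the triples of distinct indices.\<close>

definition eps :: "3 \<Rightarrow> 3 \<Rightarrow> 3 \<Rightarrow> real" where
  "eps i j k = (if i = j \<or> j = k \<or> i = k then 0 else if j = i + 1 then 1 else - 1)"

text \<open>The cross product, in components, for the inner product with Gram matrix \<open>G\<close>.\<close>

definition gram_cross :: "real^3^3 \<Rightarrow> real^3 \<Rightarrow> real^3 \<Rightarrow> real^3" where
  "gram_cross G = (THE B. bilinear B \<and>
     (\<forall>i j k. B (axis i 1) (axis j 1) \<bullet> (G *v axis k 1) = eps i j k * sqrt (det G)))"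

definition gram_matrix ::
  "'a::topological_space chart set \<Rightarrow> 'a set \<Rightarrow> ('a \<Rightarrow> real^3) \<Rightarrow>
     ('a \<Rightarrow> 'a tvec \<Rightarrow> 'a tvec \<Rightarrow> real) \<Rightarrow> 'a \<Rightarrow> real^3^3" where
  "gram_matrix A U u \<gamma> p = (\<chi> i j. \<gamma> p (coord_vec A U u i p) (coord_vec A U u j p))"

definition tangent_cross ::
  "'a::topological_space chart set \<Rightarrow> 'a set \<Rightarrow> ('a \<Rightarrow> real^3) \<Rightarrow>
     ('a \<Rightarrow> 'a tvec \<Rightarrow> 'a tvec \<Rightarrow> real) \<Rightarrow> 'a \<Rightarrow> 'a tvec \<Rightarrow> 'a tvec \<Rightarrow> 'a tvec" where
  "tangent_cross A U u \<gamma> p v w = coords_tvec A U u p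
     (gram_cross (gram_matrix A U u \<gamma> p) (fibre_coords u v) (fibre_coords u w))"


section \<open>The function \<open>f\<close>\<close>

text \<open>Vector fields on the tangent bundle over \<open>U\<close> are functions of the induced coordinates
  \<open>(x, y)\<close>; their values are the components with respect to \<open>\<partial>/\<partial>x\<^sup>i\<close> and \<open>\<partial>/\<partial>y\<^sup>i\<close>.\<close>

type_synonym bundle_field = "(real^3) \<times> (real^3) \<Rightarrow> (real^3) \<times> (real^3)"

definition apply_field :: "bundle_field \<Rightarrow> ((real^3) \<times> (real^3) \<Rightarrow> real) \<Rightarrow> (real^3) \<times> (real^3) \<Rightarrow> real" where
  "apply_field Z H z = frechet_derivative H (at z) (Z z)"

text \<open>\<open>V\<^sub>i\<close> is vertical; the last argument \<open>y\<close> of the cross product is the Liouville vector field.\<close>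

definition V_field ::
  "'a::topological_space chart set \<Rightarrow> 'a set \<Rightarrow> ('a \<Rightarrow> real^3) \<Rightarrow>
     ('a \<Rightarrow> 'a tvec \<Rightarrow> 'a tvec \<Rightarrow> real) \<Rightarrow> 3 \<Rightarrow> bundle_field" where
  "V_field A U u \<gamma> i = (\<lambda>(x, y).
     (0, (1/2) *\<^sub>R gram_cross (gram_matrix A U u \<gamma> (inv_into U u x)) (axis i 1) y))"

definition horizontal_field ::
  "'a::topological_space chart set \<Rightarrow> 'a set \<Rightarrow> ('a \<Rightarrow> real^3) \<Rightarrow>
     ('a vfield \<Rightarrow> 'a vfield \<Rightarrow> 'a vfield) \<Rightarrow> 3 \<Rightarrow> bundle_field" where
  "horizontal_field A U u D i = (\<lambda>(x, y).
     (axis i 1, \<chi> l. - (\<Sum>j\<in>UNIV. y $ j * christoffel A U u D i j l (inv_into U u x))))"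

definition energy ::
  "'a::topological_space chart set \<Rightarrow> 'a set \<Rightarrow> ('a \<Rightarrow> real^3) \<Rightarrow> ('a \<Rightarrow> 'a tvec \<Rightarrow> real) \<Rightarrow>
     (real^3) \<times> (real^3) \<Rightarrow> real" where
  "energy A U u F = (\<lambda>z. 1/2 * (in_chart A U u F z)\<^sup>2)"

definition V_total ::
  "'a::topological_space chart set \<Rightarrow> 'a set \<Rightarrow> ('a \<Rightarrow> real^3) \<Rightarrow> ('a \<Rightarrow> 'a tvec \<Rightarrow> real) \<Rightarrow>
     ('a \<Rightarrow> 'a tvec \<Rightarrow> 'a tvec \<Rightarrow> real) \<Rightarrow> ('a vfield \<Rightarrow> 'a vfield \<Rightarrow> 'a vfield) \<Rightarrow> bundle_field" where
  "V_total A U u F \<gamma> D z = (\<Sum>i\<in>UNIV.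
     apply_field (V_field A U u \<gamma> i) (energy A U u F) z *\<^sub>R horizontal_field A U u D i z)"

definition sigma ::
  "'a::topological_space chart set \<Rightarrow> 'a set \<Rightarrow> ('a \<Rightarrow> real^3) \<Rightarrow> ('a \<Rightarrow> 'a tvec \<Rightarrow> real) \<Rightarrow>
     ('a \<Rightarrow> 'a tvec \<Rightarrow> 'a tvec \<Rightarrow> real) \<Rightarrow> 'a \<Rightarrow> real" where
  "sigma A U u F \<gamma> p = (\<Sum>i\<in>UNIV. indicatrix_integral (\<lambda>y. in_chart A U u F (u p, y))
     (\<lambda>y. (apply_field (V_field A U u \<gamma> i) (energy A U u F) (u p, y))\<^sup>2))"

definition torsion_coeff ::
  "'a::topological_space chart set \<Rightarrow> 'a set \<Rightarrow> ('a \<Rightarrow> real^3) \<Rightarrow> ('a \<Rightarrow> 'a tvec \<Rightarrow> real) \<Rightarrow>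
     ('a \<Rightarrow> 'a tvec \<Rightarrow> 'a tvec \<Rightarrow> real) \<Rightarrow> ('a vfield \<Rightarrow> 'a vfield \<Rightarrow> 'a vfield) \<Rightarrow> 'a \<Rightarrow> real" where
  "torsion_coeff A U u F \<gamma> D p = 1 / sigma A U u F \<gamma> p *
     indicatrix_integral (\<lambda>y. in_chart A U u F (u p, y))
       (\<lambda>y. apply_field (V_total A U u F \<gamma> D) (energy A U u F) (u p, y))"

end

theory Submission
  imports Defs
begin

text \<open>
  Parallel transport along straight lines of a chart is the flow of a linear differential equation,
  and a compatible connection makes it a linear isometry of the Finsler norms. Differentiating \<open>F\<close> along
  parallel vectors shows that horizontal vectors annihilate \<open>E\<close>. The integral over the indicatrix is
  invariant under linear maps, because it is a volume integral over the unit ball in polar form; so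
  parallel transport also preserves the averaged metric \<open>\<gamma>\<close>. This gives the first derivatives of the
  matrix of \<open>\<gamma>\<close> in terms of the matrix itself and the Christoffel symbols, hence \<open>\<gamma>\<close> is smooth and
  \<open>\<nabla>\<close> is metric for \<open>\<gamma>\<close>.

  Therefore the lowered difference of \<open>\<nabla>\<close> and \<open>\<nabla>\<^sup>*\<close> is skew in its last two arguments, and with
  antisymmetric torsion it is a 3-form, that is, \<open>\<nabla> - \<nabla>\<^sup>* = c \<times>\<^sub>\<gamma>\<close> at each point. Then the horizontal fields
  of \<open>\<nabla>\<^sup>*\<close> satisfy \<open>X\<^sub>i E = 2 c V\<^sub>i E\<close>, and integration of \<open>\<Sum>\<^sub>i (V\<^sub>i E) (X\<^sub>i E)\<close> gives \<open>2 c \<sigma> = \<integral> V E \<mu>\<close>.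
  If \<open>\<sigma> = 0\<close> at a point, then \<open>dE\<close> vanishes on the \<open>\<gamma>\<close>-orthogonal complement of each \<open>y\<close>, so \<open>E / \<gamma>(y, y)\<close> is
  constant and \<open>F\<close> is quadratic there; by parallel transport and connectedness it would be
  quadratic everywhere.
\<close>

section \<open>Calculus of smooth maps\<close>

text \<open>The obstacle is the regularity of \<gamma>. Tangent vectors return 0 on functions that
  are not smooth, so the metric condition on the Levi-Civita connection says nothing about
  derivatives until the Gram matrix \<open>G\<close> of \<gamma> is known to be smooth.
  Differentiation under the indicatrix integral is avoided: transport expresses \<open>G\<close> at
  nearby points through its value at one point, only the flow is differentiated, and the resulting
  linear first-order system with smooth coefficients lifts continuity to smoothness. Linear
  invariance of the integral rests on a cancellation: \<open>det g\<close> acquires the factor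
  \<open>(det L)^2\<close>, whose root is the Jacobian of the substitution in the ball. A single
  scalar \<open>c\<close> suffices because in dimension three every 3-form is a multiple of the
  volume form. The relation \<open>X_i E = 2 c V_i E\<close> already holds at each nonzero vector;
  integrating against \<open>V_i E\<close> yields a formula for \<open>c\<close> whose denominator
  vanishes only if all \<open>V_i E\<close> do. The factor 2 compensates the 1/2 in
  \<open>V_i\<close>, so \<open>f = 2 c\<close> and \<open>f / 2 = c\<close>.\<close>

lemma has_derivative_cong_open:
  assumes "open S" "x \<in> S" "\<And>y. y \<in> S \<Longrightarrow> f y = g y"
  shows "(f has_derivative D) (at x) \<longleftrightarrow> (g has_derivative D) (at x)"
  using assms has_derivative_transform_within_open[of f D x UNIV S g]
    has_derivative_transform_within_open[of g D x UNIV S f] by auto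

lemma frechet_derivative_cong_open:
  assumes "open S" "x \<in> S" "\<And>y. y \<in> S \<Longrightarrow> f y = g y"
  shows "frechet_derivative f (at x) = frechet_derivative g (at x)"
  unfolding frechet_derivative_def using has_derivative_cong_open[OF assms] by simp

lemma times_differentiable_on_cong:
  assumes "open S" "\<And>x. x \<in> S \<Longrightarrow> f x = g x"
  shows "times_differentiable_on n S f \<longleftrightarrow> times_differentiable_on n S g"
  using assms(2)
proof (induction n arbitrary: f g)
  case 0
  then show ?case by (auto cong: continuous_on_cong)
next
  case (Suc n)
  have 1: "f differentiable (at x) \<longleftrightarrow> g differentiable (at x)" if "x \<in> S" for x
    unfolding differentiable_def using has_derivative_cong_open[OF assms(1) that Suc.prems] by simp
  have 2: "frechet_derivative f (at x) = frechet_derivative g (at x)" if "x \<in> S" for x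
    using frechet_derivative_cong_open[OF assms(1) that Suc.prems] by simp
  show ?case
    using 1 Suc.IH[of "\<lambda>x. frechet_derivative f (at x) v" "\<lambda>x. frechet_derivative g (at x) v" for v] 2
    by simp
qed

text \<open>Lets an explicit derivative stand in for the chosen \<open>frechet_derivative\<close>;
  on an open set both agree at every point, so the recursion may continue with either. Most closure
  rules below are inductions through this rule.\<close>

lemma times_differentiable_on_SucI:
  assumes "open S" "\<And>x. x \<in> S \<Longrightarrow> (f has_derivative f' x) (at x)"
    "\<And>v. times_differentiable_on n S (\<lambda>x. f' x v)"
  shows "times_differentiable_on (Suc n) S f"
proof -
  have "f' x = frechet_derivative f (at x)" if "x \<in> S" for x
    using assms(2)[OF that] by (rule frechet_derivative_at)
  then have "times_differentiable_on n S (\<lambda>x. f' x v) =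
      times_differentiable_on n S (\<lambda>x. frechet_derivative f (at x) v)" for v
    by (intro times_differentiable_on_cong[OF assms(1)]) auto
  then show ?thesis using assms(2,3) by (auto simp: differentiable_def)
qed

lemma times_differentiable_on_SucD:
  assumes "times_differentiable_on (Suc n) S f"
  shows "x \<in> S \<Longrightarrow> (f has_derivative frechet_derivative f (at x)) (at x)"
    and "times_differentiable_on n S (\<lambda>x. frechet_derivative f (at x) v)"
  using assms by (auto simp: frechet_derivative_works[symmetric])

lemma times_differentiable_on_Suc_mono:
  "times_differentiable_on (Suc n) S f \<Longrightarrow> times_differentiable_on n S f"
proof (induction n arbitrary: f)
  case 0
  then show ?case
    by (auto intro!: continuous_at_imp_continuous_on differentiable_imp_continuous_within)
qed auto

lemma times_differentiable_on_subset:
  "times_differentiable_on n S f \<Longrightarrow> T \<subseteq> S \<Longrightarrow> times_differentiable_on n T f"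
  by (induction n arbitrary: f) (auto intro: continuous_on_subset)

lemma times_differentiable_on_local:
  assumes "\<And>x. x \<in> S \<Longrightarrow> \<exists>T. open T \<and> x \<in> T \<and> times_differentiable_on n T f"
  shows "times_differentiable_on n S f"
  using assms
proof (induction n arbitrary: f)
  case 0
  then show ?case
    by (auto intro!: continuous_at_imp_continuous_on) (metis continuous_on_eq_continuous_at)
next
  case (Suc n)
  then show ?case by fastforce
qed

lemma times_differentiable_on_const:
  "open S \<Longrightarrow> times_differentiable_on n S (\<lambda>x. c)"
proof (induction n arbitrary: c)
  case (Suc n)
  then show ?case
    by (intro times_differentiable_on_SucI[where f' = "\<lambda>x v. 0"]) (auto intro!: derivative_eq_intros)
qed auto

lemma times_differentiable_on_linear:
  assumes "bounded_linear L" "open S"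
  shows "times_differentiable_on n S f \<Longrightarrow> times_differentiable_on n S (\<lambda>x. L (f x))"
proof (induction n arbitrary: f)
  case 0
  then show ?case using assms by (auto intro: bounded_linear.continuous_on)
next
  case (Suc n)
  show ?case
    by (rule times_differentiable_on_SucI[OF assms(2), where f' = "\<lambda>x v. L (frechet_derivative f (at x) v)"])
      (auto intro!: bounded_linear.has_derivative[OF assms(1)] Suc.IH
        times_differentiable_on_SucD[OF Suc.prems])
qed

lemma times_differentiable_on_add:
  assumes "open S"
  shows "times_differentiable_on n S f \<Longrightarrow> times_differentiable_on n S g \<Longrightarrow>
    times_differentiable_on n S (\<lambda>x. f x + g x)"
proof (induction n arbitrary: f g)
  case 0
  then show ?case by (auto intro: continuous_intros)
next
  case (Suc n)
  show ?case
    by (rule times_differentiable_on_SucI[OF assms(1),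
          where f' = "\<lambda>x v. frechet_derivative f (at x) v + frechet_derivative g (at x) v"])
      (auto intro!: has_derivative_add Suc.IH
        times_differentiable_on_SucD[OF Suc.prems(1)] times_differentiable_on_SucD[OF Suc.prems(2)])
qed

lemma times_differentiable_on_sum:
  assumes "open S"
  shows "(\<And>i. i \<in> I \<Longrightarrow> times_differentiable_on n S (f i)) \<Longrightarrow>
    times_differentiable_on n S (\<lambda>x. \<Sum>i\<in>I. f i x)"
  by (induction I rule: infinite_finite_induct)
    (auto intro: times_differentiable_on_const times_differentiable_on_add assms)

lemma times_differentiable_on_bilinear:
  assumes "bounded_bilinear B" "open S"
  shows "times_differentiable_on n S f \<Longrightarrow> times_differentiable_on n S g \<Longrightarrow>
    times_differentiable_on n S (\<lambda>x. B (f x) (g x))"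
proof (induction n arbitrary: f g)
  case 0
  then show ?case using assms by (auto intro: bounded_bilinear.continuous_on)
next
  case (Suc n)
  show ?case
    by (rule times_differentiable_on_SucI[OF assms(2),
          where f' = "\<lambda>x v. B (f x) (frechet_derivative g (at x) v) + B (frechet_derivative f (at x) v) (g x)"])
      (intro bounded_bilinear.FDERIV[OF assms(1)] Suc.IH times_differentiable_on_add assms
        times_differentiable_on_SucD[OF Suc.prems(1)] times_differentiable_on_SucD[OF Suc.prems(2)]
        times_differentiable_on_Suc_mono[OF Suc.prems(1)] times_differentiable_on_Suc_mono[OF Suc.prems(2)];
       assumption)+
qed

text \<open>\<open>times_differentiable_on\<close> controls derivatives in a fixed direction only.
  Expansion in the basis reduces a direction that varies with the point to fixed ones.\<close>

lemma linear_sum_Basis: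
  fixes L :: "'a::euclidean_space \<Rightarrow> 'b::real_vector"
  assumes "linear L"
  shows "L w = (\<Sum>b\<in>Basis. (w \<bullet> b) *\<^sub>R L b)"
proof -
  have "L w = L (\<Sum>b\<in>Basis. (w \<bullet> b) *\<^sub>R b)" by (simp add: euclidean_representation)
  also have "\<dots> = (\<Sum>b\<in>Basis. (w \<bullet> b) *\<^sub>R L b)"
    using assms by (simp add: linear_sum linear_scale)
  finally show ?thesis .
qed

text \<open>The derivative is a sum of products of components of the derivative of \<open>f\<close>
  with functions \<open>?g' (f x) b\<close>. The latter are again compositions with the same
  \<open>f\<close>, so the induction generalises over \<open>g\<close> alone.\<close>

lemma times_differentiable_on_compose:
  fixes f :: "'a::real_normed_vector \<Rightarrow> 'b::euclidean_space" and g :: "'b \<Rightarrow> 'c::real_normed_vector"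
  assumes "open S" "open T" "f ` S \<subseteq> T"
  shows "times_differentiable_on n S f \<Longrightarrow> times_differentiable_on n T g \<Longrightarrow>
    times_differentiable_on n S (\<lambda>x. g (f x))"
proof (induction n arbitrary: g)
  case 0
  then show ?case using assms by (auto intro: continuous_on_compose2)
next
  case (Suc n)
  let ?f' = "\<lambda>x. frechet_derivative f (at x)" and ?g' = "\<lambda>x. frechet_derivative g (at x)"
  note f = times_differentiable_on_SucD[OF Suc.prems(1)]
  note g = times_differentiable_on_SucD[OF Suc.prems(2)]
  show ?case
  proof (rule times_differentiable_on_SucI[OF assms(1), where f' = "\<lambda>x v. \<Sum>b\<in>Basis. (?f' x v \<bullet> b) *\<^sub>R ?g' (f x) b"])
    fix x assume x: "x \<in> S"
    then have "f x \<in> T" using assms by auto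
    have "linear (?g' (f x))" using g(1)[OF \<open>f x \<in> T\<close>] has_derivative_linear by blast
    then have "(\<Sum>b\<in>Basis. (?f' x v \<bullet> b) *\<^sub>R ?g' (f x) b) = ?g' (f x) (?f' x v)" for v
      by (rule linear_sum_Basis[symmetric])
    then show "((\<lambda>x. g (f x)) has_derivative (\<lambda>v. \<Sum>b\<in>Basis. (?f' x v \<bullet> b) *\<^sub>R ?g' (f x) b)) (at x)"
      using has_derivative_compose[OF f(1)[OF x] g(1)[OF \<open>f x \<in> T\<close>]] by simp
  next
    fix v
    show "times_differentiable_on n S (\<lambda>x. \<Sum>b\<in>Basis. (?f' x v \<bullet> b) *\<^sub>R ?g' (f x) b)"
      by (rule times_differentiable_on_sum[OF assms(1)],
          rule times_differentiable_on_bilinear[OF bounded_bilinear_scaleR assms(1)],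
          rule times_differentiable_on_linear[OF bounded_linear_inner_left assms(1) f(2)],
          rule Suc.IH[OF times_differentiable_on_Suc_mono[OF Suc.prems(1)] g(2)])
  qed
qed

lemma smooth_on_cong:
  "open S \<Longrightarrow> (\<And>x. x \<in> S \<Longrightarrow> f x = g x) \<Longrightarrow> smooth_on S f \<longleftrightarrow> smooth_on S g"
  unfolding smooth_on_def using times_differentiable_on_cong[of S f g] by simp

lemma smooth_on_subset: "smooth_on S f \<Longrightarrow> T \<subseteq> S \<Longrightarrow> smooth_on T f"
  unfolding smooth_on_def using times_differentiable_on_subset by blast

lemma smooth_on_local:
  assumes "\<And>x. x \<in> S \<Longrightarrow> \<exists>T. open T \<and> x \<in> T \<and> smooth_on T f"
  shows "smooth_on S f"
  unfolding smooth_on_def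
proof
  fix n
  have "\<exists>T. open T \<and> x \<in> T \<and> times_differentiable_on n T f" if "x \<in> S" for x
    using assms[OF that] unfolding smooth_on_def by auto
  then show "times_differentiable_on n S f" by (rule times_differentiable_on_local)
qed

lemma smooth_on_const: "open S \<Longrightarrow> smooth_on S (\<lambda>x. c)"
  by (simp add: smooth_on_def times_differentiable_on_const)

lemma smooth_on_linear:
  "bounded_linear L \<Longrightarrow> open S \<Longrightarrow> smooth_on S f \<Longrightarrow> smooth_on S (\<lambda>x. L (f x))"
  by (simp add: smooth_on_def times_differentiable_on_linear)

lemma smooth_on_id: "open S \<Longrightarrow> smooth_on S (\<lambda>x. x)"
  unfolding smooth_on_def
proof
  fix n assume "open S"
  then show "times_differentiable_on n S (\<lambda>x. x)"
  proof (cases n)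
    case (Suc m)
    with \<open>open S\<close> show ?thesis
      by (auto intro!: times_differentiable_on_SucI[where f' = "\<lambda>x v. v"] times_differentiable_on_const)
  qed auto
qed

lemma smooth_on_add:
  "open S \<Longrightarrow> smooth_on S f \<Longrightarrow> smooth_on S g \<Longrightarrow> smooth_on S (\<lambda>x. f x + g x)"
  by (simp add: smooth_on_def times_differentiable_on_add)

lemma smooth_on_sum:
  "open S \<Longrightarrow> (\<And>i. i \<in> I \<Longrightarrow> smooth_on S (f i)) \<Longrightarrow> smooth_on S (\<lambda>x. \<Sum>i\<in>I. f i x)"
  by (simp add: smooth_on_def times_differentiable_on_sum)

lemma smooth_on_bilinear:
  "bounded_bilinear B \<Longrightarrow> open S \<Longrightarrow> smooth_on S f \<Longrightarrow> smooth_on S g \<Longrightarrow> smooth_on S (\<lambda>x. B (f x) (g x))"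
  by (simp add: smooth_on_def times_differentiable_on_bilinear)

lemmas smooth_on_mult = smooth_on_bilinear[OF bounded_bilinear_mult]
  and smooth_on_scaleR = smooth_on_bilinear[OF bounded_bilinear_scaleR]

lemma smooth_on_compose:
  fixes f :: "'a::real_normed_vector \<Rightarrow> 'b::euclidean_space" and g :: "'b \<Rightarrow> 'c::real_normed_vector"
  assumes "open S" "open T" "f ` S \<subseteq> T" "smooth_on S f" "smooth_on T g"
  shows "smooth_on S (\<lambda>x. g (f x))"
  using assms(4,5) times_differentiable_on_compose[OF assms(1-3)] unfolding smooth_on_def by blast

lemma smooth_on_vec_nth:
  "open S \<Longrightarrow> smooth_on S f \<Longrightarrow> smooth_on S (\<lambda>x. f x $ i)"
  by (rule smooth_on_linear[OF bounded_linear_vec_nth])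

lemma smooth_on_Pair:
  fixes f :: "'a::real_normed_vector \<Rightarrow> 'b::real_normed_vector" and g :: "'a \<Rightarrow> 'c::real_normed_vector"
  assumes "open S" "smooth_on S f" "smooth_on S g"
  shows "smooth_on S (\<lambda>x. (f x, g x))"
proof -
  have "bounded_linear (\<lambda>v. (v, 0::'c))" "bounded_linear (\<lambda>v. (0::'b, v))"
    by (intro bounded_linear_Pair bounded_linear_ident bounded_linear_zero)+
  from smooth_on_add[OF assms(1) smooth_on_linear[OF this(1) assms(1,2)] smooth_on_linear[OF this(2) assms(1,3)]]
  show ?thesis by simp
qed

lemma smooth_on_frechet:
  "smooth_on S f \<Longrightarrow> smooth_on S (\<lambda>x. frechet_derivative f (at x) v)"
  unfolding smooth_on_def using times_differentiable_on.simps(2) by blast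

lemma smooth_on_imp_has_derivative:
  "smooth_on S f \<Longrightarrow> x \<in> S \<Longrightarrow> (f has_derivative frechet_derivative f (at x)) (at x)"
  unfolding smooth_on_def using times_differentiable_on_SucD(1) by blast

lemma smooth_on_imp_linear_frechet:
  "smooth_on S f \<Longrightarrow> x \<in> S \<Longrightarrow> linear (frechet_derivative f (at x))"
  using smooth_on_imp_has_derivative has_derivative_linear by blast

lemma smooth_on_imp_continuous_on: "smooth_on S f \<Longrightarrow> continuous_on S f"
  unfolding smooth_on_def using times_differentiable_on.simps(1) by blast

lemma smooth_on_frechet_apply:
  fixes f :: "'b::euclidean_space \<Rightarrow> 'c::real_normed_vector" and h w :: "'a::real_normed_vector \<Rightarrow> 'b"
  assumes "open S" "open T" "smooth_on T f" "smooth_on S h" "smooth_on S w" "h ` S \<subseteq> T"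
  shows "smooth_on S (\<lambda>x. frechet_derivative f (at (h x)) (w x))"
proof -
  have "smooth_on S (\<lambda>x. \<Sum>b\<in>Basis. (w x \<bullet> b) *\<^sub>R frechet_derivative f (at (h x)) b)"
    by (intro smooth_on_sum smooth_on_scaleR smooth_on_linear[OF bounded_linear_inner_left] assms
        smooth_on_compose[OF assms(1,2,6), where g = "\<lambda>y. frechet_derivative f (at y) b" for b]
        smooth_on_frechet)
  moreover have "(\<Sum>b\<in>Basis. (w x \<bullet> b) *\<^sub>R frechet_derivative f (at (h x)) b) =
      frechet_derivative f (at (h x)) (w x)" if "x \<in> S" for x
    by (rule linear_sum_Basis[symmetric], rule smooth_on_imp_linear_frechet[OF assms(3)])
      (use that assms(6) in auto)
  ultimately show ?thesis by (rule smooth_on_cong[OF assms(1), THEN iffD1, rotated])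
qed

text \<open>The mean value theorem is applied first in direction \<open>a\<close> to a difference in
  direction \<open>b\<close>, then in direction \<open>b\<close>. The left-hand side is symmetric in
  \<open>a\<close> and \<open>b\<close>, although the derivative on the right is not visibly
  so.\<close>

lemma second_difference_mvt:
  fixes f :: "'a::euclidean_space \<Rightarrow> real"
  assumes sm: "smooth_on S f" and t: "t > 0"
    and S: "\<And>r s. 0 \<le> r \<Longrightarrow> r \<le> t \<Longrightarrow> 0 \<le> s \<Longrightarrow> s \<le> t \<Longrightarrow> x + r *\<^sub>R a + s *\<^sub>R b \<in> S"
  shows "\<exists>r s. 0 \<le> r \<and> r \<le> t \<and> 0 \<le> s \<and> s \<le> t \<and>
    f (x + t *\<^sub>R a + t *\<^sub>R b) - f (x + t *\<^sub>R a) - f (x + t *\<^sub>R b) + f x =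
      t * (t * frechet_derivative (\<lambda>y. frechet_derivative f (at y) a) (at (x + r *\<^sub>R a + s *\<^sub>R b)) b)"
proof -
  let ?f' = "\<lambda>y. frechet_derivative f (at y)"
  let ?f'' = "\<lambda>y. frechet_derivative (\<lambda>y. frechet_derivative f (at y) a) (at y)"
  define p where "p = (\<lambda>r. f (x + r *\<^sub>R a + t *\<^sub>R b) - f (x + r *\<^sub>R a))"
  have d1: "((\<lambda>r. f (x + r *\<^sub>R a + s *\<^sub>R b)) has_real_derivative ?f' (x + r *\<^sub>R a + s *\<^sub>R b) a) (at r)"
    if "0 \<le> r" "r \<le> t" "0 \<le> s" "s \<le> t" for r s
  proof -
    have "((\<lambda>r. x + r *\<^sub>R a + s *\<^sub>R b) has_derivative (\<lambda>h. h *\<^sub>R a)) (at r)"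
      by (auto intro!: derivative_eq_intros)
    from has_derivative_compose[OF this smooth_on_imp_has_derivative[OF sm S[OF that]]]
    have "((\<lambda>r. f (x + r *\<^sub>R a + s *\<^sub>R b)) has_derivative (\<lambda>h. ?f' (x + r *\<^sub>R a + s *\<^sub>R b) (h *\<^sub>R a))) (at r)" .
    moreover have "?f' (x + r *\<^sub>R a + s *\<^sub>R b) (h *\<^sub>R a) = ?f' (x + r *\<^sub>R a + s *\<^sub>R b) a * h" for h
      using smooth_on_imp_linear_frechet[OF sm S[OF that]] by (simp add: linear_scale)
    ultimately show ?thesis by (simp add: has_field_derivative_def)
  qed
  have d2: "((\<lambda>s. ?f' (x + r *\<^sub>R a + s *\<^sub>R b) a) has_real_derivative ?f'' (x + r *\<^sub>R a + s *\<^sub>R b) b) (at s)"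
    if "0 \<le> r" "r \<le> t" "0 \<le> s" "s \<le> t" for r s
  proof -
    note sm' = smooth_on_frechet[OF sm, of a]
    have "((\<lambda>s. x + r *\<^sub>R a + s *\<^sub>R b) has_derivative (\<lambda>h. h *\<^sub>R b)) (at s)"
      by (auto intro!: derivative_eq_intros)
    from has_derivative_compose[OF this smooth_on_imp_has_derivative[OF sm' S[OF that]]]
    have "((\<lambda>s. ?f' (x + r *\<^sub>R a + s *\<^sub>R b) a) has_derivative (\<lambda>h. ?f'' (x + r *\<^sub>R a + s *\<^sub>R b) (h *\<^sub>R b))) (at s)" .
    moreover have "?f'' (x + r *\<^sub>R a + s *\<^sub>R b) (h *\<^sub>R b) = ?f'' (x + r *\<^sub>R a + s *\<^sub>R b) b * h" for h
      using smooth_on_imp_linear_frechet[OF sm' S[OF that]] by (simp add: linear_scale)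
    ultimately show ?thesis by (simp add: has_field_derivative_def)
  qed
  have "\<exists>r. 0 < r \<and> r < t \<and> p t - p 0 = (t - 0) * (?f' (x + r *\<^sub>R a + t *\<^sub>R b) a - ?f' (x + r *\<^sub>R a) a)"
    unfolding p_def
  proof (rule MVT2[OF t])
    fix r assume r: "0 \<le> r" "r \<le> t"
    show "((\<lambda>r. f (x + r *\<^sub>R a + t *\<^sub>R b) - f (x + r *\<^sub>R a)) has_real_derivative
        ?f' (x + r *\<^sub>R a + t *\<^sub>R b) a - ?f' (x + r *\<^sub>R a) a) (at r)"
      using DERIV_diff[OF d1[of r t] d1[of r 0]] r t by simp
  qed
  then obtain r where r: "0 < r" "r < t"
    "p t - p 0 = t * (?f' (x + r *\<^sub>R a + t *\<^sub>R b) a - ?f' (x + r *\<^sub>R a) a)" by auto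
  have "\<exists>s. 0 < s \<and> s < t \<and> ?f' (x + r *\<^sub>R a + t *\<^sub>R b) a - ?f' (x + r *\<^sub>R a + 0 *\<^sub>R b) a =
      (t - 0) * ?f'' (x + r *\<^sub>R a + s *\<^sub>R b) b"
    by (rule MVT2[OF t]) (use d2 r in auto)
  then obtain s where s: "0 < s" "s < t"
    "?f' (x + r *\<^sub>R a + t *\<^sub>R b) a - ?f' (x + r *\<^sub>R a) a = t * ?f'' (x + r *\<^sub>R a + s *\<^sub>R b) b" by auto
  have "p t - p 0 = t * (t * ?f'' (x + r *\<^sub>R a + s *\<^sub>R b) b)" using r s by simp
  then show ?thesis using r s unfolding p_def
    by (intro exI[of _ r] exI[of _ s]) simp
qed

text \<open>Both mixed derivatives, taken at suitable intermediate points, equal the same second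
  difference divided by the square of \<open>t\<close>; continuity of the mixed derivatives moves
  the intermediate points to \<open>x\<close>.\<close>

lemma second_derivative_symmetric:
  fixes f :: "'a::euclidean_space \<Rightarrow> real"
  assumes "open S" "smooth_on S f" "x \<in> S"
  shows "frechet_derivative (\<lambda>y. frechet_derivative f (at y) a) (at x) b =
    frechet_derivative (\<lambda>y. frechet_derivative f (at y) b) (at x) a"
proof -
  define P where "P = (\<lambda>y. frechet_derivative (\<lambda>y. frechet_derivative f (at y) a) (at y) b)"
  define Q where "Q = (\<lambda>y. frechet_derivative (\<lambda>y. frechet_derivative f (at y) b) (at y) a)"
  have "isCont P x" "isCont Q x" unfolding P_def Q_def
    using smooth_on_imp_continuous_on[OF smooth_on_frechet[OF smooth_on_frechet[OF assms(2)]]]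
      assms(1,3) continuous_on_eq_continuous_at by blast+
  have "\<bar>P x - Q x\<bar> \<le> e" if "e > 0" for e
  proof -
    from \<open>isCont P x\<close> obtain d1 where d1: "d1 > 0" "\<And>y. dist y x < d1 \<Longrightarrow> dist (P y) (P x) < e/2"
      unfolding continuous_at_eps_delta using \<open>e > 0\<close> by (metis half_gt_zero)
    from \<open>isCont Q x\<close> obtain d2 where d2: "d2 > 0" "\<And>y. dist y x < d2 \<Longrightarrow> dist (Q y) (Q x) < e/2"
      unfolding continuous_at_eps_delta using \<open>e > 0\<close> by (metis half_gt_zero)
    obtain d3 where d3: "d3 > 0" "ball x d3 \<subseteq> S" using assms(1,3) open_contains_ball by blast
    define d where "d = min d1 (min d2 d3)"
    have d: "d > 0" using d1 d2 d3 by (simp add: d_def)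
    \<comment> \<open>The summand 1 keeps \<open>N\<close> positive when both directions vanish.
      With \<open>t = d / (2 * N)\<close> the whole parallelogram stays within distance
      \<open>d / 2\<close> of \<open>x\<close>.\<close>
    define N where "N = norm a + norm b + 1"
    define t where "t = d / (2 * N)"
    have na: "N > 0" by (simp add: N_def add_nonneg_pos)
    have t: "t > 0" using d na by (simp add: t_def)
    have near: "dist (x + r *\<^sub>R a + s *\<^sub>R b) x < d" if "0 \<le> r" "r \<le> t" "0 \<le> s" "s \<le> t" for r s
    proof -
      have "dist (x + r *\<^sub>R a + s *\<^sub>R b) x = norm (r *\<^sub>R a + s *\<^sub>R b)"
        by (simp add: dist_norm add.assoc)
      also have "\<dots> \<le> norm (r *\<^sub>R a) + norm (s *\<^sub>R b)" by (rule norm_triangle_ineq)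
      also have "\<dots> \<le> t * norm a + t * norm b" using that by (intro add_mono) (auto intro!: mult_right_mono)
      also have "\<dots> \<le> t * N" using t by (simp add: N_def algebra_simps)
      also have "\<dots> = d / 2" using na by (simp add: t_def)
      also have "\<dots> < d" using d by simp
      finally show ?thesis .
    qed
    have inS: "x + r *\<^sub>R a + s *\<^sub>R b \<in> S" if "0 \<le> r" "r \<le> t" "0 \<le> s" "s \<le> t" for r s
      using near[OF that] d3 by (auto simp: d_def dist_commute subset_iff)
    from second_difference_mvt[OF assms(2) t inS] obtain r s where rs: "0 \<le> r" "r \<le> t" "0 \<le> s" "s \<le> t"
      "f (x + t *\<^sub>R a + t *\<^sub>R b) - f (x + t *\<^sub>R a) - f (x + t *\<^sub>R b) + f x = t * (t * P (x + r *\<^sub>R a + s *\<^sub>R b))"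
      unfolding P_def by blast
    have inS': "x + r *\<^sub>R b + s *\<^sub>R a \<in> S" if "0 \<le> r" "r \<le> t" "0 \<le> s" "s \<le> t" for r s
      using inS[of s r] that by (simp add: add.assoc add.commute add.left_commute)
    from second_difference_mvt[OF assms(2) t inS'] obtain r' s' where rs': "0 \<le> r'" "r' \<le> t" "0 \<le> s'" "s' \<le> t"
      "f (x + t *\<^sub>R b + t *\<^sub>R a) - f (x + t *\<^sub>R b) - f (x + t *\<^sub>R a) + f x = t * (t * Q (x + r' *\<^sub>R b + s' *\<^sub>R a))"
      unfolding Q_def by blast
    have "x + t *\<^sub>R b + t *\<^sub>R a = x + t *\<^sub>R a + t *\<^sub>R b" by simp
    then have "t * (t * P (x + r *\<^sub>R a + s *\<^sub>R b)) = t * (t * Q (x + r' *\<^sub>R b + s' *\<^sub>R a))"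
      using rs(5) rs'(5) by (metis (no_types, lifting) add.commute diff_diff_eq)
    then have PQ: "P (x + r *\<^sub>R a + s *\<^sub>R b) = Q (x + r' *\<^sub>R b + s' *\<^sub>R a)" using t by simp
    have "dist (x + r' *\<^sub>R b + s' *\<^sub>R a) x < d"
      using near[OF rs'(3,4,1,2)] by (simp add: add.assoc add.commute add.left_commute)
    then have "dist (P (x + r *\<^sub>R a + s *\<^sub>R b)) (P x) < e/2" "dist (Q (x + r' *\<^sub>R b + s' *\<^sub>R a)) (Q x) < e/2"
      using near[OF rs(1-4)] d1(2) d2(2) by (auto simp: d_def)
    then show ?thesis using PQ unfolding dist_real_def by linarith
  qed
  then have "\<bar>P x - Q x\<bar> \<le> 0" by (rule field_le_epsilon) simp
  then show ?thesis by (simp add: P_def Q_def)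
qed

text \<open>Differentiation under the integral produces a further factor \<open>t\<close>, the inner
  derivative of the radial map, and replaces \<open>h\<close> by one of its directional derivatives.
  The powers \<open>t ^ k\<close> are there to make the induction close.\<close>

lemma times_differentiable_on_radial_integral:
  fixes h :: "'a::euclidean_space \<Rightarrow> real"
  assumes "smooth_on (ball x0 r) h"
  shows "times_differentiable_on n (ball x0 r) (\<lambda>x. integral (cbox 0 1) (\<lambda>t. t ^ k * h (x0 + t *\<^sub>R (x - x0))))"
  using assms
proof (induction n arbitrary: k h)
  have seg: "x0 + t *\<^sub>R (x - x0) \<in> ball x0 r" if "x \<in> ball x0 r" "t \<in> cbox 0 1" for x t
  proof -
    have "norm (t *\<^sub>R (x - x0)) \<le> 1 * norm (x - x0)"
      using that(2) unfolding norm_scaleR by (intro mult_right_mono) auto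
    then show ?thesis using that(1) by (simp add: dist_norm norm_minus_commute)
  qed
  have cont_z: "continuous_on (ball x0 r \<times> cbox 0 1) (\<lambda>z. g (x0 + snd z *\<^sub>R (fst z - x0)))"
    if "smooth_on (ball x0 r) g" for g :: "'a \<Rightarrow> real"
    by (rule continuous_on_compose2[OF smooth_on_imp_continuous_on[OF that]])
      (use seg in \<open>auto intro!: continuous_intros\<close>)
  have cont: "continuous_on (ball x0 r \<times> cbox 0 1) (\<lambda>(x, t). t ^ k * g (x0 + t *\<^sub>R (x - x0)))"
    if "smooth_on (ball x0 r) g" for g :: "'a \<Rightarrow> real" and k
    unfolding split_beta by (intro continuous_intros cont_z[OF that])
  {
    case 0
    show ?case using integral_continuous_on_param[OF cont[OF 0]] by simp
  next
    case (Suc n)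
    let ?z = "\<lambda>x t. x0 + t *\<^sub>R (x - x0)"
    let ?D = "\<lambda>y. frechet_derivative h (at y)"
    \<comment> \<open>The Leibniz rule wants the derivative as a bounded linear map that is jointly
      continuous in \<open>(x, t)\<close>; written as a combination of coordinate functionals, its
      continuity reduces to that of the coefficients.\<close>
    define F where "F = (\<lambda>x t. t ^ Suc k *\<^sub>R (\<Sum>b\<in>Basis. ?D (?z x t) b *\<^sub>R blinfun_inner_left b))"
    have F_apply: "blinfun_apply (F x t) v = t ^ Suc k * ?D (?z x t) v"
      if "x \<in> ball x0 r" "t \<in> cbox 0 1" for x t v
    proof -
      have "?D (?z x t) v = (\<Sum>b\<in>Basis. (v \<bullet> b) *\<^sub>R ?D (?z x t) b)"
        by (rule linear_sum_Basis[OF smooth_on_imp_linear_frechet[OF Suc.prems seg[OF that]]])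
      then show ?thesis
        by (simp add: F_def blinfun.sum_left blinfun.scaleR_left inner_commute mult.commute)
    qed
    have cont_F: "continuous_on (ball x0 r \<times> cbox 0 1) (\<lambda>(x, t). F x t)"
      unfolding F_def split_beta
      by (intro continuous_intros cont_z[OF smooth_on_frechet[OF Suc.prems]])
    have der: "((\<lambda>x. t ^ k * h (?z x t)) has_derivative blinfun_apply (F x t)) (at x within ball x0 r)"
      if "x \<in> ball x0 r" "t \<in> cbox 0 1" for x t
    proof -
      have "((\<lambda>x. ?z x t) has_derivative (\<lambda>v. t *\<^sub>R v)) (at x within ball x0 r)"
        by (auto intro!: derivative_eq_intros)
      from has_derivative_mult_right[OF has_derivative_compose[OF this smooth_on_imp_has_derivative[OF Suc.prems seg[OF that]]], of "t ^ k"]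
      have "((\<lambda>x. t ^ k * h (?z x t)) has_derivative (\<lambda>v. t ^ k * ?D (?z x t) (t *\<^sub>R v))) (at x within ball x0 r)" .
      moreover have "(\<lambda>v. t ^ k * ?D (?z x t) (t *\<^sub>R v)) = blinfun_apply (F x t)"
        using smooth_on_imp_linear_frechet[OF Suc.prems seg[OF that]]
        by (auto simp: fun_eq_iff F_apply[OF that] linear_scale)
      ultimately show ?thesis by simp
    qed
    show ?case
    proof (rule times_differentiable_on_SucI[where f' = "\<lambda>x v. integral (cbox 0 1) (\<lambda>t. t ^ Suc k * ?D (?z x t) v)"])
      fix x assume x: "x \<in> ball x0 r"
      have int: "(\<lambda>t. t ^ k * h (?z y t)) integrable_on cbox 0 1" if "y \<in> ball x0 r" for y
        by (rule integrable_continuous, rule continuous_on_compose2[OF cont[OF Suc.prems], of _ "\<lambda>t. (y, t)", simplified])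
          (use that in \<open>auto intro!: continuous_intros\<close>)
      have intF: "F x integrable_on cbox 0 1"
        by (rule integrable_continuous, rule continuous_on_compose2[OF cont_F, of _ "\<lambda>t. (x, t)", simplified])
          (use x in \<open>auto intro!: continuous_intros\<close>)
      have "((\<lambda>x. integral (cbox 0 1) (\<lambda>t. t ^ k * h (?z x t))) has_derivative
          blinfun_apply (integral (cbox 0 1) (F x))) (at x within ball x0 r)"
        by (rule leibniz_rule[OF der int cont_F x convex_ball]) auto
      moreover have "blinfun_apply (integral (cbox 0 1) (F x)) =
          (\<lambda>v. integral (cbox 0 1) (\<lambda>t. t ^ Suc k * ?D (?z x t) v))"
        unfolding blinfun_apply_integral[OF intF]
        by (intro ext integral_cong F_apply[OF x])
      moreover have "at x within ball x0 r = at x" by (rule at_within_open[OF x]) simp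
      ultimately show "((\<lambda>x. integral (cbox 0 1) (\<lambda>t. t ^ k * h (?z x t))) has_derivative
          (\<lambda>v. integral (cbox 0 1) (\<lambda>t. t ^ Suc k * ?D (?z x t) v))) (at x)"
        by (simp only:)
    next
      fix v
      show "times_differentiable_on n (ball x0 r) (\<lambda>x. integral (cbox 0 1) (\<lambda>t. t ^ Suc k * ?D (?z x t) v))"
        by (rule Suc.IH[OF smooth_on_frechet[OF Suc.prems]])
    qed simp
  }
qed

text \<open>Integrate the derivative of \<open>f\<close> along the segment from \<open>x0\<close> to
  \<open>x\<close> and pull the components of \<open>x - x0\<close> out of the integral. This is
  what identifies abstract derivations with coordinate vectors later.\<close>

lemma hadamard:
  fixes f :: "'a::euclidean_space \<Rightarrow> real"
  assumes f: "smooth_on (ball x0 r) f" and r: "r > 0"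
  obtains g where "\<And>b. smooth_on (ball x0 r) (g b)"
    "\<And>b. g b x0 = frechet_derivative f (at x0) b"
    "\<And>x. x \<in> ball x0 r \<Longrightarrow> f x = f x0 + (\<Sum>b\<in>Basis. ((x - x0) \<bullet> b) * g b x)"
proof
  let ?z = "\<lambda>x t. x0 + t *\<^sub>R (x - x0)"
  let ?D = "\<lambda>y. frechet_derivative f (at y)"
  \<comment> \<open>The factor \<open>t ^ 0\<close> only fits the integrand to the shape required by
    \<open>times_differentiable_on_radial_integral\<close>.\<close>
  define g where "g = (\<lambda>b x. integral (cbox 0 1) (\<lambda>t::real. t ^ 0 * ?D (?z x t) b))"
  show "smooth_on (ball x0 r) (g b)" for b
    unfolding smooth_on_def g_def using times_differentiable_on_radial_integral[OF smooth_on_frechet[OF f]] by blast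
  show "g b x0 = ?D x0 b" for b by (simp add: g_def)
  fix x assume x: "x \<in> ball x0 r"
  have seg: "?z x t \<in> ball x0 r" if "t \<in> {0..1}" for t
  proof -
    have "norm (t *\<^sub>R (x - x0)) \<le> 1 * norm (x - x0)"
      using that unfolding norm_scaleR by (intro mult_right_mono) auto
    then show ?thesis using x by (simp add: dist_norm norm_minus_commute)
  qed
  have "((\<lambda>t. f (?z x t)) has_vector_derivative ?D (?z x t) (x - x0)) (at t within {0..1})" if "t \<in> {0..1}" for t
  proof -
    have "(?z x has_derivative (\<lambda>h. h *\<^sub>R (x - x0))) (at t within {0..1})"
      by (auto intro!: derivative_eq_intros)
    from has_derivative_compose[OF this smooth_on_imp_has_derivative[OF f seg[OF that]]]
    show ?thesis using smooth_on_imp_linear_frechet[OF f seg[OF that]]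
      by (simp add: has_vector_derivative_def linear_scale)
  qed
  then have "((\<lambda>t. ?D (?z x t) (x - x0)) has_integral f (?z x 1) - f (?z x 0)) {0..1}"
    by (intro fundamental_theorem_of_calculus) auto
  then have "f x - f x0 = integral {0..1} (\<lambda>t. ?D (?z x t) (x - x0))"
    by (simp add: integral_unique)
  also have "\<dots> = integral {0..1} (\<lambda>t. \<Sum>b\<in>Basis. ((x - x0) \<bullet> b) * ?D (?z x t) b)"
    by (rule integral_cong)
      (use linear_sum_Basis[OF smooth_on_imp_linear_frechet[OF f seg], of _ "x - x0"] in simp)
  also have "\<dots> = (\<Sum>b\<in>Basis. integral {0..1} (\<lambda>t. ((x - x0) \<bullet> b) * ?D (?z x t) b))"
  proof (rule integral_sum)
    fix b :: 'a
    have "continuous_on {0..1} (\<lambda>t. ?D (?z x t) b)"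
      by (rule continuous_on_compose2[OF smooth_on_imp_continuous_on[OF smooth_on_frechet[OF f]]])
        (use seg in \<open>auto intro!: continuous_intros\<close>)
    then show "(\<lambda>t. ((x - x0) \<bullet> b) * ?D (?z x t) b) integrable_on {0..1}"
      by (intro integrable_continuous_interval continuous_intros)
  qed simp
  finally show "f x = f x0 + (\<Sum>b\<in>Basis. ((x - x0) \<bullet> b) * g b x)" by (simp add: g_def)
qed

section \<open>Minkowski norms\<close>

text \<open>Basis-free and over any Euclidean space, so that one notion serves the energy on a
  fibre, the energy on the bundle, and the transition maps of charts.\<close>

definition hessian :: "('a::euclidean_space \<Rightarrow> real) \<Rightarrow> 'a \<Rightarrow> 'a \<Rightarrow> 'a \<Rightarrow> real" where
  "hessian f y a b = frechet_derivative (\<lambda>z. frechet_derivative f (at z) a) (at y) b"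

lemma hessian_linear_right:
  assumes "smooth_on S f" "y \<in> S" shows "linear (hessian f y a)"
  unfolding hessian_def
  by (rule smooth_on_imp_linear_frechet[OF smooth_on_frechet[OF assms(1)] assms(2)])

lemma hessian_sym:
  "open S \<Longrightarrow> smooth_on S f \<Longrightarrow> y \<in> S \<Longrightarrow> hessian f y a b = hessian f y b a"
  unfolding hessian_def by (rule second_derivative_symmetric)

lemma hessian_linear_left:
  assumes "open S" "smooth_on S f" "y \<in> S" shows "linear (\<lambda>a. hessian f y a b)"
  using hessian_linear_right[OF assms(2,3), of b] hessian_sym[OF assms, of _ b] by simp

lemma hessian_sum_axis:
  fixes f :: "real^'n \<Rightarrow> real"
  assumes "open S" "smooth_on S f" "y \<in> S"
  shows "hessian f y a b = (\<Sum>i\<in>UNIV. \<Sum>j\<in>UNIV. a $ i * b $ j * hessian f y (axis i 1) (axis j 1))"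
proof -
  have expand: "L w = (\<Sum>i\<in>UNIV. w $ i * L (axis i 1))" if "linear L" for L :: "real^'n \<Rightarrow> real" and w
  proof -
    have "L w = L (\<Sum>i\<in>UNIV. w $ i *s axis i 1)" by (simp add: basis_expansion)
    then show ?thesis using that by (simp add: linear_sum linear_scale scalar_mult_eq_scaleR)
  qed
  have "hessian f y a b = (\<Sum>i\<in>UNIV. a $ i * hessian f y (axis i 1) b)"
    by (rule expand[OF hessian_linear_left[OF assms]])
  also have "\<dots> = (\<Sum>i\<in>UNIV. a $ i * (\<Sum>j\<in>UNIV. b $ j * hessian f y (axis i 1) (axis j 1)))"
    using expand[OF hessian_linear_right[OF assms(2,3)], of _ b] by simp
  finally show ?thesis by (simp add: sum_distrib_left mult.assoc)
qed

definition half_square :: "('a \<Rightarrow> real) \<Rightarrow> 'a \<Rightarrow> real" where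
  "half_square \<phi> = (\<lambda>z. 1/2 * (\<phi> z)\<^sup>2)"

lemma fundamental_matrix_nth:
  "fundamental_matrix \<phi> y $ i $ j = hessian (half_square \<phi>) y (axis j 1) (axis i 1)"
  by (simp add: fundamental_matrix_def hessian_def pderiv_at_def[abs_def] half_square_def)

lemma inner_transpose: "a \<bullet> (transpose M *v z) = (M *v a) \<bullet> z" for M :: "real^'n^'m"
  by (metis dot_lmul_matrix inner_commute transpose_matrix_vector)

text \<open>A Finsler metric restricted to one tangent space, in fibre coordinates; it isolates the
  arguments that take place over a single point.\<close>

locale minkowski =
  fixes \<phi> :: "real^3 \<Rightarrow> real"
  assumes nonneg: "\<phi> y \<ge> 0"
    and homog: "t > 0 \<Longrightarrow> \<phi> (t *\<^sub>R y) = t * \<phi> y"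
    and smooth: "smooth_on (UNIV - {0}) \<phi>"
    and posdef: "y \<noteq> 0 \<Longrightarrow> w \<noteq> 0 \<Longrightarrow> w \<bullet> (fundamental_matrix \<phi> y *v w) > 0"
begin

abbreviation "E \<equiv> half_square \<phi>"
abbreviation "dE y \<equiv> frechet_derivative E (at y)"

lemma open_punctured: "open (UNIV - {0::real^3})"
  by (simp add: open_delete)

lemma smooth_E: "smooth_on (UNIV - {0}) E"
  unfolding half_square_def power2_eq_square
  by (intro smooth_on_mult smooth_on_const open_punctured smooth)

lemma dE: "y \<noteq> 0 \<Longrightarrow> (E has_derivative dE y) (at y)"
  by (rule smooth_on_imp_has_derivative[OF smooth_E]) simp

lemma linear_dE: "y \<noteq> 0 \<Longrightarrow> linear (dE y)"
  using dE has_derivative_linear by blast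

lemma E_scale: "t > 0 \<Longrightarrow> E (t *\<^sub>R y) = t\<^sup>2 * E y"
  by (simp add: half_square_def homog power_mult_distrib)

text \<open>Both sides of \<open>E (t z) = t^2 E z\<close> are differentiated in \<open>z\<close>.
  \<open>hessian_scale\<close> repeats this one order higher, and the two Euler identities arise by
  differentiating in \<open>t\<close> at \<open>t = 1\<close> instead.\<close>

lemma dE_scale:
  assumes "t > 0" "y \<noteq> 0" shows "dE (t *\<^sub>R y) w = t * dE y w"
proof -
  have "((\<lambda>z. E (t *\<^sub>R z)) has_derivative (\<lambda>w. dE (t *\<^sub>R y) (t *\<^sub>R w))) (at y)"
  proof (rule has_derivative_compose[where f = "\<lambda>z. t *\<^sub>R z" and f' = "\<lambda>w. t *\<^sub>R w"])
    show "((\<lambda>z. t *\<^sub>R z) has_derivative (\<lambda>w. t *\<^sub>R w)) (at y)" by (auto intro!: derivative_eq_intros)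
    show "(E has_derivative dE (t *\<^sub>R y)) (at (t *\<^sub>R y))" by (rule dE) (use assms in simp)
  qed
  moreover have "((\<lambda>z. E (t *\<^sub>R z)) has_derivative (\<lambda>w. t\<^sup>2 * dE y w)) (at y)"
    unfolding E_scale[OF assms(1)] by (rule has_derivative_mult_right[OF dE[OF assms(2)]])
  ultimately have "(\<lambda>w. dE (t *\<^sub>R y) (t *\<^sub>R w)) = (\<lambda>w. t\<^sup>2 * dE y w)"
    by (rule has_derivative_unique)
  from fun_cong[OF this] have "dE (t *\<^sub>R y) (t *\<^sub>R w) = t\<^sup>2 * dE y w" .
  moreover have "dE (t *\<^sub>R y) (t *\<^sub>R w) = t * dE (t *\<^sub>R y) w"
    using linear_dE[of "t *\<^sub>R y"] assms by (simp add: linear_scale)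
  ultimately have "t * dE (t *\<^sub>R y) w = t * (t * dE y w)" by (simp add: power2_eq_square mult.assoc)
  then show ?thesis using assms(1) by simp
qed

lemma hessian_scale:
  assumes "t > 0" "y \<noteq> 0" shows "hessian E (t *\<^sub>R y) a b = hessian E y a b"
proof -
  let ?h = "\<lambda>z. dE z a"
  have h: "(?h has_derivative hessian E z a) (at z)" if "z \<noteq> 0" for z
    unfolding hessian_def
    by (rule smooth_on_imp_has_derivative[OF smooth_on_frechet[OF smooth_E]]) (use that in simp)
  have "((\<lambda>z. ?h (t *\<^sub>R z)) has_derivative (\<lambda>b. hessian E (t *\<^sub>R y) a (t *\<^sub>R b))) (at y)"
  proof (rule has_derivative_compose[where f = "\<lambda>z. t *\<^sub>R z" and f' = "\<lambda>w. t *\<^sub>R w"])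
    show "((\<lambda>z. t *\<^sub>R z) has_derivative (\<lambda>w. t *\<^sub>R w)) (at y)" by (auto intro!: derivative_eq_intros)
    show "(?h has_derivative hessian E (t *\<^sub>R y) a) (at (t *\<^sub>R y))" by (rule h) (use assms in simp)
  qed
  moreover have "((\<lambda>z. ?h (t *\<^sub>R z)) has_derivative (\<lambda>b. t * hessian E y a b)) (at y)"
  proof (rule has_derivative_cong_open[OF open_punctured, THEN iffD1])
    show "((\<lambda>z. t * ?h z) has_derivative (\<lambda>b. t * hessian E y a b)) (at y)"
      by (rule has_derivative_mult_right[OF h[OF assms(2)]])
  qed (use assms dE_scale in auto)
  ultimately have "(\<lambda>b. hessian E (t *\<^sub>R y) a (t *\<^sub>R b)) = (\<lambda>b. t * hessian E y a b)"
    by (rule has_derivative_unique)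
  from fun_cong[OF this] have "hessian E (t *\<^sub>R y) a (t *\<^sub>R b) = t * hessian E y a b" .
  moreover have "hessian E (t *\<^sub>R y) a (t *\<^sub>R b) = t * hessian E (t *\<^sub>R y) a b"
    using hessian_linear_right[OF smooth_E, of "t *\<^sub>R y" a] assms by (simp add: linear_scale)
  ultimately show ?thesis using assms(1) by simp
qed

lemma fundamental_matrix_scale:
  "t > 0 \<Longrightarrow> y \<noteq> 0 \<Longrightarrow> fundamental_matrix \<phi> (t *\<^sub>R y) = fundamental_matrix \<phi> y"
  by (simp add: vec_eq_iff fundamental_matrix_nth hessian_scale)

lemma euler: assumes "y \<noteq> 0" shows "dE y y = 2 * E y"
proof -
  have "((\<lambda>t. t *\<^sub>R y) has_derivative (\<lambda>h. h *\<^sub>R y)) (at 1)" by (auto intro!: derivative_eq_intros)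
  then have "((\<lambda>t. E (t *\<^sub>R y)) has_derivative (\<lambda>h. dE (1 *\<^sub>R y) (h *\<^sub>R y))) (at 1)"
    by (rule has_derivative_compose) (use dE assms in simp)
  moreover have "((\<lambda>t. E (t *\<^sub>R y)) has_derivative (\<lambda>h. h * (2 * E y))) (at 1)"
  proof (rule has_derivative_cong_open[of "{0<..}", THEN iffD1])
    show "((\<lambda>t. t\<^sup>2 * E y) has_derivative (\<lambda>h. h * (2 * E y))) (at 1)"
      by (auto intro!: derivative_eq_intros)
  qed (use E_scale in auto)
  ultimately have "(\<lambda>h. dE (1 *\<^sub>R y) (h *\<^sub>R y)) = (\<lambda>h. h * (2 * E y))"
    by (rule has_derivative_unique)
  from fun_cong[OF this, of 1] show ?thesis by simp
qed

lemma euler_hessian: assumes "y \<noteq> 0" shows "hessian E y a y = dE y a"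
proof -
  have h: "((\<lambda>z. dE z a) has_derivative hessian E z a) (at z)" if "z \<noteq> 0" for z
    unfolding hessian_def
    by (rule smooth_on_imp_has_derivative[OF smooth_on_frechet[OF smooth_E]]) (use that in simp)
  have "((\<lambda>t. t *\<^sub>R y) has_derivative (\<lambda>h. h *\<^sub>R y)) (at 1)" by (auto intro!: derivative_eq_intros)
  then have "((\<lambda>t. dE (t *\<^sub>R y) a) has_derivative (\<lambda>t. hessian E (1 *\<^sub>R y) a (t *\<^sub>R y))) (at 1)"
    by (rule has_derivative_compose) (use h assms in simp)
  moreover have "((\<lambda>t. dE (t *\<^sub>R y) a) has_derivative (\<lambda>h. h * dE y a)) (at 1)"
  proof (rule has_derivative_cong_open[of "{0<..}", THEN iffD1])
    show "((\<lambda>t. t * dE y a) has_derivative (\<lambda>h. h * dE y a)) (at 1)"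
      by (auto intro!: derivative_eq_intros)
  qed (use dE_scale assms in auto)
  ultimately have "(\<lambda>t. hessian E (1 *\<^sub>R y) a (t *\<^sub>R y)) = (\<lambda>h. h * dE y a)"
    by (rule has_derivative_unique)
  from fun_cong[OF this, of 1] show ?thesis by simp
qed

lemma fundamental_matrix_bilinear:
  assumes "y \<noteq> 0" shows "a \<bullet> (fundamental_matrix \<phi> y *v b) = hessian E y a b"
proof -
  have y: "y \<in> UNIV - {0}" using assms by simp
  note exp = hessian_sum_axis[OF open_punctured smooth_E y, of a b]
  have "a \<bullet> (fundamental_matrix \<phi> y *v b) =
      (\<Sum>i\<in>UNIV. a $ i * (\<Sum>j\<in>UNIV. hessian E y (axis j 1) (axis i 1) * b $ j))"
    by (simp add: inner_vec_def matrix_vector_mult_def fundamental_matrix_nth)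
  also have "\<dots> = (\<Sum>i\<in>UNIV. \<Sum>j\<in>UNIV. a $ i * b $ j * hessian E y (axis i 1) (axis j 1))"
    unfolding sum_distrib_left
    by (intro sum.cong refl, subst hessian_sym[OF open_punctured smooth_E y]) simp
  finally show ?thesis using exp by simp
qed

text \<open>By the two Euler identities, the form \<open>g\<close> at \<open>y\<close> evaluated on
  \<open>y\<close> itself is \<open>2 * E y\<close>, the square of the norm.\<close>

lemma pos: assumes "y \<noteq> 0" shows "\<phi> y > 0"
proof -
  have "y \<bullet> (fundamental_matrix \<phi> y *v y) = 2 * E y"
    using fundamental_matrix_bilinear euler_hessian euler assms by simp
  then have "(\<phi> y)\<^sup>2 > 0" using posdef[OF assms assms] by (simp add: half_square_def)
  then show ?thesis using nonneg[of y] by (simp add: less_le)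
qed

lemma zero: "\<phi> 0 = 0"
  using homog[of 2 0] by simp

lemma pos_iff: "\<phi> y > 0 \<longleftrightarrow> y \<noteq> 0"
  using pos zero by force

lemma continuous_phi: "continuous_on (UNIV - {0}) \<phi>"
  by (rule smooth_on_imp_continuous_on[OF smooth])

lemma continuous_hessian: "continuous_on (UNIV - {0}) (\<lambda>y. hessian E y a b)"
  unfolding hessian_def
  by (rule smooth_on_imp_continuous_on[OF smooth_on_frechet[OF smooth_on_frechet[OF smooth_E]]])

end

text \<open>The segment from the identity to \<open>A\<close> consists of matrices with positive
  quadratic form, except possibly for no point at all; a zero of the determinant would give a kernel
  vector contradicting positivity. So the determinant keeps the sign it has at the identity. The
  argument works without eigenvalues or symmetry.\<close>

lemma det_pos_if_posdef:
  fixes A :: "real^'n^'n"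
  assumes "\<And>w. w \<noteq> 0 \<Longrightarrow> w \<bullet> (A *v w) > 0"
  shows "det A > 0"
proof (rule ccontr)
  assume "\<not> det A > 0"
  define B where "B = (\<lambda>t::real. \<chi> i j. (1 - t) * mat 1 $ i $ j + t * A $ i $ j)"
  have Bv: "B t *v w = (1 - t) *\<^sub>R w + t *\<^sub>R (A *v w)" for t w
  proof -
    have "B t = (1 - t) *\<^sub>R mat 1 + t *\<^sub>R A" by (simp add: B_def vec_eq_iff)
    then show ?thesis
      by (simp add: matrix_vector_mult_add_rdistrib flip: scaleR_matrix_vector_assoc)
  qed
  have "continuous_on {0..1} (\<lambda>t. det (B t))"
    unfolding det_def B_def by (intro continuous_intros)
  moreover have "det (B 0) = 1"
  proof -
    have "B 0 = mat 1" by (simp add: B_def vec_eq_iff)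
    then show ?thesis by simp
  qed
  moreover have "det (B 1) = det A"
  proof -
    have "B 1 = A" by (simp add: B_def vec_eq_iff)
    then show ?thesis by simp
  qed
  ultimately obtain t where t: "0 \<le> t" "t \<le> 1" "det (B t) = 0"
    using IVT2'[of "\<lambda>t. det (B t)" 1 0 0] \<open>\<not> det A > 0\<close>
    by (metis linorder_not_less zero_le_one)
  then have "\<not> invertible (B t)" by (simp add: invertible_det_nz)
  then obtain w where w: "w \<noteq> 0" "B t *v w = 0"
    using invertible_left_inverse matrix_left_invertible_ker by blast
  have "(1 - t) * (w \<bullet> w) + t * (w \<bullet> (A *v w)) = 0"
    using arg_cong[OF w(2), of "inner w"] by (simp add: Bv inner_add_right)
  moreover have "w \<bullet> w > 0" "w \<bullet> (A *v w) > 0" using w(1) assms by auto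
  moreover have "(1 - t) * (w \<bullet> w) \<ge> 0" "t * (w \<bullet> (A *v w)) \<ge> 0" using t calculation by auto
  ultimately have "(1 - t) * (w \<bullet> w) = 0" "t * (w \<bullet> (A *v w)) = 0" by linarith+
  then show False using \<open>w \<bullet> w > 0\<close> \<open>w \<bullet> (A *v w) > 0\<close> by simp
qed

context minkowski
begin

lemma det_fundamental_pos: "y \<noteq> 0 \<Longrightarrow> det (fundamental_matrix \<phi> y) > 0"
  by (rule det_pos_if_posdef) (rule posdef)

lemma continuous_fundamental_nth: "continuous_on (UNIV - {0}) (\<lambda>y. fundamental_matrix \<phi> y $ i $ j)"
  unfolding fundamental_matrix_nth by (rule continuous_hessian)

lemma continuous_det_fundamental: "continuous_on (UNIV - {0}) (\<lambda>y. det (fundamental_matrix \<phi> y))"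
  unfolding det_def by (intro continuous_intros continuous_fundamental_nth)

end

section \<open>Linear changes of the fibre variable\<close>

lemma hessian_linear_change:
  assumes "open S" "smooth_on S f" "L y \<in> S" "linear L"
  shows "hessian (\<lambda>z. f (L z)) y a b = hessian f (L y) (L a) (L b)"
    and "frechet_derivative (\<lambda>z. f (L z)) (at y) a = frechet_derivative f (at (L y)) (L a)"
proof -
  have bl: "bounded_linear L" using assms(4) by (simp add: linear_conv_bounded_linear)
  have L: "(L has_derivative L) (at z)" for z using bl by (rule bounded_linear_imp_has_derivative)
  have op: "open (L -` S)"
    by (rule continuous_open_vimage[OF assms(1) linear_continuous_at[OF bl]])
  have 1: "frechet_derivative (\<lambda>z. f (L z)) (at z) a = frechet_derivative f (at (L z)) (L a)"
    if "z \<in> L -` S" for z a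
  proof -
    have "L z \<in> S" using that by simp
    from frechet_derivative_at[OF has_derivative_compose[OF L smooth_on_imp_has_derivative[OF assms(2) this]]]
    show ?thesis by (rule fun_cong[OF sym])
  qed
  then show "frechet_derivative (\<lambda>z. f (L z)) (at y) a = frechet_derivative f (at (L y)) (L a)"
    using assms(3) by simp
  let ?h = "\<lambda>z. frechet_derivative f (at z) (L a)"
  have "frechet_derivative (\<lambda>z. frechet_derivative (\<lambda>z. f (L z)) (at z) a) (at y) =
      frechet_derivative (\<lambda>z. ?h (L z)) (at y)"
    by (rule frechet_derivative_cong_open[OF op]) (use 1 assms(3) in auto)
  also have "\<dots> = (\<lambda>b. frechet_derivative ?h (at (L y)) (L b))"
    by (rule frechet_derivative_at[OF has_derivative_compose[OF L smooth_on_imp_has_derivative[OF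
            smooth_on_frechet[OF assms(2)] assms(3)]], symmetric])
  finally show "hessian (\<lambda>z. f (L z)) y a b = hessian f (L y) (L a) (L b)"
    unfolding hessian_def by simp
qed

context minkowski
begin

lemma half_square_linear: "half_square (\<lambda>y. \<phi> (L y)) = (\<lambda>y. E (L y))"
  by (simp add: half_square_def)

context
  fixes L :: "real^3 \<Rightarrow> real^3"
  assumes L: "linear L" "inj L"
begin

lemma L_nz: "y \<noteq> 0 \<Longrightarrow> L y \<noteq> 0"
  using L linear_injective_0 by blast

lemma hessian_change: "y \<noteq> 0 \<Longrightarrow> hessian (half_square (\<lambda>y. \<phi> (L y))) y a b = hessian E (L y) (L a) (L b)"
  by (subst half_square_linear, rule hessian_linear_change[OF open_punctured smooth_E _ L(1)]) (simp add: L_nz)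

lemma fundamental_matrix_change:
  assumes "y \<noteq> 0"
  shows "fundamental_matrix (\<lambda>y. \<phi> (L y)) y = transpose (matrix L) ** fundamental_matrix \<phi> (L y) ** matrix L"
    (is "?l = ?r")
proof -
  have "?r $ i $ j = ?l $ i $ j" for i j
  proof -
    have "?r $ i $ j = axis i 1 \<bullet> (?r *v axis j 1)"
      by (simp add: matrix_vector_mul_component inner_axis' matrix_vector_mult_basis column_def)
    also have "\<dots> = axis i 1 \<bullet> (transpose (matrix L) *v (fundamental_matrix \<phi> (L y) *v (matrix L *v axis j 1)))"
      by (simp add: matrix_vector_mul_assoc matrix_mul_assoc)
    also have "\<dots> = (matrix L *v axis i 1) \<bullet> (fundamental_matrix \<phi> (L y) *v (matrix L *v axis j 1))"
      by (rule inner_transpose)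
    also have "\<dots> = hessian E (L y) (L (axis i 1)) (L (axis j 1))"
      using fundamental_matrix_bilinear[OF L_nz[OF assms]] L(1) by (simp add: matrix_works)
    also have "\<dots> = ?l $ i $ j"
      unfolding fundamental_matrix_nth hessian_change[OF assms]
      by (rule hessian_sym[OF open_punctured smooth_E]) (simp add: L_nz assms)
    finally show ?thesis .
  qed
  then show ?thesis by (simp add: vec_eq_iff)
qed

text \<open>The square root of this factor is \<open>\<bar>det (matrix L)\<bar>\<close>, exactly
  what the substitution in the unit ball needs.\<close>

lemma det_fundamental_change:
  "y \<noteq> 0 \<Longrightarrow> det (fundamental_matrix (\<lambda>y. \<phi> (L y)) y) = (det (matrix L))\<^sup>2 * det (fundamental_matrix \<phi> (L y))"
  by (simp add: fundamental_matrix_change det_mul power2_eq_square)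

lemma minkowski_change: "minkowski (\<lambda>y. \<phi> (L y))"
proof
  have sm: "smooth_on (UNIV - {0}) (\<lambda>y. \<phi> (L y))"
  proof (rule smooth_on_compose[OF open_punctured open_punctured _ _ smooth])
    show "smooth_on (UNIV - {0}) L"
      using smooth_on_linear[OF _ open_punctured smooth_on_id[OF open_punctured], of L] L(1)
      by (simp add: linear_conv_bounded_linear)
  qed (use L_nz in auto)
  show "smooth_on (UNIV - {0}) (\<lambda>y. \<phi> (L y))" by (rule sm)
  fix y w :: "real^3" assume y: "y \<noteq> 0" and w: "w \<noteq> 0"
  have "w \<bullet> (fundamental_matrix (\<lambda>y. \<phi> (L y)) y *v w) =
      (matrix L *v w) \<bullet> (fundamental_matrix \<phi> (L y) *v (matrix L *v w))"
    by (simp only: fundamental_matrix_change[OF y] inner_transpose matrix_vector_mul_assoc[symmetric])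
  then show "w \<bullet> (fundamental_matrix (\<lambda>y. \<phi> (L y)) y *v w) > 0"
    using posdef[OF L_nz[OF y] L_nz[OF w]] L(1) by (simp add: matrix_works)
qed (use nonneg homog L(1) in \<open>auto simp: linear_scale\<close>)

end

end

section \<open>Integration over the indicatrix\<close>

definition sphere_point :: "real \<times> real \<Rightarrow> real^3" where
  "sphere_point s = vector [sin (fst s) * cos (snd s), sin (fst s) * sin (snd s), cos (fst s)]"

definition sphere_fst :: "real \<times> real \<Rightarrow> real^3" where
  "sphere_fst s = vector [cos (fst s) * cos (snd s), cos (fst s) * sin (snd s), - sin (fst s)]"

definition sphere_snd :: "real \<times> real \<Rightarrow> real^3" where
  "sphere_snd s = vector [- sin (fst s) * sin (snd s), sin (fst s) * cos (snd s), 0]"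

lemma mem_box_pair:
  "x \<in> box (a, b) (c, d) \<longleftrightarrow> a < fst x \<and> fst x < c \<and> b < snd x \<and> snd x < (d::real)"
  for x :: "real \<times> real"
  by (cases x) (auto simp: box_def Basis_prod_def)

lemma mem_cbox_pair:
  "x \<in> cbox (a, b) (c, d) \<longleftrightarrow> a \<le> fst x \<and> fst x \<le> c \<and> b \<le> snd x \<and> snd x \<le> (d::real)"
  for x :: "real \<times> real"
  by (cases x) auto

lemma vector_3_axis: "vector [a, b, c] = a *\<^sub>R axis 1 1 + b *\<^sub>R axis 2 1 + c *\<^sub>R (axis 3 1 :: real^3)"
  by (simp add: vec_eq_iff forall_3 axis_def)

lemma sphere_point_has_derivative:
  "(sphere_point has_derivative (\<lambda>w. fst w *\<^sub>R sphere_fst s + snd w *\<^sub>R sphere_snd s)) (at s within S)"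
  unfolding sphere_point_def[abs_def] vector_3_axis
  by (rule derivative_eq_intros refl)+
    (simp add: fun_eq_iff vec_eq_iff forall_3 axis_def sphere_fst_def sphere_snd_def algebra_simps)

lemma continuous_sphere_point: "continuous_on S sphere_point"
  unfolding sphere_point_def[abs_def] vector_3_axis by (intro continuous_intros)

lemma norm_sphere_point: "norm (sphere_point s) = 1"
proof -
  have "(sin a * cos b)\<^sup>2 + (sin a * sin b)\<^sup>2 + (cos a)\<^sup>2 = 1" for a b :: real
  proof -
    have "(sin a * cos b)\<^sup>2 + (sin a * sin b)\<^sup>2 + (cos a)\<^sup>2 = (sin a)\<^sup>2 * ((sin b)\<^sup>2 + (cos b)\<^sup>2) + (cos a)\<^sup>2"
      by (simp only: power_mult_distrib algebra_simps)
    then show ?thesis by simp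
  qed
  then show ?thesis by (simp add: norm_vec_def L2_set_def sum_3 sphere_point_def)
qed

lemma sphere_point_nz: "sphere_point s \<noteq> 0"
  using norm_sphere_point[of s] by auto

text \<open>The closed parameter box covers the whole sphere, while the open box misses only points
  of the plane \<open>m $ 2 = 0\<close>. The first fact serves pointwise statements, the second
  shows that the omitted set is null.\<close>

lemma sphere_point_surj:
  assumes "norm m = 1"
  obtains s where "s \<in> cbox (0, 0) (pi, 2 * pi)" "sphere_point s = m"
    "m $ 2 \<noteq> 0 \<Longrightarrow> s \<in> box (0, 0) (pi, 2 * pi)"
proof -
  have n: "(m$1)\<^sup>2 + (m$2)\<^sup>2 + (m$3)\<^sup>2 = 1"
    using assms by (simp add: norm_vec_def L2_set_def sum_3)
  then have "(m$3)\<^sup>2 \<le> 1" using zero_le_power2[of "m$1"] zero_le_power2[of "m$2"] by linarith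
  then have m3: "-1 \<le> m$3" "m$3 \<le> 1" by (auto simp: abs_le_iff abs_square_le_1)
  define a where "a = arccos (m$3)"
  have a: "0 \<le> a" "a \<le> pi" "cos a = m$3" using m3 by (auto simp: a_def arccos_lbound arccos_ubound)
  have sa: "sin a \<ge> 0" using a by (intro sin_ge_zero)
  have sin2: "(sin a)\<^sup>2 = (m$1)\<^sup>2 + (m$2)\<^sup>2" using n a(3) sin_cos_squared_add[of a] by simp
  show ?thesis
  proof (cases "sin a = 0")
    case True
    then have "(m$1)\<^sup>2 + (m$2)\<^sup>2 = 0" using sin2 by simp
    then have "m$1 = 0" "m$2 = 0" by (simp_all only: sum_power2_eq_zero_iff)
    \<comment> \<open>At the poles the longitude is arbitrary; 0 is taken.\<close>
    then show ?thesis using True a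
      by (intro that[of "(a, 0)"]) (auto simp: sphere_point_def vec_eq_iff forall_3)
  next
    case False
    then have "sin a > 0" using sa by simp
    have "(m$1 / sin a)\<^sup>2 + (m$2 / sin a)\<^sup>2 = 1"
      using sin2[symmetric] False by (simp add: power_divide flip: add_divide_distrib)
    then obtain b where b: "0 \<le> b" "b < 2 * pi" "m$1 / sin a = cos b" "m$2 / sin a = sin b"
      using sincos_total_2pi by blast
    have m: "m$1 = sin a * cos b" "m$2 = sin a * sin b" using b False by (auto simp: field_simps)
    show ?thesis
    proof (rule that[of "(a, b)"])
      show "sphere_point (a, b) = m" using m a by (simp add: sphere_point_def vec_eq_iff forall_3)
      show "(a, b) \<in> cbox (0, 0) (pi, 2 * pi)" using a b by auto
      assume "m$2 \<noteq> 0"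
      then have "b \<noteq> 0" using m by auto
      moreover have "a \<noteq> 0" "a \<noteq> pi" using \<open>sin a > 0\<close> by auto
      ultimately show "(a, b) \<in> box (0, 0) (pi, 2 * pi)" using a b by (auto simp: mem_box_pair)
    qed
  qed
qed

lemma sphere_point_inj:
  assumes "s \<in> box (0, 0) (pi, 2 * pi)" "t \<in> box (0, 0) (pi, 2 * pi)" "sphere_point s = sphere_point t"
  shows "s = t"
proof -
  obtain a b where s: "s = (a, b)" by (cases s)
  obtain c d where t: "t = (c, d)" by (cases t)
  have ab: "0 < a" "a < pi" "0 < b" "b < 2 * pi" "0 < c" "c < pi" "0 < d" "d < 2 * pi"
    using assms(1,2) by (auto simp: s t mem_box_pair)
  have eq: "sin a * cos b = sin c * cos d" "sin a * sin b = sin c * sin d" "cos a = cos c"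
    using assms(3) unfolding vec_eq_iff forall_3 by (simp_all add: s t sphere_point_def)
  have "a = c" using eq(3) ab cos_inj_pi by simp
  have "sin a > 0" using ab by (simp add: sin_gt_zero)
  then have "sin b = sin d" "cos b = cos d" using eq(1,2) \<open>a = c\<close> by simp_all
  then obtain n :: int where n: "b = d + 2 * pi * n" using sin_cos_eq_iff[of b d] by auto
  have "\<bar>b - d\<bar> < 2 * pi" using ab by linarith
  then have "\<bar>2 * pi * of_int n\<bar> < 2 * pi * 1" using n by simp
  then have "\<bar>real_of_int n\<bar> < 1" by (simp add: abs_mult)
  then have "n = 0" by linarith
  then show ?thesis using n \<open>a = c\<close> by (simp add: s t)
qed

text \<open>Expanded as in \<^const>\<open>indicatrix_form\<close>.\<close>

definition det3 :: "real^3 \<Rightarrow> real^3 \<Rightarrow> real^3 \<Rightarrow> real" where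
  "det3 y a b = y$1 * (a$2 * b$3 - a$3 * b$2) - y$2 * (a$1 * b$3 - a$3 * b$1) + y$3 * (a$1 * b$2 - a$2 * b$1)"

lemma det3_sphere: "det3 (sphere_point s) (sphere_fst s) (sphere_snd s) = sin (fst s)"
proof -
  have "det3 (vector [S * c, S * d, C]) (vector [C * c, C * d, - S]) (vector [- S * d, S * c, 0]) =
      S * ((S\<^sup>2 + C\<^sup>2) * (d\<^sup>2 + c\<^sup>2))" for S C c d :: real
    by (simp add: det3_def power2_eq_square algebra_simps)
  from this[of "sin (fst s)" "cos (snd s)" "sin (snd s)" "cos (fst s)"] show ?thesis
    unfolding sphere_point_def sphere_fst_def sphere_snd_def by simp
qed

text \<open>Multiples of the first argument added to the other two drop out of the determinant. The
  derivative of the radial factor enters only through such multiples and therefore never has to be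
  computed.\<close>

lemma det3_scale_add:
  "det3 (r *\<^sub>R n) (p *\<^sub>R a + c *\<^sub>R n) (q *\<^sub>R b + d *\<^sub>R n) = r * p * q * det3 n a b"
  by (simp add: det3_def algebra_simps)

context minkowski
begin

lemma continuous_on_sphere:
  fixes k :: "real^3 \<Rightarrow> real"
  assumes "continuous_on (UNIV - {0}) k"
  shows "continuous_on S (\<lambda>s. k (sphere_point s))"
  by (rule continuous_on_compose2[OF assms continuous_sphere_point]) (use sphere_point_nz in auto)

lemma indicatrix_param_eq: "indicatrix_param \<phi> = (\<lambda>s. (1 / \<phi> (sphere_point s)) *\<^sub>R sphere_point s)"
  by (auto simp: indicatrix_param_def sphere_point_def Let_def fun_eq_iff inverse_eq_divide)

lemma inverse_phi_sphere_has_derivative: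
  obtains r where "((\<lambda>s. 1 / \<phi> (sphere_point s)) has_derivative r) (at s)"
proof -
  have "((\<lambda>s. \<phi> (sphere_point s)) has_derivative
      (\<lambda>w. frechet_derivative \<phi> (at (sphere_point s)) (fst w *\<^sub>R sphere_fst s + snd w *\<^sub>R sphere_snd s))) (at s)"
    by (rule has_derivative_compose[OF sphere_point_has_derivative smooth_on_imp_has_derivative[OF smooth]])
      (simp add: sphere_point_nz)
  from has_derivative_divide[OF has_derivative_const this, of 1] pos[OF sphere_point_nz[of s]]
  show ?thesis using that by auto
qed

text \<open>On the indicatrix the denominators in the form equal 1, and \<open>g\<close> is the same
  as at the unprojected sphere point because it is homogeneous of degree 0. Each argument of
  \<open>det3\<close> contributes one factor \<open>1 / \<phi>\<close>, which explains the
  cube.\<close>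

lemma indicatrix_form_param:
  "indicatrix_form \<phi> (indicatrix_param \<phi> s)
     (frechet_derivative (indicatrix_param \<phi>) (at s) (1, 0))
     (frechet_derivative (indicatrix_param \<phi>) (at s) (0, 1)) =
   sin (fst s) * (sqrt (det (fundamental_matrix \<phi> (sphere_point s))) / \<phi> (sphere_point s) ^ 3)"
proof -
  let ?n = "sphere_point s"
  let ?c = "1 / \<phi> ?n"
  obtain r where r: "((\<lambda>s. 1 / \<phi> (sphere_point s)) has_derivative r) (at s)"
    using inverse_phi_sphere_has_derivative .
  have "(indicatrix_param \<phi> has_derivative
      (\<lambda>w. ?c *\<^sub>R (fst w *\<^sub>R sphere_fst s + snd w *\<^sub>R sphere_snd s) + r w *\<^sub>R ?n)) (at s)"
    unfolding indicatrix_param_eq by (rule has_derivative_scaleR[OF r sphere_point_has_derivative])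
  note fr = frechet_derivative_at[OF this, symmetric]
  have c: "?c > 0" using pos[OF sphere_point_nz] by simp
  have "\<phi> (?c *\<^sub>R ?n) = 1" using homog[OF c, of ?n] pos[OF sphere_point_nz[of s]] by simp
  moreover have "fundamental_matrix \<phi> (?c *\<^sub>R ?n) = fundamental_matrix \<phi> ?n"
    using c sphere_point_nz by (rule fundamental_matrix_scale)
  ultimately have "indicatrix_form \<phi> (?c *\<^sub>R ?n) a b = sqrt (det (fundamental_matrix \<phi> ?n)) * det3 (?c *\<^sub>R ?n) a b" for a b
    by (simp add: indicatrix_form_def det3_def)
  then show ?thesis
    unfolding fr unfolding indicatrix_param_eq
    by (simp add: det3_scale_add det3_sphere power3_eq_cube)
qed

text \<open>The density of the volume form of the indicatrix, carried to the unit sphere along rays,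
  with respect to the Euclidean area form.\<close>

definition weight :: "real^3 \<Rightarrow> real" where
  "weight m = sqrt (det (fundamental_matrix \<phi> m)) / \<phi> m ^ 3"

lemma indicatrix_integral_eq_box:
  "indicatrix_integral \<phi> h = integral (box (0, 0) (pi, 2 * pi))
     (\<lambda>s. sin (fst s) * (weight (sphere_point s) * h (sphere_point s /\<^sub>R \<phi> (sphere_point s))))"
  unfolding indicatrix_integral_def Let_def indicatrix_form_param weight_def
  by (simp add: indicatrix_param_eq inverse_eq_divide mult_ac)

lemma indicatrix_integral_eq:
  "indicatrix_integral \<phi> h = integral (cbox (0, 0) (pi, 2 * pi))
     (\<lambda>s. sin (fst s) * (weight (sphere_point s) * h (sphere_point s /\<^sub>R \<phi> (sphere_point s))))"
  unfolding indicatrix_integral_eq_box by (rule integral_open_interval)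

lemma continuous_weight: "continuous_on (UNIV - {0}) weight"
  unfolding weight_def[abs_def]
  by (intro continuous_intros continuous_phi continuous_det_fundamental) (use pos in force)

lemma weight_pos: "m \<noteq> 0 \<Longrightarrow> weight m > 0"
  using pos det_fundamental_pos by (simp add: weight_def)

lemma continuous_integrand:
  assumes "continuous_on (UNIV - {0}) h"
  shows "continuous_on S (\<lambda>s. weight (sphere_point s) * h (sphere_point s /\<^sub>R \<phi> (sphere_point s)))"
proof -
  have "continuous_on (UNIV - {0}) (\<lambda>m. h (m /\<^sub>R \<phi> m))"
    by (rule continuous_on_compose2[OF assms])
      (use pos in \<open>auto intro!: continuous_intros continuous_phi simp: less_le\<close>)
  from continuous_on_sphere[OF this] continuous_on_sphere[OF continuous_weight]
  show ?thesis by (intro continuous_intros)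
qed

lemma continuous_integrand':
  assumes "continuous_on (UNIV - {0}) h"
  shows "continuous_on S (\<lambda>s. sin (fst s) * (weight (sphere_point s) * h (sphere_point s /\<^sub>R \<phi> (sphere_point s))))"
  by (intro continuous_on_mult[OF _ continuous_integrand[OF assms]] continuous_intros)

lemma integrable_integrand:
  assumes "continuous_on (UNIV - {0}) h"
  shows "(\<lambda>s. sin (fst s) * (weight (sphere_point s) * h (sphere_point s /\<^sub>R \<phi> (sphere_point s))))
    integrable_on (cbox (0, 0) (pi, 2 * pi))"
  by (rule integrable_continuous[OF continuous_integrand'[OF assms]])

lemma indicatrix_integral_sum:
  assumes "finite I" "\<And>i. i \<in> I \<Longrightarrow> continuous_on (UNIV - {0}) (h i)"
  shows "indicatrix_integral \<phi> (\<lambda>y. \<Sum>i\<in>I. h i y) = (\<Sum>i\<in>I. indicatrix_integral \<phi> (h i))"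
  unfolding indicatrix_integral_eq sum_distrib_left
  by (rule integral_sum[OF assms(1) integrable_integrand[OF assms(2)]])

lemma indicatrix_integral_cmult: "indicatrix_integral \<phi> (\<lambda>y. c * h y) = c * indicatrix_integral \<phi> h"
proof -
  have "(\<lambda>s. sin (fst s) * (weight (sphere_point s) * (c * h (sphere_point s /\<^sub>R \<phi> (sphere_point s))))) =
     (\<lambda>s. c * (sin (fst s) * (weight (sphere_point s) * h (sphere_point s /\<^sub>R \<phi> (sphere_point s)))))"
    by (simp add: mult_ac)
  then show ?thesis unfolding indicatrix_integral_eq by simp
qed

lemma indicatrix_integral_cong:
  assumes "\<And>y. y \<noteq> 0 \<Longrightarrow> h y = h' y"
  shows "indicatrix_integral \<phi> h = indicatrix_integral \<phi> h'"
proof -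
  have "h (sphere_point s /\<^sub>R \<phi> (sphere_point s)) = h' (sphere_point s /\<^sub>R \<phi> (sphere_point s))" for s
    using pos[OF sphere_point_nz[of s]] by (intro assms) (simp add: sphere_point_nz)
  then show ?thesis unfolding indicatrix_integral_eq by simp
qed

text \<open>A nonnegative continuous integrand with vanishing integral is zero. Since the factor
  \<open>sin (fst s)\<close> vanishes at the poles, it can be cancelled only in the open box;
  continuity of the remaining factor then covers the closed box, whose image is the entire
  sphere.\<close>

lemma indicatrix_integral_nonneg_eq_0D:
  assumes cont: "continuous_on (UNIV - {0}) h" and nn: "\<And>y. y \<noteq> 0 \<Longrightarrow> h y \<ge> 0"
    and zero: "indicatrix_integral \<phi> h = 0" and y: "\<phi> y = 1"
  shows "h y = 0"
proof -
  let ?k = "\<lambda>s. weight (sphere_point s) * h (sphere_point s /\<^sub>R \<phi> (sphere_point s))"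
  have knn: "?k s \<ge> 0" for s
    using weight_pos[OF sphere_point_nz[of s]] nn pos[OF sphere_point_nz[of s]]
    by (simp add: sphere_point_nz)
  have int: "((\<lambda>s. sin (fst s) * ?k s) has_integral 0) (cbox (0, 0) (pi, 2 * pi))"
    using zero integrable_integral[OF integrable_integrand[OF cont]] unfolding indicatrix_integral_eq by simp
  have "(pi/2, pi) \<in> box (0, 0) (pi, 2 * pi)" by (simp add: mem_box_pair)
  then have ne: "box (0::real, 0::real) (pi, 2 * pi) \<noteq> {}" by blast
  have k_box: "?k s = 0" if s: "s \<in> box (0, 0) (pi, 2 * pi)" for s
  proof -
    have "sin (fst s) * ?k s = 0"
    proof (rule has_integral_0_cbox_imp_0[OF continuous_integrand'[OF cont] _ int])
      fix s :: "real \<times> real" assume "s \<in> box (0, 0) (pi, 2 * pi)"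
      then have "sin (fst s) \<ge> 0" by (auto simp: mem_box_pair intro!: sin_ge_zero)
      then show "sin (fst s) * ?k s \<ge> 0" using knn by (rule mult_nonneg_nonneg)
    qed (use s box_subset_cbox ne in blast)+
    moreover have "sin (fst s) > 0" using s by (auto simp: mem_box_pair intro!: sin_gt_zero)
    ultimately show ?thesis by simp
  qed
  have cl: "closure (box (0, 0) (pi, 2 * pi)) = cbox (0::real, 0::real) (pi, 2 * pi)"
    using ne by (rule closure_box)
  have k0: "?k s = 0" if "s \<in> cbox (0, 0) (pi, 2 * pi)" for s
    by (rule continuous_constant_on_closure[OF continuous_integrand[OF cont] k_box])
      (simp only: cl that)+
  have "y \<noteq> 0" using y zero minkowski.zero minkowski_axioms by fastforce
  then have "norm (y /\<^sub>R norm y) = 1" by simp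
  then obtain s where s: "s \<in> cbox (0, 0) (pi, 2 * pi)" "sphere_point s = y /\<^sub>R norm y"
    using sphere_point_surj by blast
  have "\<phi> (sphere_point s) = 1 / norm y" unfolding s(2)
    using homog[of "inverse (norm y)" y] \<open>y \<noteq> 0\<close> y by (simp add: inverse_eq_divide)
  then have "sphere_point s /\<^sub>R \<phi> (sphere_point s) = y" using \<open>y \<noteq> 0\<close> by (simp add: s(2))
  then show ?thesis using k0[OF s(1)] weight_pos[OF sphere_point_nz[of s]] by simp
qed

end

text \<open>Separates the radial variable of polar coordinates; the factor 1/3 is the integral of
  \<open>r^2\<close> over the unit interval. Fubini needs a product type, so the box is first moved
  there by a coordinate bijection that preserves volumes.\<close>

lemma integral_box3:
  fixes k :: "real \<times> real \<Rightarrow> real"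
  assumes k: "continuous_on UNIV k"
  shows "integral (cbox (vector [0, 0, 0]) (vector [1, a, b])) (\<lambda>x::real^3. (x$1)\<^sup>2 * k (x$2, x$3)) =
    1/3 * integral (cbox (0, 0) (a, b)) k"
proof -
  define T :: "real^3 \<Rightarrow> real \<times> real \<times> real" where "T = (\<lambda>x. (x$1, x$2, x$3))"
  define T' :: "real \<times> real \<times> real \<Rightarrow> real^3" where "T' = (\<lambda>p. vector [fst p, fst (snd p), snd (snd p)])"
  have prod3: "prod h (UNIV :: 3 set) = h 1 * h 2 * h 3" for h :: "3 \<Rightarrow> real"
    unfolding UNIV_3 by (simp add: ac_simps)
  have TT: "T' (T x) = x" for x by (simp add: T_def T'_def vec_eq_iff forall_3)
  have TT': "T (T' p) = p" for p by (simp add: T_def T'_def)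
  have mem: "T x \<in> cbox (T u) (T v) \<longleftrightarrow> x \<in> cbox u v" for x u v
    by (auto simp: T_def mem_box_cart forall_3)
  have im: "T ` cbox u v = cbox (T u) (T v)" for u v
  proof
    show "cbox (T u) (T v) \<subseteq> T ` cbox u v"
      using mem TT' by (metis image_iff subsetI)
  qed (use mem in auto)
  have im': "T' ` cbox u v = cbox (T' u) (T' v)" for u v
    using im[of "T' u" "T' v"] by (simp add: TT' image_image TT flip: im[of "T' u" "T' v", simplified TT'])
  have content: "measure lborel (T ` cbox u v) = 1 * measure lborel (cbox u v)" for u v
  proof -
    have "measure lborel (cbox (T u) (T v)) = measure lborel {u$1..v$1} * (measure lborel {u$2..v$2} * measure lborel {u$3..v$3})"
      by (simp add: T_def content_Pair)
    also have "\<dots> = measure lborel (cbox u v)"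
    proof (cases "u$1 \<le> v$1 \<and> u$2 \<le> v$2 \<and> u$3 \<le> v$3")
      case True
      then have ne: "cbox u v \<noteq> {}" by (simp add: interval_ne_empty_cart forall_3)
      have "measure lborel (cbox u v) = (v$1 - u$1) * (v$2 - u$2) * (v$3 - u$3)"
        unfolding content_cbox_cart[OF ne] prod3 ..
      moreover have "measure lborel {u$i..v$i} = v$i - u$i" if "u$i \<le> v$i" for i
        using that by (rule content_real)
      ultimately show ?thesis using True by (simp only: mult.assoc)
    next
      case False
      then have "cbox u v = {}" using interval_ne_empty_cart(1)[of u v] by (auto simp: forall_3)
      then show ?thesis using False by auto
    qed
    finally show ?thesis by (simp add: im)
  qed
  define f where "f = (\<lambda>p::real \<times> real \<times> real. (fst p)\<^sup>2 * k (snd p))"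
  have cf: "continuous_on S f" for S
    unfolding f_def by (intro continuous_intros continuous_on_compose2[OF k]) auto
  have "((\<lambda>x. f (T x)) has_integral (1 / 1) *\<^sub>R integral (cbox (0, 0, 0) (1, a, b)) f)
      (T' ` cbox (0, 0, 0) (1, a, b))"
  proof (rule has_integral_twiddle[where g = T and h = T' and r = 1])
    show "isCont T x" for x unfolding T_def by (intro continuous_intros)
    show "\<exists>w z. T ` cbox u v = cbox w z" for u v using im by blast
    show "\<exists>w z. T' ` cbox u v = cbox w z" for u v using im' by blast
    show "(f has_integral integral (cbox (0, 0, 0) (1, a, b)) f) (cbox (0, 0, 0) (1, a, b))"
      by (rule integrable_integral[OF integrable_continuous[OF cf]])
  qed (simp_all add: TT TT' content)
  then have "integral (cbox (vector [0, 0, 0]) (vector [1, a, b])) (\<lambda>x. f (T x)) =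
      integral (cbox (0, 0, 0) (1, a, b)) f"
    unfolding im' by (simp add: T'_def integral_unique)
  also have "\<dots> = integral (cbox 0 1) (\<lambda>r. integral (cbox (0, 0) (a, b)) (\<lambda>s. f (r, s)))"
    by (rule integral_prod_continuous[OF cf])
  also have "\<dots> = integral {0..1} (\<lambda>r. r\<^sup>2 * integral (cbox (0, 0) (a, b)) k)"
    by (simp add: f_def)
  also have "\<dots> = integral {0..1::real} (\<lambda>r. r\<^sup>2) * integral (cbox (0, 0) (a, b)) k"
    by simp
  also have "integral {0..1::real} (\<lambda>r. r\<^sup>2) = 1/3"
  proof -
    have "((\<lambda>r::real. r\<^sup>2) has_integral (1 ^ 3 / 3 - 0 ^ 3 / 3)) {0..1}"
      by (rule fundamental_theorem_of_calculus)
        (auto intro!: derivative_eq_intros simp flip: has_real_derivative_iff_has_vector_derivative)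
    then show ?thesis by (simp add: integral_unique)
  qed
  finally show ?thesis by (simp add: f_def T_def)
qed

lemma det_matrix_det3: "det (matrix D) = det3 (D (axis 1 1)) (D (axis 2 1)) (D (axis 3 1))"
  by (simp add: det_3 det3_def matrix_def algebra_simps)

section \<open>Polar coordinates of the norm and linear invariance of the indicatrix
  integral\<close>

context minkowski
begin

text \<open>The radius is measured by \<open>\<phi>\<close> itself, so that the unit ball of
  \<open>\<phi>\<close> is the image of a box up to a null set.\<close>

definition polar :: "real^3 \<Rightarrow> real^3" where
  "polar x = x$1 *\<^sub>R indicatrix_param \<phi> (x$2, x$3)"

lemma polar_eq: "polar x = (x$1 / \<phi> (sphere_point (x$2, x$3))) *\<^sub>R sphere_point (x$2, x$3)"
  by (simp add: polar_def indicatrix_param_eq)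

lemma polar_has_derivative:
  obtains D where "(polar has_derivative D) (at x)"
    "det (matrix D) = (x$1)\<^sup>2 * (sin (x$2) / \<phi> (sphere_point (x$2, x$3)) ^ 3)"
proof -
  let ?s = "(x$2, x$3)"
  let ?n = "sphere_point ?s"
  let ?c = "1 / \<phi> ?n"
  obtain r where r: "((\<lambda>s. 1 / \<phi> (sphere_point s)) has_derivative r) (at ?s)"
    using inverse_phi_sphere_has_derivative .
  define P' where "P' = (\<lambda>w. ?c *\<^sub>R (fst w *\<^sub>R sphere_fst ?s + snd w *\<^sub>R sphere_snd ?s) + r w *\<^sub>R ?n)"
  have P: "(indicatrix_param \<phi> has_derivative P') (at ?s)"
    unfolding indicatrix_param_eq P'_def by (rule has_derivative_scaleR[OF r sphere_point_has_derivative])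
  have proj: "((\<lambda>x. (x$2, x$3)) has_derivative (\<lambda>w. (w$2, w$3))) (at x)"
    by (auto intro!: derivative_eq_intros bounded_linear.has_derivative[OF bounded_linear_vec_nth])
  have fst: "((\<lambda>x. x$1) has_derivative (\<lambda>w. w$1)) (at x)"
    by (auto intro!: derivative_eq_intros bounded_linear.has_derivative[OF bounded_linear_vec_nth])
  define D where "D = (\<lambda>w::real^3. x$1 *\<^sub>R P' (w$2, w$3) + w$1 *\<^sub>R indicatrix_param \<phi> ?s)"
  have "(polar has_derivative D) (at x)"
    unfolding polar_def[abs_def] D_def
    by (rule has_derivative_scaleR[OF fst has_derivative_compose[OF proj P]])
  moreover have "det (matrix D) = (x$1)\<^sup>2 * (sin (x$2) / \<phi> ?n ^ 3)"
  proof -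
    have r0: "r (0, 0) = 0"
      using r[THEN has_derivative_linear] linear_0 by (metis zero_prod_def)
    have "D (axis 1 1) = ?c *\<^sub>R ?n"
      by (simp add: D_def P'_def r0 indicatrix_param_eq axis_def)
    moreover have "D (axis 2 1) = (x$1 * ?c) *\<^sub>R sphere_fst ?s + (x$1 * r (1, 0)) *\<^sub>R ?n"
      by (simp add: D_def P'_def axis_def scaleR_add_right)
    moreover have "D (axis 3 1) = (x$1 * ?c) *\<^sub>R sphere_snd ?s + (x$1 * r (0, 1)) *\<^sub>R ?n"
      by (simp add: D_def P'_def axis_def scaleR_add_right)
    ultimately show ?thesis
      unfolding det_matrix_det3 by (simp only: det3_scale_add det3_sphere) (simp add: power2_eq_square power3_eq_cube)
  qed
  ultimately show ?thesis by (rule that)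
qed

context
  fixes L :: "real^3 \<Rightarrow> real^3" and f :: "real^3 \<Rightarrow> real"
  assumes L: "linear L" "inj L"
    and cont: "continuous_on (UNIV - {0}) f"
    and f_homog: "\<And>t y. t > 0 \<Longrightarrow> y \<noteq> 0 \<Longrightarrow> f (t *\<^sub>R y) = f y"
begin

interpretation L: minkowski "\<lambda>y. \<phi> (L y)"
  by (rule minkowski_change[OF L])

text \<open>Polar coordinates of the pulled-back norm followed by \<open>L\<close> parametrise the
  unit ball of \<open>\<phi>\<close>, whichever \<open>L\<close> is taken; the right-hand side does
  not mention \<open>L\<close>, and this is the point. The factor 3 cancels the radial integral,
  which separates because \<open>f\<close> is homogeneous of degree 0.\<close>

lemma integral_unit_ball:
  "\<bar>det (matrix L)\<bar> * integral (cbox (0, 0) (pi, 2 * pi))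
      (\<lambda>s. sin (fst s) * (f (L (sphere_point s)) / \<phi> (L (sphere_point s)) ^ 3)) =
    3 * integral {y. y \<noteq> 0 \<and> \<phi> y < 1} f"
proof -
  define k where "k = (\<lambda>s. sin (fst s) * (f (L (sphere_point s)) / \<phi> (L (sphere_point s)) ^ 3))"
  define S :: "(real^3) set" where "S = box (vector [0, 0, 0]) (vector [1, pi, 2 * pi])"
  define g where "g = (\<lambda>x. L (L.polar x))"
  define K where "K = (\<lambda>x::real^3. \<bar>det (matrix L)\<bar> * ((x$1)\<^sup>2 * k (x$2, x$3)))"
  have memS: "x \<in> S \<longleftrightarrow> 0 < x$1 \<and> x$1 < 1 \<and> 0 < x$2 \<and> x$2 < pi \<and> 0 < x$3 \<and> x$3 < 2 * pi" for x
    by (auto simp: S_def mem_box_cart forall_3)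
  have contL: "continuous_on T L" for T
    using L(1) by (simp add: linear_continuous_on linear_conv_bounded_linear)
  have cfL: "continuous_on (UNIV - {0}) (\<lambda>m. f (L m))"
    by (rule continuous_on_compose2[OF cont contL]) (use L_nz[OF L] in auto)
  have contk: "continuous_on T k" for T
    unfolding k_def
    by (intro continuous_intros continuous_on_sphere[OF cfL] continuous_on_sphere[OF L.continuous_phi])
      (use L.pos[OF sphere_point_nz] in \<open>auto simp: less_le\<close>)
  have contK: "continuous_on T K" for T
    unfolding K_def by (intro continuous_intros continuous_on_compose2[OF contk[of UNIV]]) auto
  have gx: "g x = (x$1 / \<phi> (L (sphere_point (x$2, x$3)))) *\<^sub>R L (sphere_point (x$2, x$3))" for x
    unfolding g_def L.polar_eq using L(1) by (simp add: linear_scale)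
  have posn: "\<phi> (L (sphere_point s)) > 0" for s by (rule L.pos[OF sphere_point_nz])
  have phig: "\<phi> (g x) = x$1" if "x$1 > 0" for x
    unfolding gx using that posn[of "(x$2, x$3)"] by (subst homog) auto
  have g_nz: "g x \<noteq> 0" if "x$1 > 0" for x using phig[OF that] that pos_iff by metis
  have "\<exists>D. (g has_derivative D) (at x) \<and>
      det (matrix D) = det (matrix L) * ((x$1)\<^sup>2 * (sin (x$2) / \<phi> (L (sphere_point (x$2, x$3))) ^ 3))" for x
  proof -
    obtain D where D: "(L.polar has_derivative D) (at x)"
      "det (matrix D) = (x$1)\<^sup>2 * (sin (x$2) / \<phi> (L (sphere_point (x$2, x$3))) ^ 3)"
      using L.polar_has_derivative .
    have "(L has_derivative L) (at (L.polar x))"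
      using L(1) by (simp add: linear_conv_bounded_linear bounded_linear_imp_has_derivative)
    from has_derivative_compose[OF D(1) this]
    have "(g has_derivative (L \<circ> D)) (at x)" by (simp add: g_def o_def)
    moreover have "det (matrix (L \<circ> D)) = det (matrix L) * det (matrix D)"
      using has_derivative_linear[OF D(1)] L(1) by (simp add: matrix_compose det_mul)
    ultimately show ?thesis using D(2) by auto
  qed
  then obtain g' where g': "\<And>x. (g has_derivative g' x) (at x)"
    "\<And>x. det (matrix (g' x)) = det (matrix L) * ((x$1)\<^sup>2 * (sin (x$2) / \<phi> (L (sphere_point (x$2, x$3))) ^ 3))"
    by metis
  have fg: "f (g x) = f (L (sphere_point (x$2, x$3)))" if "x$1 > 0" for x
    unfolding gx by (rule f_homog) (use that posn L_nz[OF L sphere_point_nz] in auto)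
  have DK: "\<bar>det (matrix (g' x))\<bar> * f (g x) = K x" if "x \<in> S" for x
  proof -
    have "sin (x$2) > 0" using that memS sin_gt_zero by blast
    then have "\<bar>det (matrix (g' x))\<bar> = \<bar>det (matrix L)\<bar> * ((x$1)\<^sup>2 * (sin (x$2) / \<phi> (L (sphere_point (x$2, x$3))) ^ 3))"
      unfolding g'(2) using posn[of "(x$2, x$3)"] by (simp add: abs_mult less_imp_le)
    then show ?thesis using fg[of x] that memS by (simp add: K_def k_def)
  qed
  have inj: "inj_on g S"
  proof (rule inj_onI)
    fix x y assume xy: "x \<in> S" "y \<in> S" "g x = g y"
    then have x1: "x$1 = y$1" using phig[of x] phig[of y] memS by auto
    let ?m = "sphere_point (x$2, x$3)" and ?n = "sphere_point (y$2, y$3)"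
    have "L.polar x = L.polar y" using xy(3) L(2) by (simp add: g_def inj_eq)
    then have eq: "(x$1 / \<phi> (L ?m)) *\<^sub>R ?m = (x$1 / \<phi> (L ?n)) *\<^sub>R ?n" unfolding L.polar_eq x1 .
    have c: "x$1 / \<phi> (L ?m) > 0" "x$1 / \<phi> (L ?n) > 0" using posn xy(1) memS by auto
    have "x$1 / \<phi> (L ?m) = x$1 / \<phi> (L ?n)"
      using arg_cong[OF eq, of norm] unfolding norm_scaleR norm_sphere_point by (simp only: abs_of_pos[OF c(1)] abs_of_pos[OF c(2)] mult_1_right)
    then have "?m = ?n" using eq c by auto
    then have "(x$2, x$3) = (y$2, y$3)"
      by (rule sphere_point_inj[rotated 2]) (use xy memS in \<open>auto simp: mem_box_pair\<close>)
    then show "x = y" using x1 by (simp add: vec_eq_iff forall_3)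
  qed
  let ?B = "{y. y \<noteq> 0 \<and> \<phi> y < 1}"
  have sub: "g ` S \<subseteq> ?B" using phig g_nz memS by auto
  \<comment> \<open>The points missed by the open parameter box lie in the image under
    \<open>L\<close> of a coordinate plane, which is a null set.\<close>
  have sub': "?B - g ` S \<subseteq> L ` {y. y$2 = 0}"
  proof
    fix y assume y: "y \<in> ?B - g ` S"
    obtain z where z: "y = L z" using linear_injective_imp_surjective[OF L] by (metis surjD)
    have "z$2 = 0"
    proof (rule ccontr)
      assume z2: "z$2 \<noteq> 0"
      then have "z \<noteq> 0" by auto
      then have "norm (z /\<^sub>R norm z) = 1" by simp
      then obtain s where s: "sphere_point s = z /\<^sub>R norm z" "s \<in> box (0, 0) (pi, 2 * pi)"
      proof (rule sphere_point_surj)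
        fix s assume "sphere_point s = z /\<^sub>R norm z" "(z /\<^sub>R norm z) $ 2 \<noteq> 0 \<Longrightarrow> s \<in> box (0, 0) (pi, 2 * pi)"
        then show thesis using that[of s] z2 \<open>z \<noteq> 0\<close> by simp
      qed
      have "\<phi> (L (sphere_point s)) = \<phi> y / norm z"
        unfolding s(1) z using \<open>z \<noteq> 0\<close> L.homog[of "inverse (norm z)" z] by (simp add: inverse_eq_divide)
      moreover have "\<phi> y > 0" using y pos by simp
      ultimately have gv: "g (vector [\<phi> y, fst s, snd s]) = y"
        unfolding gx using \<open>z \<noteq> 0\<close> L(1) by (simp add: s(1) z linear_scale)
      have "vector [\<phi> y, fst s, snd s] \<in> S"
        using s(2) y \<open>\<phi> y > 0\<close> by (simp add: memS mem_box_pair)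
      from imageI[OF this, of g] have "y \<in> g ` S" unfolding gv .
      then show False using y by simp
    qed
    then show "y \<in> L ` {y. y$2 = 0}" using z by simp
  qed
  have negl: "negligible (?B - g ` S)"
    by (rule negligible_subset[OF negligible_differentiable_image_negligible[OF order_refl
            negligible_standard_hyperplane_cart linear_imp_differentiable_on[OF L(1)]] sub'])
  have "K absolutely_integrable_on cbox (vector [0, 0, 0]) (vector [1, pi, 2 * pi])"
    by (rule absolutely_integrable_continuous[OF contK])
  then have Kint: "K absolutely_integrable_on S"
    by (rule set_integrable_subset) (auto simp: S_def box_subset_cbox)
  \<comment> \<open>The change of variables theorem concerns functions with values in some
    \<open>real^'n\<close>, so the real integrand is wrapped as a vector of length 1.\<close>
  have DK': "\<bar>det (matrix (g' x))\<bar> *\<^sub>R (vec (f (g x)) :: real^1) = K x *\<^sub>R vec 1" if "x \<in> S" for x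
    using DK[OF that] by (simp add: vec_eq_iff)
  have "((\<lambda>r. r *\<^sub>R (vec 1 :: real^1)) \<circ> K) absolutely_integrable_on S"
    by (rule absolutely_integrable_linear[OF Kint bounded_linear_scaleR_left])
  then have "(\<lambda>x. K x *\<^sub>R (vec 1 :: real^1)) absolutely_integrable_on S" by (simp only: o_def)
  then have int: "(\<lambda>x. \<bar>det (matrix (g' x))\<bar> *\<^sub>R (vec (f (g x)) :: real^1)) absolutely_integrable_on S"
    by (rule set_integrable_cong[OF refl refl DK', THEN iffD2, rotated])
  then have 1: "(\<lambda>y. vec (f y) :: real^1) absolutely_integrable_on g ` S"
    and 2: "integral (g ` S) (\<lambda>y. vec (f y) :: real^1) =
      integral S (\<lambda>x. \<bar>det (matrix (g' x))\<bar> *\<^sub>R (vec (f (g x)) :: real^1))"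
    using has_absolute_integral_change_of_variables[of S g g' "\<lambda>y. vec (f y) :: real^1"
       "integral S (\<lambda>x. \<bar>det (matrix (g' x))\<bar> *\<^sub>R (vec (f (g x)) :: real^1))"]
      g'(1) inj by (auto simp: S_def has_derivative_at_withinI)
  have "integral (g ` S) f = integral (g ` S) ((\<lambda>v. v $ 1) \<circ> (\<lambda>y. vec (f y) :: real^1))" by (simp add: o_def)
  also have "\<dots> = integral S (\<lambda>x. \<bar>det (matrix (g' x))\<bar> *\<^sub>R (vec (f (g x)) :: real^1)) $ 1"
    unfolding 2[symmetric]
    by (rule integral_linear[OF set_lebesgue_integral_eq_integral(1)[OF 1] bounded_linear_vec_nth])
  also have "\<dots> = integral S ((\<lambda>v. v $ 1) \<circ> (\<lambda>x. \<bar>det (matrix (g' x))\<bar> *\<^sub>R (vec (f (g x)) :: real^1)))"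
    by (rule integral_linear[OF set_lebesgue_integral_eq_integral(1)[OF int] bounded_linear_vec_nth, symmetric])
  also have "\<dots> = integral S K"
    by (rule integral_cong) (simp add: DK)
  finally have "integral (g ` S) f = integral S K" .
  moreover have "integral (g ` S) f = integral ?B f"
  proof (rule integral_spike_set)
    have "g ` S - ?B = {}" using sub by blast
    then show "negligible {x \<in> g ` S - ?B. f x \<noteq> 0}" by (metis (lifting) Collect_empty_eq empty_iff negligible_empty)
    show "negligible {x \<in> ?B - g ` S. f x \<noteq> 0}" by (rule negligible_subset[OF negl]) auto
  qed
  ultimately have "integral ?B f = integral S K" by simp
  also have "\<dots> = \<bar>det (matrix L)\<bar> * (1/3 * integral (cbox (0, 0) (pi, 2 * pi)) k)"
    unfolding S_def K_def integral_open_interval integral_mult_right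
    by (subst integral_box3[OF contk]) simp
  finally show ?thesis by (simp add: k_def)
qed

end

text \<open>The weight of the pulled-back norm contains \<open>\<bar>det (matrix L)\<bar>\<close> by
  \<open>det_fundamental_change\<close>. Hence \<open>integral_unit_ball\<close>, used once for
  \<open>L\<close> and once for the identity, turns both sides into the same volume
  integral.\<close>

lemma indicatrix_integral_linear:
  assumes L: "linear L" "inj L"
    and cont: "continuous_on (UNIV - {0}) h"
    and h_homog: "\<And>t y. t > 0 \<Longrightarrow> y \<noteq> 0 \<Longrightarrow> h (t *\<^sub>R y) = h y"
  shows "indicatrix_integral (\<lambda>y. \<phi> (L y)) (\<lambda>y. h (L y)) = indicatrix_integral \<phi> h"
proof -
  interpret L: minkowski "\<lambda>y. \<phi> (L y)" by (rule minkowski_change[OF L])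
  define f where "f = (\<lambda>y. sqrt (det (fundamental_matrix \<phi> y)) * h y)"
  have f: "continuous_on (UNIV - {0}) f"
    unfolding f_def by (intro continuous_intros continuous_det_fundamental cont)
  have f_homog: "f (t *\<^sub>R y) = f y" if "t > 0" "y \<noteq> 0" for t y
    using that by (simp add: f_def fundamental_matrix_scale h_homog)
  have hL: "h (L (sphere_point s /\<^sub>R \<phi> (L (sphere_point s)))) = h (L (sphere_point s))" for s
    using h_homog[of "inverse (\<phi> (L (sphere_point s)))"] L.pos[OF sphere_point_nz[of s]] L(1)
      L_nz[OF L sphere_point_nz] by (simp add: linear_scale)
  have h: "h (sphere_point s /\<^sub>R \<phi> (sphere_point s)) = h (sphere_point s)" for s
    using h_homog[of "inverse (\<phi> (sphere_point s))"] pos[OF sphere_point_nz[of s]] sphere_point_nz by simp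
  have "indicatrix_integral (\<lambda>y. \<phi> (L y)) (\<lambda>y. h (L y)) =
     integral (cbox (0, 0) (pi, 2 * pi)) (\<lambda>s. \<bar>det (matrix L)\<bar> * (sin (fst s) *
       (f (L (sphere_point s)) / \<phi> (L (sphere_point s)) ^ 3)))"
    unfolding L.indicatrix_integral_eq L.weight_def hL det_fundamental_change[OF L sphere_point_nz]
    by (simp add: f_def real_sqrt_mult mult_ac)
  also have "\<dots> = 3 * integral {y. y \<noteq> 0 \<and> \<phi> y < 1} f"
    unfolding integral_mult_right by (rule integral_unit_ball[OF L f f_homog])
  also have "\<dots> = integral (cbox (0, 0) (pi, 2 * pi)) (\<lambda>s. sin (fst s) *
       (f (sphere_point s) / \<phi> (sphere_point s) ^ 3))"
    using integral_unit_ball[OF linear_id inj_on_id f f_homog] by (simp add: id_def)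
  also have "\<dots> = indicatrix_integral \<phi> h"
    unfolding indicatrix_integral_eq weight_def h by (simp add: f_def mult_ac)
  finally show ?thesis .
qed

end

section \<open>Linear ordinary differential equations\<close>

text \<open>Picard iteration as a fixed point of a contraction. Because the equation is linear, the
  Lipschitz bound is global in the unknown and the iterates need not be confined to a ball.\<close>

lemma linear_ode_local_solution:
  fixes A :: "real \<Rightarrow> 'b::banach \<Rightarrow>\<^sub>L 'b"
  assumes a: "a > 0" and A: "continuous_on {-a..a} A"
  obtains e X where "e > 0" "e \<le> a" "X 0 = x0"
    "\<And>t. t \<in> {-e<..<e} \<Longrightarrow> (X has_vector_derivative A t (X t)) (at t)"
proof -
  have "bounded (A ` {-a..a})"
    by (rule compact_imp_bounded[OF compact_continuous_image[OF A compact_Icc]])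
  then obtain C where C: "\<And>t. t \<in> {-a..a} \<Longrightarrow> norm (A t) \<le> C" "C > 0"
    unfolding bounded_pos by (meson imageI)
  \<comment> \<open>Two integrals over intervals of length at most \<open>2 * e\<close> enter the
    Lipschitz estimate, so \<open>e * C \<le> 1/8\<close> gives the contraction constant
    1/2.\<close>
  define e where "e = min a (1 / (8 * C))"
  have e: "e > 0" "e \<le> a" "e * C \<le> 1/8"
    using a C(2) by (auto simp: e_def min_def field_simps)
  have Ae: "continuous_on {-e..e} A" by (rule continuous_on_subset[OF A]) (use e in auto)
  \<comment> \<open>Clamping the time to \<open>{-e..e}\<close> extends the iterates to the whole
    line, which makes the complete space of bounded continuous functions available.\<close>
  define cl where "cl = (\<lambda>t. max (-e) (min e t))"
  have cl: "cl t \<in> {-e..e}" for t using e by (auto simp: cl_def)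
  have cl_id: "cl t = t" if "t \<in> {-e..e}" for t using that by (auto simp: cl_def)
  \<comment> \<open>Starting at \<open>-e\<close> rather than at 0 treats both directions of time at
    once; \<open>T\<close> subtracts the value at 0 to restore the initial condition.\<close>
  define I where "I = (\<lambda>f t. integral {-e..t} (\<lambda>s. A s (apply_bcontfun f s)))"
  define T where "T = (\<lambda>f t. x0 + (I f (cl t) - I f 0))"
  have cont_f: "continuous_on S (apply_bcontfun f)" for S and f :: "real \<Rightarrow>\<^sub>C 'b"
    using apply_bcontfun[of f] by (auto simp: bcontfun_def intro: continuous_on_subset)
  have cont: "continuous_on {-e..e} (\<lambda>s. A s (apply_bcontfun f s))" for f
    by (intro continuous_intros Ae cont_f)
  have int: "(\<lambda>s. A s (apply_bcontfun f s)) integrable_on {-e..t}" if "t \<in> {-e..e}" for f t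
    by (rule integrable_continuous_real[OF continuous_on_subset[OF cont]]) (use that in auto)
  have contI: "continuous_on {-e..e} (I f)" for f
    unfolding I_def by (rule indefinite_integral_continuous_1[OF integrable_continuous_real[OF cont]])
  have contT: "continuous_on UNIV (T f)" for f
    unfolding T_def
    by (intro continuous_intros continuous_on_compose2[OF contI]) (use cl in \<open>auto simp: cl_def intro!: continuous_intros\<close>)
  have T: "T f \<in> bcontfun" for f
  proof -
    have "bounded (I f ` {-e..e})"
      by (rule compact_imp_bounded[OF compact_continuous_image[OF contI compact_Icc]])
    then obtain K where K: "\<And>t. t \<in> {-e..e} \<Longrightarrow> norm (I f t) \<le> K"
      unfolding bounded_iff by (meson imageI)
    have "norm (T f t) \<le> norm x0 + (K + norm (I f 0))" for t
    proof -
      have "norm (T f t) \<le> norm x0 + norm (I f (cl t) - I f 0)"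
        unfolding T_def by (rule norm_triangle_ineq)
      moreover have "norm (I f (cl t) - I f 0) \<le> norm (I f (cl t)) + norm (I f 0)"
        by (rule norm_triangle_ineq4)
      ultimately show ?thesis using K[OF cl[of t]] by linarith
    qed
    then show ?thesis by (rule bcontfun_normI[OF contT])
  qed
  have lip: "dist (T f t) (T g t) \<le> 1/2 * dist f g" for f g t
  proof -
    have diff: "norm (I f r - I g r) \<le> 1/4 * dist f g" if r: "r \<in> {-e..e}" for r
    proof -
      have "I f r - I g r = integral {-e..r} (\<lambda>s. A s (apply_bcontfun f s) - A s (apply_bcontfun g s))"
        unfolding I_def by (rule integral_diff[OF int[OF r] int[OF r], symmetric])
      also have "norm \<dots> \<le> (C * dist f g) * (r - - e)"
      proof (rule integral_bound)
        show "continuous_on {-e..r} (\<lambda>s. A s (apply_bcontfun f s) - A s (apply_bcontfun g s))"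
          by (intro continuous_on_diff continuous_on_subset[OF cont]) (use r in auto)
        fix s assume s: "s \<in> {-e..r}"
        have "norm (A s (apply_bcontfun f s) - A s (apply_bcontfun g s)) =
            norm (A s (apply_bcontfun f s - apply_bcontfun g s))"
          by (simp add: blinfun.diff_right)
        also have "\<dots> \<le> norm (A s) * norm (apply_bcontfun f s - apply_bcontfun g s)"
          by (rule norm_blinfun)
        also have "\<dots> \<le> C * dist f g"
          using C dist_bounded[of f s g] s r e by (intro mult_mono) (auto simp: dist_norm)
        finally show "norm (A s (apply_bcontfun f s) - A s (apply_bcontfun g s)) \<le> C * dist f g" .
      qed (use r in auto)
      also have "\<dots> \<le> (C * dist f g) * (2 * e)"
        using r C(2) by (intro mult_left_mono) auto
      also have "\<dots> = 2 * (e * C) * dist f g" by simp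
      also have "\<dots> \<le> 2 * (1/8) * dist f g"
        using e(3) by (intro mult_right_mono) auto
      finally show ?thesis by simp
    qed
    have "dist (T f t) (T g t) = norm ((I f (cl t) - I g (cl t)) - (I f 0 - I g 0))"
      by (simp add: T_def dist_norm algebra_simps)
    also have "\<dots> \<le> 1/4 * dist f g + 1/4 * dist f g"
      by (rule order_trans[OF norm_triangle_ineq4 add_mono[OF diff[OF cl] diff]]) (use e in simp)
    finally show ?thesis by simp
  qed
  have "dist (Bcontfun (T f)) (Bcontfun (T g)) \<le> 1/2 * dist f g" for f g
    by (rule dist_bound) (simp only: Bcontfun_inverse[OF T] lip)
  then have "\<exists>!f. Bcontfun (T f) = f"
    by (intro banach_fix_type[of "1/2"]) auto
  then obtain f where f: "Bcontfun (T f) = f" by blast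
  have fT: "apply_bcontfun f = T f" using Bcontfun_inverse[OF T[of f]] unfolding f .
  show ?thesis
  proof (rule that[OF e(1,2), of "apply_bcontfun f"])
    show "apply_bcontfun f 0 = x0" unfolding fT T_def using cl_id[of 0] e by simp
    fix t assume t: "t \<in> {-e<..<e}"
    then have t': "t \<in> {-e..e}" by auto
    have "(I f has_vector_derivative A t (apply_bcontfun f t)) (at t within {-e..e})"
      unfolding I_def by (rule integral_has_vector_derivative[OF cont t'])
    then have "(I f has_vector_derivative A t (apply_bcontfun f t)) (at t)"
      using t by (simp add: at_within_Icc_at)
    then have "((\<lambda>s. x0 + (I f s - I f 0)) has_vector_derivative A t (apply_bcontfun f t)) (at t)"
      by (auto intro!: derivative_eq_intros)
    then show "(apply_bcontfun f has_vector_derivative A t (apply_bcontfun f t)) (at t)"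
    proof (rule has_vector_derivative_transform_within_open)
      show "open {-e<..<e}" "t \<in> {-e<..<e}" using t by auto
      show "x0 + (I f s - I f 0) = apply_bcontfun f s" if "s \<in> {-e<..<e}" for s
        unfolding fT T_def using cl_id[of s] that by simp
    qed
  qed
qed

text \<open>The equation for \<open>M\<close> is the transposed one; it makes \<open>M t\<close> the inverse of \<open>N t\<close>.\<close>

lemma linear_flow:
  fixes B :: "real \<Rightarrow> real^'n^'n"
  assumes a: "a > 0" and B: "continuous_on {-a..a} B"
  obtains e N M where "e > 0" "e \<le> a" "N 0 = mat 1" "M 0 = mat 1"
    "\<And>t. t \<in> {-e<..<e} \<Longrightarrow> (N has_vector_derivative B t ** N t) (at t)"
    "\<And>t. t \<in> {-e<..<e} \<Longrightarrow> (M has_vector_derivative - (M t ** B t)) (at t)"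
    "\<And>t. t \<in> {-e<..<e} \<Longrightarrow> M t ** N t = mat 1"
proof -
  have bb: "bounded_bilinear ((**) :: real^'n^'n \<Rightarrow> real^'n^'n \<Rightarrow> real^'n^'n)"
  proof -
    have "bilinear ((**) :: real^'n^'n \<Rightarrow> real^'n^'n \<Rightarrow> real^'n^'n)"
      unfolding bilinear_def
      by (auto intro!: linearI simp: matrix_matrix_mult_def
          vec_eq_iff sum_distrib_left algebra_simps sum.distrib)
    then show ?thesis by (simp add: bilinear_conv_bounded_bilinear)
  qed
  define A1 where "A1 = (\<lambda>t. Blinfun (\<lambda>X::real^'n^'n. B t ** X))"
  define A2 where "A2 = (\<lambda>t. Blinfun (\<lambda>X::real^'n^'n. - (X ** B t)))"
  have A1: "blinfun_apply (A1 t) X = B t ** X" for t X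
    unfolding A1_def
    by (rule fun_cong[OF bounded_linear_Blinfun_apply[OF bounded_bilinear.bounded_linear_right[OF bb, of "B t"]]])
  have A2: "blinfun_apply (A2 t) X = - (X ** B t)" for t X
    unfolding A2_def
    by (rule fun_cong[OF bounded_linear_Blinfun_apply[OF bounded_linear_minus[OF bounded_bilinear.bounded_linear_left[OF bb, of "B t"]]]])
  have cA: "continuous_on {-a..a} A1" "continuous_on {-a..a} A2"
    by (rule continuous_on_blinfun_componentwise, simp only: A1 A2,
        intro continuous_intros bounded_bilinear.continuous_on[OF bb] B)+
  obtain e1 N where N: "e1 > 0" "e1 \<le> a" "N 0 = mat 1"
    "\<And>t. t \<in> {-e1<..<e1} \<Longrightarrow> (N has_vector_derivative A1 t (N t)) (at t)"
    by (rule linear_ode_local_solution[OF a cA(1), of "mat 1"]) (rule that)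
  obtain e2 M where M: "e2 > 0" "e2 \<le> a" "M 0 = mat 1"
    "\<And>t. t \<in> {-e2<..<e2} \<Longrightarrow> (M has_vector_derivative A2 t (M t)) (at t)"
    by (rule linear_ode_local_solution[OF a cA(2), of "mat 1"]) (rule that)
  define e where "e = min e1 e2"
  have dN: "(N has_vector_derivative B t ** N t) (at t)" if "t \<in> {-e<..<e}" for t
    using N(4)[of t] that by (auto simp: A1 e_def min_def split: if_splits)
  have dM: "(M has_vector_derivative - (M t ** B t)) (at t)" if "t \<in> {-e<..<e}" for t
    using M(4)[of t] that by (auto simp: A2 e_def min_def split: if_splits)
  have "M t ** N t = mat 1" if t: "t \<in> {-e<..<e}" for t
  proof -
    have "((\<lambda>t. M t ** N t) has_vector_derivative 0) (at s)" if "s \<in> {-e<..<e}" for s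
    proof -
      have "((\<lambda>t. M t ** N t) has_vector_derivative M s ** (B s ** N s) + - (M s ** B s) ** N s) (at s)"
        by (rule bounded_bilinear.has_vector_derivative[OF bb dM[OF that] dN[OF that]])
      moreover have "M s ** (B s ** N s) + - (M s ** B s) ** N s = 0"
        by (simp add: matrix_mul_assoc bounded_bilinear.minus_left[OF bb])
      ultimately show ?thesis by simp
    qed
    then have d: "((\<lambda>t. M t ** N t) has_derivative (\<lambda>h. 0)) (at s within {-e<..<e})" if "s \<in> {-e<..<e}" for s
      using that by (simp add: has_vector_derivative_def has_derivative_at_withinI)
    have "convex {-e<..<e}" by (rule convex_real_interval)
    from has_derivative_zero_constant[OF this d] obtain c where c: "\<And>s. s \<in> {-e<..<e} \<Longrightarrow> M s ** N s = c"
      by blast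
    have "0 \<in> {-e<..<e}" using N(1) M(1) by (simp add: e_def)
    with c[of t] c[of 0] t have "M t ** N t = M 0 ** N 0" by simp
    then show ?thesis by (simp add: N(3) M(3))
  qed
  then show ?thesis
    by (intro that[of e N M] dN dM) (use N(1-3) M(1-3) in \<open>auto simp: e_def\<close>)
qed

section \<open>Charts and smooth functions\<close>

locale manifold3 =
  fixes A :: "'a::topological_space chart set"
  assumes atlas: "smooth_atlas A"

locale chart = manifold3 A for A :: "'a::topological_space chart set" +
  fixes U :: "'a set" and u :: "'a \<Rightarrow> real^3"
  assumes chart: "(U, u) \<in> charts A"
begin

abbreviation "ui \<equiv> inv_into U u"

lemma is_chart: "is_chart (U, u)"
  using chart by (simp add: charts_def)

lemma open_U: "open U" and open_uU: "open (u ` U)"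
  and homeo: "homeomorphism U (u ` U) u ui"
  using is_chart by (auto simp: is_chart_def)

lemma inj_u: "inj_on u U"
  using homeo unfolding homeomorphism_def by (metis inj_on_inverseI)

lemma ui_u [simp]: "p \<in> U \<Longrightarrow> ui (u p) = p"
  using inj_u by (rule inv_into_f_f)

lemma u_ui [simp]: "x \<in> u ` U \<Longrightarrow> u (ui x) = x"
  by (rule f_inv_into_f)

lemma ui_mem [simp]: "x \<in> u ` U \<Longrightarrow> ui x \<in> U"
  by (rule inv_into_into)

lemma continuous_u: "continuous_on U u" and continuous_ui: "continuous_on (u ` U) ui"
  using homeo by (auto simp: homeomorphism_def)

lemma open_image: "open W \<Longrightarrow> W \<subseteq> U \<Longrightarrow> open (u ` W)"
  using homeomorphism_imp_open_map[OF homeo, of W] open_U open_uU by (simp add: openin_open_eq)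

lemma open_preimage: "open T \<Longrightarrow> open (U \<inter> u -` T)"
  using continuous_open_preimage[OF continuous_u open_U, of T] by simp

lemma image_preimage: "T \<subseteq> u ` U \<Longrightarrow> u ` (U \<inter> u -` T) = T"
  by auto

lemma restrict: assumes "open W" "W \<subseteq> U" shows "(W, u) \<in> charts A"
proof -
  have inv_eq: "inv_into W u x = ui x" if "x \<in> u ` W" for x
    using that inj_on_subset[OF inj_u assms(2)] assms(2) by (auto simp: inv_into_f_f)
  have "homeomorphism W (u ` W) u ui"
    by (rule homeomorphism_of_subsets[OF homeo assms(2)]) (use assms(2) in auto)
  then have "homeomorphism W (u ` W) u (inv_into W u)"
    by (rule homeomorphism_cong) (use inv_eq in auto)
  then have 1: "is_chart (W, u)" using assms open_image by (simp add: is_chart_def)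
  have "smoothly_compatible (W, u) \<kappa>" if "\<kappa> \<in> A" for \<kappa>
  proof (cases \<kappa>)
    case (Pair V v)
    have c: "smoothly_compatible (U, u) (V, v)" and V: "is_chart (V, v)"
      using chart that atlas Pair by (auto simp: charts_def smooth_atlas_def)
    have op: "open (W \<inter> V)" using assms(1) V by (auto simp: is_chart_def)
    have "smooth_on (u ` (W \<inter> V)) (v \<circ> ui)"
      by (rule smooth_on_subset[of "u ` (U \<inter> V)"]) (use c assms(2) in \<open>auto simp: smoothly_compatible_def\<close>)
    moreover have "open (u ` (W \<inter> V))" by (rule open_image[OF op]) (use assms in auto)
    ultimately have "smooth_on (u ` (W \<inter> V)) (v \<circ> inv_into W u)"
      by (subst smooth_on_cong[of _ _ "v \<circ> ui"]) (use inv_eq in auto)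
    moreover have "smooth_on (v ` (W \<inter> V)) (u \<circ> inv_into V v)"
      by (rule smooth_on_subset[of "v ` (U \<inter> V)"]) (use c assms(2) in \<open>auto simp: smoothly_compatible_def\<close>)
    ultimately show ?thesis by (simp add: smoothly_compatible_def Pair)
  qed
  with 1 show ?thesis by (simp add: charts_def)
qed

end

lemma (in manifold3) chartI: "(U, u) \<in> charts A \<Longrightarrow> chart A U u"
  by unfold_locales

lemma (in manifold3) atlas_subset: "A \<subseteq> charts A"
  using atlas by (auto simp: smooth_atlas_def charts_def)

lemma (in manifold3) ex_chart: obtains U u where "(U, u) \<in> charts A" "p \<in> U"
proof -
  have "p \<in> (\<Union>(U, u)\<in>A. U)" using atlas by (simp add: smooth_atlas_def)
  then show ?thesis using atlas_subset that by auto
qed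

text \<open>Members of the maximal atlas are compatible with the charts in \<open>A\<close> by
  definition, but with each other only through a third chart: near each point the transition factors
  through some member of \<open>A\<close>.\<close>

lemma (in manifold3) charts_compatible:
  assumes "(U, u) \<in> charts A" "(V, v) \<in> charts A"
  shows "smooth_on (u ` (U \<inter> V)) (\<lambda>x. v (inv_into U u x))"
proof (rule smooth_on_local)
  interpret U: chart A U u by (rule chartI[OF assms(1)])
  interpret V: chart A V v by (rule chartI[OF assms(2)])
  fix x assume "x \<in> u ` (U \<inter> V)"
  then obtain p where p: "p \<in> U" "p \<in> V" "x = u p" by auto
  have "p \<in> (\<Union>(U, u)\<in>A. U)" using atlas by (simp add: smooth_atlas_def)
  then obtain W w where W: "(W, w) \<in> A" "p \<in> W" by auto
  interpret W: chart A W w by (rule chartI) (use W(1) atlas_subset in auto)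
  have "smoothly_compatible (U, u) (W, w)" "smoothly_compatible (V, v) (W, w)"
    using assms W(1) by (auto simp: charts_def)
  then have s1: "smooth_on (u ` (U \<inter> W)) (\<lambda>x. w (U.ui x))" and s2: "smooth_on (w ` (V \<inter> W)) (\<lambda>x. v (W.ui x))"
    by (auto simp: smoothly_compatible_def o_def)
  let ?T = "u ` (U \<inter> V \<inter> W)"
  have op: "open ?T" by (rule U.open_image) (use U.open_U V.open_U W.open_U in auto)
  have "smooth_on ?T (\<lambda>x. v (W.ui (w (U.ui x))))"
  proof (rule smooth_on_compose[OF op _ _ _ s2])
    show "open (w ` (V \<inter> W))" by (rule W.open_image) (use V.open_U W.open_U in auto)
    show "smooth_on ?T (\<lambda>x. w (U.ui x))" by (rule smooth_on_subset[OF s1]) auto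
  qed auto
  moreover have "v (W.ui (w (U.ui y))) = v (U.ui y)" if "y \<in> ?T" for y using that by auto
  ultimately have "smooth_on ?T (\<lambda>x. v (U.ui x))"
    by (rule smooth_on_cong[OF op, THEN iffD1, rotated])
  then show "\<exists>T. open T \<and> x \<in> T \<and> smooth_on T (\<lambda>x. v (U.ui x))"
    using op p W(2) by (intro exI[of _ ?T]) auto
qed

context chart
begin

text \<open>\<open>smooth_near\<close> speaks of an entire chart domain, so the chart is cut down to
  the preimage of \<open>T\<close>, which is again a chart of the maximal atlas.\<close>

lemma smooth_nearI:
  assumes "p \<in> U" "open T" "u p \<in> T" "T \<subseteq> u ` U" "smooth_on T (\<lambda>x. f (ui x))"
  shows "smooth_near A p f"
proof -
  let ?W = "U \<inter> u -` T"
  have W: "(?W, u) \<in> charts A" by (rule restrict[OF open_preimage[OF assms(2)]]) simp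
  have im: "u ` ?W = T" using image_preimage[OF assms(4)] .
  have "inv_into ?W u x = ui x" if "x \<in> T" for x
  proof -
    obtain q where q: "q \<in> ?W" "x = u q" using \<open>x \<in> T\<close> im by (metis imageE)
    then show ?thesis using inv_into_f_f[OF inj_on_subset[OF inj_u], of ?W q] by simp
  qed
  then have "smooth_on (u ` ?W) (f \<circ> inv_into ?W u)"
    unfolding im using smooth_on_cong[OF assms(2), of "f \<circ> inv_into ?W u" "\<lambda>x. f (ui x)"] assms(5) by simp
  then show ?thesis using W assms(1,3) unfolding smooth_near_def by (intro bexI[OF _ W]) auto
qed

lemma smooth_nearD:
  assumes "smooth_near A p f" "p \<in> U"
  obtains T where "open T" "u p \<in> T" "T \<subseteq> u ` U" "smooth_on T (\<lambda>x. f (ui x))"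
proof -
  obtain V v where V: "(V, v) \<in> charts A" "p \<in> V" "smooth_on (v ` V) (f \<circ> inv_into V v)"
    using assms(1) unfolding smooth_near_def by auto
  interpret V: chart A V v by (rule chartI[OF V(1)])
  let ?T = "u ` (U \<inter> V)"
  have op: "open ?T" by (rule open_image) (use open_U V.open_U in auto)
  have "smooth_on ?T (\<lambda>x. (f \<circ> V.ui) (v (ui x)))"
    by (rule smooth_on_compose[OF op V.open_uU _ charts_compatible[OF chart V(1)] V(3)]) auto
  moreover have "(f \<circ> V.ui) (v (ui x)) = f (ui x)" if "x \<in> ?T" for x using that by auto
  ultimately have "smooth_on ?T (\<lambda>x. f (ui x))"
    by (rule smooth_on_cong[OF op, THEN iffD1, rotated])
  then show ?thesis using that[of ?T] op assms(2) V(2) by blast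
qed

lemma smooth_on_iff_smooth_near:
  "smooth_on (u ` U) (\<lambda>x. f (ui x)) \<longleftrightarrow> (\<forall>p\<in>U. smooth_near A p f)"
proof
  assume "smooth_on (u ` U) (\<lambda>x. f (ui x))"
  then show "\<forall>p\<in>U. smooth_near A p f" using smooth_nearI[OF _ open_uU] by auto
next
  assume s: "\<forall>p\<in>U. smooth_near A p f"
  show "smooth_on (u ` U) (\<lambda>x. f (ui x))"
  proof (rule smooth_on_local)
    fix x assume "x \<in> u ` U"
    then obtain p where "p \<in> U" "x = u p" by auto
    then show "\<exists>T. open T \<and> x \<in> T \<and> smooth_on T (\<lambda>x. f (ui x))"
      using smooth_nearD[of p f] s by metis
  qed
qed

end

context manifold3
begin

lemma smooth_near_const: "smooth_near A p (\<lambda>q. c)"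
proof -
  obtain U u where U: "(U, u) \<in> charts A" "p \<in> U" by (rule ex_chart)
  interpret chart A U u by (rule chartI[OF U(1)])
  show ?thesis by (rule smooth_nearI[OF U(2) open_uU]) (use U(2) smooth_on_const[OF open_uU] in auto)
qed

lemma smooth_near_add:
  assumes "smooth_near A p f" "smooth_near A p g" shows "smooth_near A p (\<lambda>q. f q + g q)"
    and "smooth_near A p (\<lambda>q. f q * g q)"
proof -
  obtain U u where U: "(U, u) \<in> charts A" "p \<in> U" by (rule ex_chart)
  interpret chart A U u by (rule chartI[OF U(1)])
  obtain S where S: "open S" "u p \<in> S" "S \<subseteq> u ` U" "smooth_on S (\<lambda>x. f (ui x))"
    by (rule smooth_nearD[OF assms(1) U(2)])
  obtain T where T: "open T" "u p \<in> T" "T \<subseteq> u ` U" "smooth_on T (\<lambda>x. g (ui x))"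
    by (rule smooth_nearD[OF assms(2) U(2)])
  have op: "open (S \<inter> T)" using S T by blast
  have s: "smooth_on (S \<inter> T) (\<lambda>x. f (ui x))" "smooth_on (S \<inter> T) (\<lambda>x. g (ui x))"
    using smooth_on_subset[OF S(4)] smooth_on_subset[OF T(4)] by auto
  show "smooth_near A p (\<lambda>q. f q + g q)"
    by (rule smooth_nearI[OF U(2) op _ _ smooth_on_add[OF op s]]) (use S T in auto)
  show "smooth_near A p (\<lambda>q. f q * g q)"
    by (rule smooth_nearI[OF U(2) op _ _ smooth_on_mult[OF op s]]) (use S T in auto)
qed

lemmas smooth_near_mult = smooth_near_add(2)

lemma smooth_near_sum:
  "(\<And>i. i \<in> I \<Longrightarrow> smooth_near A p (f i)) \<Longrightarrow> smooth_near A p (\<lambda>q. \<Sum>i\<in>I. f i q)"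
  by (induction I rule: infinite_finite_induct) (auto intro: smooth_near_const smooth_near_add)

lemma smooth_near_cong:
  assumes "open W" "p \<in> W" "\<And>q. q \<in> W \<Longrightarrow> f q = g q"
  shows "smooth_near A p f \<longleftrightarrow> smooth_near A p g"
proof -
  have imp: "smooth_near A p g" if f: "smooth_near A p f" and eq: "\<And>q. q \<in> W \<Longrightarrow> f q = g q" for f g
  proof -
    obtain U u where U: "(U, u) \<in> charts A" "p \<in> U" by (rule ex_chart)
    interpret chart A U u by (rule chartI[OF U(1)])
    obtain T where T: "open T" "u p \<in> T" "T \<subseteq> u ` U" "smooth_on T (\<lambda>x. f (ui x))"
      by (rule smooth_nearD[OF f U(2)])
    let ?T = "T \<inter> u ` (U \<inter> W)"
    have op: "open ?T" using T(1) open_image[of "U \<inter> W"] open_U assms(1) by auto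
    have "smooth_on ?T (\<lambda>x. f (ui x))" by (rule smooth_on_subset[OF T(4)]) simp
    then have "smooth_on ?T (\<lambda>x. g (ui x))"
      by (rule smooth_on_cong[OF op, THEN iffD1, rotated]) (auto intro!: eq)
    then show ?thesis by (rule smooth_nearI[OF U(2) op, rotated 2]) (use T U(2) assms(2) in auto)
  qed
  show ?thesis using imp[of f g] imp[of g f] assms(3) by auto
qed

text \<open>The substitute for bump functions: only smoothness near \<open>p\<close> counts, so the
  indicator function of a neighbourhood is admissible.\<close>

lemma smooth_near_indicator: "open W \<Longrightarrow> p \<in> W \<Longrightarrow> smooth_near A p (indicator W)"
  using smooth_near_cong[of W p "indicator W" "\<lambda>q. 1"] smooth_near_const by auto

section \<open>Tangent vectors\<close>

lemma tangent_not_smooth: "v \<in> tangent_space A p \<Longrightarrow> \<not> smooth_near A p f \<Longrightarrow> v f = 0"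
  by (simp add: tangent_space_def)

lemma tangent_linear: "v \<in> tangent_space A p \<Longrightarrow> smooth_near A p f \<Longrightarrow> smooth_near A p g \<Longrightarrow>
    v (\<lambda>q. a * f q + b * g q) = a * v f + b * v g"
  by (simp add: tangent_space_def)

lemma tangent_mult: "v \<in> tangent_space A p \<Longrightarrow> smooth_near A p f \<Longrightarrow> smooth_near A p g \<Longrightarrow>
    v (\<lambda>q. f q * g q) = v f * g p + f p * v g"
  by (simp add: tangent_space_def)

lemma tangent_add: "v \<in> tangent_space A p \<Longrightarrow> smooth_near A p f \<Longrightarrow> smooth_near A p g \<Longrightarrow>
    v (\<lambda>q. f q + g q) = v f + v g"
  using tangent_linear[of v p f g 1 1] by simp

lemma tangent_const: assumes "v \<in> tangent_space A p" shows "v (\<lambda>q. c) = 0"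
proof -
  have "v (\<lambda>q. 1) = 0"
    using tangent_mult[OF assms smooth_near_const[of p 1] smooth_near_const[of p 1]] by simp
  moreover have "v (\<lambda>q. c) = c * v (\<lambda>q. 1)"
    using tangent_linear[OF assms smooth_near_const[of p 1] smooth_near_const[of p 1], of c 0] by simp
  ultimately show ?thesis by simp
qed

lemma tangent_sum:
  assumes "v \<in> tangent_space A p" "\<And>i. i \<in> I \<Longrightarrow> smooth_near A p (f i)"
  shows "v (\<lambda>q. \<Sum>i\<in>I. f i q) = (\<Sum>i\<in>I. v (f i))"
  using assms(2)
  by (induction I rule: infinite_finite_induct)
    (auto simp: tangent_const[OF assms(1)] tangent_add[OF assms(1)] smooth_near_sum)

text \<open>The difference \<open>?h\<close> of the two functions equals \<open>?h\<close> times
  \<open>1 - indicator W\<close>. Both factors vanish at \<open>p\<close>, so the product rule gives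
  0. If one function is not smooth near \<open>p\<close>, neither is the other, and both values are
  0 by convention.\<close>

lemma tangent_cong:
  assumes v: "v \<in> tangent_space A p" and W: "open W" "p \<in> W" "\<And>q. q \<in> W \<Longrightarrow> f q = g q"
  shows "v f = v g"
proof (cases "smooth_near A p f")
  case False
  then have "\<not> smooth_near A p g" using smooth_near_cong[OF W] by simp
  with False show ?thesis using tangent_not_smooth[OF v] by simp
next
  case True
  then have g: "smooth_near A p g" using smooth_near_cong[OF W] by simp
  let ?h = "\<lambda>q. 1 * f q + (- 1) * g q" and ?k = "\<lambda>q. 1 * 1 + (- 1) * indicator W q"
  have h: "smooth_near A p ?h"
    by (intro smooth_near_add smooth_near_mult smooth_near_const True g)
  have k: "smooth_near A p ?k"
    by (intro smooth_near_add smooth_near_mult smooth_near_const smooth_near_indicator W)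
  have "?h = (\<lambda>q. ?h q * ?k q)" using W(3) by (auto simp: fun_eq_iff indicator_def)
  then have "v ?h = v ?h * ?k p + ?h p * v ?k" using tangent_mult[OF v h k] by simp
  also have "\<dots> = 0" using W by simp
  finally have "v ?h = 0" .
  then show ?thesis unfolding tangent_linear[OF v True g] by simp
qed

end

lemma linear_sum_axis:
  fixes L :: "real^'n \<Rightarrow> 'b::real_vector"
  assumes "linear L" shows "L w = (\<Sum>i\<in>UNIV. (w $ i) *\<^sub>R L (axis i 1))"
proof -
  have "L w = L (\<Sum>i\<in>UNIV. (w $ i) *\<^sub>R axis i 1)" using basis_expansion[of w] by (simp add: scalar_mult_eq_scaleR)
  then show ?thesis using assms by (simp add: linear_sum linear_scale)
qed

context chart
begin

lemma coord_fun_smooth: assumes "p \<in> U" shows "smooth_near A p (\<lambda>q. u q $ i)"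
proof (rule smooth_nearI[OF assms open_uU])
  have "smooth_on (u ` U) (\<lambda>x. x $ i)" by (rule smooth_on_vec_nth[OF open_uU smooth_on_id[OF open_uU]])
  then show "smooth_on (u ` U) (\<lambda>x. u (ui x) $ i)"
    by (rule smooth_on_cong[OF open_uU, THEN iffD1, rotated]) simp
qed (use assms in auto)

lemma rep_has_derivative:
  assumes "smooth_near A p f" "p \<in> U"
  shows "((\<lambda>x. f (ui x)) has_derivative frechet_derivative (\<lambda>x. f (ui x)) (at (u p))) (at (u p))"
  by (rule smooth_nearD[OF assms]) (rule smooth_on_imp_has_derivative)

lemma coords_tvec_apply:
  assumes "smooth_near A p f" "p \<in> U"
  shows "coords_tvec A U u p y f = frechet_derivative (\<lambda>x. f (ui x)) (at (u p)) y"
proof -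
  have "frechet_derivative (\<lambda>x. f (ui x)) (at (u p)) y =
      (\<Sum>i\<in>UNIV. (y $ i) *\<^sub>R frechet_derivative (\<lambda>x. f (ui x)) (at (u p)) (axis i 1))"
    by (rule linear_sum_axis[OF has_derivative_linear[OF rep_has_derivative[OF assms]]])
  then show ?thesis
    using assms by (simp add: coords_tvec_def coord_vec_def pderiv_at_def o_def)
qed

lemma coords_tvec_not_smooth: "\<not> smooth_near A p f \<Longrightarrow> coords_tvec A U u p y f = 0"
  by (simp add: coords_tvec_def coord_vec_def)

lemma coord_vec_eq: "coord_vec A U u i p = coords_tvec A U u p (axis i 1)"
  by (auto simp: coords_tvec_def fun_eq_iff axis_def if_distrib[of "\<lambda>x. x * _"] cong: if_cong)

lemma coords_tvec_mem: assumes "p \<in> U" shows "coords_tvec A U u p y \<in> tangent_space A p"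
proof -
  let ?v = "coords_tvec A U u p y"
  have lin: "?v (\<lambda>q. a * f q + b * g q) = a * ?v f + b * ?v g"
    if f: "smooth_near A p f" and g: "smooth_near A p g" for f g a b
  proof -
    have s: "smooth_near A p (\<lambda>q. a * f q + b * g q)"
      by (intro smooth_near_add smooth_near_mult smooth_near_const f g)
    have "((\<lambda>x. a * f (ui x) + b * g (ui x)) has_derivative
      (\<lambda>y. a * frechet_derivative (\<lambda>x. f (ui x)) (at (u p)) y + b * frechet_derivative (\<lambda>x. g (ui x)) (at (u p)) y))
      (at (u p))"
      by (intro has_derivative_add has_derivative_mult_right rep_has_derivative f g assms)
    from frechet_derivative_at[OF this, symmetric] show ?thesis
      by (simp add: coords_tvec_apply[OF s assms] coords_tvec_apply[OF f assms] coords_tvec_apply[OF g assms])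
  qed
  have mult: "?v (\<lambda>q. f q * g q) = ?v f * g p + f p * ?v g"
    if f: "smooth_near A p f" and g: "smooth_near A p g" for f g
  proof -
    have s: "smooth_near A p (\<lambda>q. f q * g q)" by (rule smooth_near_mult[OF f g])
    have "((\<lambda>x. f (ui x) * g (ui x)) has_derivative
      (\<lambda>y. f (ui (u p)) * frechet_derivative (\<lambda>x. g (ui x)) (at (u p)) y +
        frechet_derivative (\<lambda>x. f (ui x)) (at (u p)) y * g (ui (u p)))) (at (u p))"
      by (intro has_derivative_mult rep_has_derivative f g assms)
    from frechet_derivative_at[OF this, symmetric] show ?thesis
      by (simp add: coords_tvec_apply[OF s assms] coords_tvec_apply[OF f assms] coords_tvec_apply[OF g assms] assms)
  qed
  show ?thesis
    unfolding tangent_space_def using lin mult coords_tvec_not_smooth by simp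
qed

lemma coord_fun_derivative:
  assumes "p \<in> U" shows "coords_tvec A U u p y (\<lambda>q. u q $ i) = y $ i"
proof -
  have "frechet_derivative (\<lambda>x. u (ui x) $ i) (at (u p)) = frechet_derivative (\<lambda>x. x $ i) (at (u p))"
    by (rule frechet_derivative_cong_open[OF open_uU]) (use assms in auto)
  also have "\<dots> = (\<lambda>x. x $ i)"
    by (rule frechet_derivative_at[symmetric], rule bounded_linear_imp_has_derivative, rule bounded_linear_vec_nth)
  finally show ?thesis
    by (simp add: coords_tvec_apply[OF coord_fun_smooth[OF assms] assms])
qed

lemma fibre_coords_coords_tvec: "p \<in> U \<Longrightarrow> fibre_coords u (coords_tvec A U u p y) = y"
  by (simp add: fibre_coords_def coord_fun_derivative)

lemma Basis_axis: "(Basis :: (real^'n) set) = (\<lambda>i. axis i 1) ` UNIV"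
  by (auto simp: Basis_vec_def)

text \<open>By \<open>hadamard\<close>, near \<open>p\<close> the function is a constant plus
  products of \<open>u^i - u^i(p)\<close> with smooth functions. A derivation kills the constant,
  and in each product it leaves its value on the coordinate times the second factor at
  \<open>p\<close>, which is a partial derivative.\<close>

lemma tangent_expand:
  assumes p: "p \<in> U" and v: "v \<in> tangent_space A p"
  shows "v = coords_tvec A U u p (fibre_coords u v)"
proof
  fix f
  show "v f = coords_tvec A U u p (fibre_coords u v) f"
  proof (cases "smooth_near A p f")
    case False
    then show ?thesis using tangent_not_smooth[OF v] coords_tvec_not_smooth by simp
  next
    case True
    then obtain T where T: "open T" "u p \<in> T" "T \<subseteq> u ` U" "smooth_on T (\<lambda>x. f (ui x))"
      by (rule smooth_nearD[OF _ p])
    then obtain r where r: "r > 0" "ball (u p) r \<subseteq> T" using open_contains_ball by blast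
    have fr: "smooth_on (ball (u p) r) (\<lambda>x. f (ui x))" by (rule smooth_on_subset[OF T(4) r(2)])
    obtain g where g: "\<And>b. smooth_on (ball (u p) r) (g b)"
      "\<And>b. g b (u p) = frechet_derivative (\<lambda>x. f (ui x)) (at (u p)) b"
      "\<And>x. x \<in> ball (u p) r \<Longrightarrow> f (ui x) = f (ui (u p)) + (\<Sum>b\<in>Basis. ((x - u p) \<bullet> b) * g b x)"
      by (rule hadamard[OF fr r(1)]) (rule that)
    have sub: "ball (u p) r \<subseteq> u ` U" using r(2) T(3) by blast
    define G where "G = (\<lambda>i q. g (axis i 1) (u q))"
    have Gs: "smooth_near A p (G i)" for i
    proof (rule smooth_nearI[OF p _ _ sub])
      show "smooth_on (ball (u p) r) (\<lambda>x. G i (ui x))"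
        using g(1)[of "axis i 1"]
        by (rule smooth_on_cong[OF open_ball, THEN iffD1, rotated]) (use sub in \<open>auto simp: G_def\<close>)
    qed (use r(1) in auto)
    define h where "h = (\<lambda>i q. 1 * (u q $ i) + (- u p $ i) * 1)"
    have hs: "smooth_near A p (h i)" for i
      unfolding h_def by (intro smooth_near_add smooth_near_mult smooth_near_const coord_fun_smooth[OF p])
    have vh: "v (h i) = fibre_coords u v $ i" for i
      unfolding h_def using tangent_linear[OF v coord_fun_smooth[OF p] smooth_near_const[of p 1], of 1 i "- u p $ i"]
        tangent_const[OF v, of 1]
      by (simp add: fibre_coords_def)
    have hGs: "smooth_near A p (\<lambda>q. h i q * G i q)" for i by (rule smooth_near_mult[OF hs Gs])
    have "v f = v (\<lambda>q. f p + (\<Sum>i\<in>UNIV. h i q * G i q))"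
    proof (rule tangent_cong[OF v open_preimage[OF open_ball]])
      show "p \<in> U \<inter> u -` ball (u p) r" using p r(1) by simp
      fix q assume "q \<in> U \<inter> u -` ball (u p) r"
      then have q: "q \<in> U" "u q \<in> ball (u p) r" by auto
      have "f q = f p + (\<Sum>b\<in>Basis. ((u q - u p) \<bullet> b) * g b (u q))"
        using g(3)[OF q(2)] q(1) p by simp
      also have "(\<Sum>b\<in>Basis. ((u q - u p) \<bullet> b) * g b (u q)) = (\<Sum>i\<in>UNIV. h i q * G i q)"
        unfolding Basis_axis
        by (subst sum.reindex) (auto simp: inj_on_def axis_eq_axis h_def G_def inner_axis)
      finally show "f q = f p + (\<Sum>i\<in>UNIV. h i q * G i q)" .
    qed
    also have "\<dots> = v (\<lambda>q. f p) + v (\<lambda>q. \<Sum>i\<in>UNIV. h i q * G i q)"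
      by (rule tangent_add[OF v smooth_near_const smooth_near_sum[OF hGs]])
    also have "\<dots> = (\<Sum>i\<in>UNIV. v (\<lambda>q. h i q * G i q))"
      by (simp add: tangent_const[OF v] tangent_sum[OF v hGs])
    also have "\<dots> = (\<Sum>i\<in>UNIV. fibre_coords u v $ i * frechet_derivative (\<lambda>x. f (ui x)) (at (u p)) (axis i 1))"
      using tangent_mult[OF v hs Gs] by (simp add: vh) (simp add: h_def G_def g(2))
    also have "\<dots> = frechet_derivative (\<lambda>x. f (ui x)) (at (u p)) (fibre_coords u v)"
      using linear_sum_axis[OF has_derivative_linear[OF rep_has_derivative[OF True p]], of "fibre_coords u v"] by simp
    also have "\<dots> = coords_tvec A U u p (fibre_coords u v) f" by (rule coords_tvec_apply[OF True p, symmetric])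
    finally show ?thesis .
  qed
qed

lemma coords_tvec_add: "coords_tvec A U u p (y + z) f = coords_tvec A U u p y f + coords_tvec A U u p z f"
  by (simp add: coords_tvec_def sum.distrib algebra_simps)

lemma coords_tvec_scale: "coords_tvec A U u p (c *\<^sub>R y) f = c * coords_tvec A U u p y f"
  by (simp add: coords_tvec_def sum_distrib_left algebra_simps)

lemma coord_vec_apply_smooth:
  assumes p: "p \<in> U" and f: "smooth_near A p f"
  shows "smooth_near A p (\<lambda>q. coord_vec A U u i q f)"
proof -
  obtain T where T: "open T" "u p \<in> T" "T \<subseteq> u ` U" "smooth_on T (\<lambda>x. f (ui x))"
    by (rule smooth_nearD[OF f p])
  show ?thesis
  proof (rule smooth_nearI[OF p T(1-3)])
    show "smooth_on T (\<lambda>x. coord_vec A U u i (ui x) f)"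
      using smooth_on_frechet[OF T(4), of "axis i 1"]
    proof (rule smooth_on_cong[OF T(1), THEN iffD1, rotated])
      fix x assume x: "x \<in> T"
      then have "ui x \<in> U" "u (ui x) = x" using T(3) by auto
      moreover have "smooth_near A (ui x) f"
        by (rule smooth_nearI[OF _ T(1) _ T(3,4)]) (use x calculation in auto)
      ultimately show "frechet_derivative (\<lambda>x. f (ui x)) (at x) (axis i 1) = coord_vec A U u i (ui x) f"
        by (simp add: coord_vec_def pderiv_at_def o_def)
    qed
  qed
qed

end

context manifold3
begin

lemma tangent_space_add:
  assumes "v \<in> tangent_space A p" "w \<in> tangent_space A p"
  shows "(\<lambda>f. v f + w f) \<in> tangent_space A p"
  using assms unfolding tangent_space_def by (simp add: algebra_simps)

lemma tangent_space_scale: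
  assumes "v \<in> tangent_space A p" shows "(\<lambda>f. c * v f) \<in> tangent_space A p"
  using assms unfolding tangent_space_def by (simp add: algebra_simps)

lemma tangent_space_zero: "(\<lambda>f. 0) \<in> tangent_space A p"
  by (simp add: tangent_space_def)

lemma smooth_vfield_add:
  "smooth_vfield A W X \<Longrightarrow> smooth_vfield A W Y \<Longrightarrow> smooth_vfield A W (\<lambda>q f. X q f + Y q f)"
  unfolding smooth_vfield_def using tangent_space_add smooth_near_add(1) by simp

lemma smooth_vfield_mult:
  "(\<And>p. p \<in> W \<Longrightarrow> smooth_near A p h) \<Longrightarrow> smooth_vfield A W X \<Longrightarrow> smooth_vfield A W (\<lambda>q f. h q * X q f)"
  unfolding smooth_vfield_def using tangent_space_scale smooth_near_mult by simp

lemma smooth_vfield_sum: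
  "(\<And>i. i \<in> I \<Longrightarrow> smooth_vfield A W (X i)) \<Longrightarrow> smooth_vfield A W (\<lambda>q f. \<Sum>i\<in>I. X i q f)"
proof (induction I rule: infinite_finite_induct)
  case (insert x F)
  then show ?case using smooth_vfield_add[of W "X x" "\<lambda>q f. \<Sum>i\<in>F. X i q f"] by simp
qed (auto simp: smooth_vfield_def tangent_space_zero smooth_near_const)

lemma smooth_vfield_subset: "smooth_vfield A W X \<Longrightarrow> W' \<subseteq> W \<Longrightarrow> smooth_vfield A W' X"
  unfolding smooth_vfield_def by blast

lemma smooth_vfield_cong:
  assumes "open W" "\<And>q. q \<in> W \<Longrightarrow> X q = Y q" "smooth_vfield A W X"
  shows "smooth_vfield A W Y"
  unfolding smooth_vfield_def
proof (intro ballI conjI allI impI)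
  fix p assume p: "p \<in> W"
  show "Y p \<in> tangent_space A p" using assms(2)[OF p] assms(3) p by (auto simp: smooth_vfield_def)
  fix f assume "smooth_near A p f"
  then have "smooth_near A p (\<lambda>q. X q f)" using assms(3) p by (auto simp: smooth_vfield_def)
  then show "smooth_near A p (\<lambda>q. Y q f)"
    by (rule smooth_near_cong[OF assms(1) p, THEN iffD1, rotated]) (simp add: assms(2))
qed

lemma smooth_vfield_mem: "smooth_vfield A W X \<Longrightarrow> p \<in> W \<Longrightarrow> X p \<in> tangent_space A p"
  by (simp add: smooth_vfield_def)

lemma smooth_vfield_apply: "smooth_vfield A W X \<Longrightarrow> p \<in> W \<Longrightarrow> smooth_near A p f \<Longrightarrow> smooth_near A p (\<lambda>q. X q f)"
  by (simp add: smooth_vfield_def)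

end

context chart
begin

lemma smooth_vfield_coord_vec: "smooth_vfield A U (coord_vec A U u i)"
  unfolding smooth_vfield_def using coord_vec_apply_smooth coords_tvec_mem by (simp add: coord_vec_eq)

lemma smooth_vfield_coords_tvec: "smooth_vfield A U (\<lambda>q. coords_tvec A U u q y)"
proof -
  have "(\<lambda>q. coords_tvec A U u q y) = (\<lambda>q f. \<Sum>i\<in>UNIV. y $ i * coord_vec A U u i q f)"
    by (simp add: coords_tvec_def)
  then show ?thesis
    by (simp only:) (intro smooth_vfield_sum smooth_vfield_mult smooth_near_const smooth_vfield_coord_vec)
qed

end

section \<open>Linear connections in coordinates\<close>

locale connection = chart A U u for A :: "'a::topological_space chart set" and U u +
  fixes D :: "'a vfield \<Rightarrow> 'a vfield \<Rightarrow> 'a vfield"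
  assumes D: "linear_connection A D"
begin

context
  fixes W :: "'a set"
  assumes W: "open W"
begin

lemma smooth_D: "smooth_vfield A W X \<Longrightarrow> smooth_vfield A W Y \<Longrightarrow> smooth_vfield A W (D X Y)"
  using D W unfolding linear_connection_def by blast

lemma add_left: "smooth_vfield A W X \<Longrightarrow> smooth_vfield A W Y \<Longrightarrow> smooth_vfield A W Z \<Longrightarrow> p \<in> W \<Longrightarrow>
    D (\<lambda>q f. X q f + Z q f) Y p = (\<lambda>f. D X Y p f + D Z Y p f)"
  using D W unfolding linear_connection_def by blast

lemma add_right: "smooth_vfield A W X \<Longrightarrow> smooth_vfield A W Y \<Longrightarrow> smooth_vfield A W Z \<Longrightarrow> p \<in> W \<Longrightarrow>
    D X (\<lambda>q f. Y q f + Z q f) p = (\<lambda>f. D X Y p f + D X Z p f)"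
  using D W unfolding linear_connection_def by blast

lemma mult_left: "smooth_vfield A W X \<Longrightarrow> smooth_vfield A W Y \<Longrightarrow> (\<And>p. p \<in> W \<Longrightarrow> smooth_near A p h) \<Longrightarrow> p \<in> W \<Longrightarrow>
    D (\<lambda>q f. h q * X q f) Y p = (\<lambda>f. h p * D X Y p f)"
  using D W unfolding linear_connection_def by blast

lemma mult_right: "smooth_vfield A W X \<Longrightarrow> smooth_vfield A W Y \<Longrightarrow> (\<And>p. p \<in> W \<Longrightarrow> smooth_near A p h) \<Longrightarrow> p \<in> W \<Longrightarrow>
    D X (\<lambda>q f. h q * Y q f) p = (\<lambda>f. X p h * Y p f + h p * D X Y p f)"
  using D W unfolding linear_connection_def by blast

text \<open>After multiplication by the indicator function of \<open>W\<close> the two fields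
  coincide everywhere, not just on \<open>W\<close>. The rules for multiples recover the values at
  \<open>p\<close>, since the indicator is 1 there and has derivative 0.\<close>

lemma D_local:
  assumes p: "p \<in> W" and X: "smooth_vfield A W X" "\<And>q. q \<in> W \<Longrightarrow> X q = X' q"
    and Y: "smooth_vfield A W Y" "\<And>q. q \<in> W \<Longrightarrow> Y q = Y' q"
  shows "D X Y p = D X' Y' p"
proof -
  let ?h = "indicator W :: 'a \<Rightarrow> real"
  have h: "smooth_near A p ?h" if "p \<in> W" for p using smooth_near_indicator[OF W that] .
  have X': "smooth_vfield A W X'" by (rule smooth_vfield_cong[OF W X(2,1)])
  have Y': "smooth_vfield A W Y'" by (rule smooth_vfield_cong[OF W Y(2,1)])
  have "(\<lambda>q f. ?h q * X q f) = (\<lambda>q f. ?h q * X' q f)" using X(2) by (auto simp: fun_eq_iff indicator_def)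
  then have "D X Y p = D X' Y p"
    using mult_left[OF X(1) Y(1) h p] mult_left[OF X' Y(1) h p] p by simp
  have Xh: "X' p ?h = 0"
    using tangent_cong[OF smooth_vfield_mem[OF X' p] W p, of ?h "\<lambda>q. 1"]
      tangent_const[OF smooth_vfield_mem[OF X' p]] by simp
  have "(\<lambda>q f. ?h q * Y q f) = (\<lambda>q f. ?h q * Y' q f)" using Y(2) by (auto simp: fun_eq_iff indicator_def)
  then have "D X' Y p = D X' Y' p"
    using mult_right[OF X' Y(1) h p] mult_right[OF X' Y' h p] p Xh by simp
  with \<open>D X Y p = D X' Y p\<close> show ?thesis by simp
qed

lemma sum_left:
  assumes "finite I" "\<And>i. i \<in> I \<Longrightarrow> smooth_vfield A W (X i)" "smooth_vfield A W Y"
    "\<And>i p. i \<in> I \<Longrightarrow> p \<in> W \<Longrightarrow> smooth_near A p (h i)" "p \<in> W"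
  shows "D (\<lambda>q f. \<Sum>i\<in>I. h i q * X i q f) Y p = (\<lambda>f. \<Sum>i\<in>I. h i p * D (X i) Y p f)"
  using assms(1,2,4)
proof (induction I)
  case empty
  \<comment> \<open>The zero field is handled as a multiple of \<open>Y\<close>, so that the rule
    for multiples applies.\<close>
  have "D (\<lambda>q f. 0 * Y q f) Y p = (\<lambda>f. 0 * D Y Y p f)"
    by (rule mult_left[OF assms(3) assms(3) smooth_near_const assms(5)])
  then show ?case by simp
next
  case (insert i I)
  have 1: "smooth_vfield A W (\<lambda>q f. h i q * X i q f)" "smooth_vfield A W (\<lambda>q f. \<Sum>i\<in>I. h i q * X i q f)"
    using insert.prems by (auto intro!: smooth_vfield_sum smooth_vfield_mult)
  have "D (\<lambda>q f. h i q * X i q f + (\<Sum>i\<in>I. h i q * X i q f)) Y p =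
      (\<lambda>f. D (\<lambda>q f. h i q * X i q f) Y p f + D (\<lambda>q f. \<Sum>i\<in>I. h i q * X i q f) Y p f)"
    by (rule add_left[OF 1(1) assms(3) 1(2) assms(5)])
  moreover have "D (\<lambda>q f. h i q * X i q f) Y p = (\<lambda>f. h i p * D (X i) Y p f)"
    by (rule mult_left) (use insert.prems assms in auto)
  moreover have "D (\<lambda>q f. \<Sum>i\<in>I. h i q * X i q f) Y p = (\<lambda>f. \<Sum>i\<in>I. h i p * D (X i) Y p f)"
    by (rule insert.IH) (use insert.prems in auto)
  ultimately show ?case using insert.hyps by simp
qed

lemma sum_right:
  assumes "finite I" "\<And>i. i \<in> I \<Longrightarrow> smooth_vfield A W (Y i)" "smooth_vfield A W X"
    "\<And>i p. i \<in> I \<Longrightarrow> p \<in> W \<Longrightarrow> smooth_near A p (h i)" "p \<in> W"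
  shows "D X (\<lambda>q f. \<Sum>i\<in>I. h i q * Y i q f) p = (\<lambda>f. \<Sum>i\<in>I. X p (h i) * Y i p f + h i p * D X (Y i) p f)"
  using assms(1,2,4)
proof (induction I)
  case empty
  have "D X (\<lambda>q f. 0 * X q f) p = (\<lambda>f. X p (\<lambda>q. 0) * X p f + 0 * D X X p f)"
    by (rule mult_right[OF assms(3) assms(3) smooth_near_const assms(5)])
  then show ?case by (simp add: tangent_const[OF smooth_vfield_mem[OF assms(3,5)]])
next
  case (insert i I)
  have 1: "smooth_vfield A W (\<lambda>q f. h i q * Y i q f)" "smooth_vfield A W (\<lambda>q f. \<Sum>i\<in>I. h i q * Y i q f)"
    using insert.prems by (auto intro!: smooth_vfield_sum smooth_vfield_mult)
  have "D X (\<lambda>q f. h i q * Y i q f + (\<Sum>i\<in>I. h i q * Y i q f)) p =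
      (\<lambda>f. D X (\<lambda>q f. h i q * Y i q f) p f + D X (\<lambda>q f. \<Sum>i\<in>I. h i q * Y i q f) p f)"
    by (rule add_right[OF assms(3) 1 assms(5)])
  moreover have "D X (\<lambda>q f. h i q * Y i q f) p = (\<lambda>f. X p (h i) * Y i p f + h i p * D X (Y i) p f)"
    by (rule mult_right) (use insert.prems assms in auto)
  moreover have "D X (\<lambda>q f. \<Sum>i\<in>I. h i q * Y i q f) p = (\<lambda>f. \<Sum>i\<in>I. X p (h i) * Y i p f + h i p * D X (Y i) p f)"
    by (rule insert.IH) (use insert.prems in auto)
  ultimately show ?case using insert.hyps by simp
qed

end

definition Gam :: "'a \<Rightarrow> real^3 \<Rightarrow> real^3 \<Rightarrow> real^3" where
  "Gam p a b = (\<chi> l. \<Sum>i\<in>UNIV. \<Sum>j\<in>UNIV. a $ i * b $ j * christoffel A U u D i j l p)"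

lemma Gam_linear: "linear (\<lambda>a. Gam p a b)" "linear (\<lambda>b. Gam p a b)"
  by (auto intro!: linearI simp: Gam_def vec_eq_iff sum.distrib sum_distrib_left algebra_simps)

lemma christoffel_smooth:
  assumes "p \<in> U" shows "smooth_near A p (christoffel A U u D i j l)"
proof -
  have "smooth_vfield A U (D (coord_vec A U u i) (coord_vec A U u j))"
    by (rule smooth_D[OF open_U smooth_vfield_coord_vec smooth_vfield_coord_vec])
  from smooth_vfield_apply[OF this assms coord_fun_smooth[OF assms, of l]]
  show ?thesis by (simp add: christoffel_def[abs_def] fibre_coords_def)
qed

text \<open>Both fields are combinations of the coordinate fields only on
  \<open>W \<inter> U\<close>; \<open>D_local\<close> permits replacing them by these combinations,
  and the product rule then yields the derivative term and the Christoffel term.\<close>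

lemma D_coords:
  assumes W: "open W" "p \<in> W" and p: "p \<in> U" and X: "smooth_vfield A W X" and Y: "smooth_vfield A W Y"
  shows "fibre_coords u (D X Y p) $ l =
    X p (\<lambda>q. Y q (\<lambda>r. u r $ l)) + Gam p (fibre_coords u (X p)) (fibre_coords u (Y p)) $ l"
proof -
  let ?W = "W \<inter> U"
  let ?c = "coord_vec A U u"
  have op: "open ?W" and pW: "p \<in> ?W" using W p open_U by auto
  have XW: "smooth_vfield A ?W X" and YW: "smooth_vfield A ?W Y"
    using X Y by (auto intro: smooth_vfield_subset)
  have cW: "smooth_vfield A ?W (?c i)" for i by (rule smooth_vfield_subset[OF smooth_vfield_coord_vec]) simp
  let ?a = "\<lambda>i q. X q (\<lambda>r. u r $ i)" and ?b = "\<lambda>j q. Y q (\<lambda>r. u r $ j)"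
  have as: "smooth_near A q (?a i)" and bs: "smooth_near A q (?b i)" if "q \<in> ?W" for i q
    using that smooth_vfield_apply[OF XW that] smooth_vfield_apply[OF YW that] coord_fun_smooth by auto
  have expand: "Z q = (\<lambda>f. \<Sum>i\<in>UNIV. Z q (\<lambda>r. u r $ i) * ?c i q f)" if "smooth_vfield A ?W Z" "q \<in> ?W" for Z q
    using tangent_expand[OF _ smooth_vfield_mem[OF that]] that(2)
    by (simp add: coords_tvec_def fibre_coords_def)
  have "D X Y p = D (\<lambda>q f. \<Sum>i\<in>UNIV. ?a i q * ?c i q f) (\<lambda>q f. \<Sum>j\<in>UNIV. ?b j q * ?c j q f) p"
    by (rule D_local[OF op pW XW _ YW]) (fact expand[OF XW], fact expand[OF YW])
  also have "\<dots> = (\<lambda>f. \<Sum>i\<in>UNIV. ?a i p * D (?c i) (\<lambda>q f. \<Sum>j\<in>UNIV. ?b j q * ?c j q f) p f)"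
    by (rule sum_left[OF op]) (use W(2) p in \<open>auto intro!: cW as bs smooth_vfield_sum smooth_vfield_mult\<close>)
  also have "\<dots> = (\<lambda>f. \<Sum>i\<in>UNIV. ?a i p * (\<Sum>j\<in>UNIV. ?c i p (?b j) * ?c j p f + ?b j p * D (?c i) (?c j) p f))"
    by (subst sum_right[OF op]) (use W(2) p in \<open>auto intro!: cW bs\<close>)
  finally have "D X Y p (\<lambda>r. u r $ l) = (\<Sum>i\<in>UNIV. ?a i p * (\<Sum>j\<in>UNIV.
      ?c i p (?b j) * ?c j p (\<lambda>r. u r $ l) + ?b j p * D (?c i) (?c j) p (\<lambda>r. u r $ l)))"
    by (rule fun_cong)
  moreover have "?c j p (\<lambda>r. u r $ l) = (if j = l then 1 else 0)" for j
    unfolding coord_vec_eq coord_fun_derivative[OF p] by (simp add: axis_def)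
  moreover have delta: "(\<Sum>n\<in>UNIV. x * (g n * (if n = l then 1 else 0))) = x * g l" for x :: real and g
  proof -
    have "(\<Sum>n\<in>UNIV. x * (g n * (if n = l then 1 else 0))) = (\<Sum>n\<in>UNIV. if n = l then x * g n else 0)"
      by (rule sum.cong) auto
    then show ?thesis by simp
  qed
  ultimately have "D X Y p (\<lambda>r. u r $ l) = (\<Sum>i\<in>UNIV. ?a i p * ?c i p (?b l)) +
      (\<Sum>i\<in>UNIV. \<Sum>j\<in>UNIV. ?a i p * ?b j p * D (?c i) (?c j) p (\<lambda>r. u r $ l))"
    by (simp add: sum.distrib distrib_left sum_distrib_left mult.assoc delta)
  also have "(\<Sum>i\<in>UNIV. ?a i p * ?c i p (?b l)) = X p (?b l)"
    using fun_cong[OF expand[OF XW pW], of "?b l"] by simp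
  finally show ?thesis by (simp add: fibre_coords_def Gam_def christoffel_def)
qed

end

section \<open>Change of charts\<close>

locale two_charts = U: chart A U u + V: chart A V v
  for A :: "'a::topological_space chart set" and U u V v
begin

abbreviation "transition \<equiv> (\<lambda>x. v (U.ui x))"
abbreviation "jac p \<equiv> frechet_derivative transition (at (u p))"

lemma open_overlap: "open (u ` (U \<inter> V))"
  by (rule U.open_image) (use U.open_U V.open_U in auto)

lemma transition_smooth: "smooth_on (u ` (U \<inter> V)) transition"
  by (rule U.charts_compatible[OF U.chart V.chart])

lemma transition_nth_smooth: "smooth_on (u ` (U \<inter> V)) (\<lambda>x. transition x $ l)"
  by (rule smooth_on_vec_nth[OF open_overlap transition_smooth])

lemma frechet_transition_nth:
  assumes "x \<in> u ` (U \<inter> V)"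
  shows "frechet_derivative (\<lambda>x. transition x $ l) (at x) y = frechet_derivative transition (at x) y $ l"
  using frechet_derivative_at[OF bounded_linear.has_derivative[OF bounded_linear_vec_nth
        smooth_on_imp_has_derivative[OF transition_smooth assms]], of l] by (metis (lifting))

lemma linear_jacobian: "p \<in> U \<Longrightarrow> p \<in> V \<Longrightarrow> linear (jac p)"
  by (rule smooth_on_imp_linear_frechet[OF transition_smooth]) simp

lemma coords_tvec_transition:
  assumes "p \<in> U" "p \<in> V"
  shows "coords_tvec A U u p y (\<lambda>q. v q $ l) = frechet_derivative (\<lambda>x. transition x $ l) (at (u p)) y"
  by (rule U.coords_tvec_apply[OF V.coord_fun_smooth[OF assms(2)] assms(1)])

lemma fibre_coords_change:
  assumes "p \<in> U" "p \<in> V"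
  shows "fibre_coords v (coords_tvec A U u p y) = jac p y"
proof -
  have "u p \<in> u ` (U \<inter> V)" using assms by simp
  from frechet_transition_nth[OF this] show ?thesis
    by (simp add: fibre_coords_def vec_eq_iff coords_tvec_transition[OF assms])
qed

lemma coords_tvec_change:
  assumes "p \<in> U" "p \<in> V"
  shows "coords_tvec A U u p y = coords_tvec A V v p (jac p y)"
  using V.tangent_expand[OF assms(2) U.coords_tvec_mem[OF assms(1)]] fibre_coords_change[OF assms] by metis

lemma fibre_coords_change':
  assumes "p \<in> U" "p \<in> V" "w \<in> tangent_space A p"
  shows "fibre_coords v w = jac p (fibre_coords u w)"
  using U.tangent_expand[OF assms(1,3)] fibre_coords_change[OF assms(1,2)] by metis

end

locale connection_two_charts = U: connection A U u D + V: connection A V v D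
  for A :: "'a::topological_space chart set" and U u V v D

sublocale connection_two_charts \<subseteq> two_charts A U u V v
  by unfold_locales

context connection_two_charts
begin

text \<open>The derivative of one coordinate-constant field along another is computed in both
  charts. In \<open>u\<close> the components are constant and only the Christoffel term remains; in
  \<open>v\<close> they are first derivatives of the transition map, whence the Hessian
  term.\<close>

lemma Gam_change:
  assumes p: "p \<in> U" "p \<in> V"
  shows "jac p (U.Gam p a b) $ l =
    hessian (\<lambda>x. transition x $ l) (u p) b a + V.Gam p (jac p a) (jac p b) $ l"
proof -
  let ?W = "U \<inter> V"
  let ?X = "\<lambda>q. coords_tvec A U u q a" and ?Y = "\<lambda>q. coords_tvec A U u q b"
  have op: "open ?W" and pW: "p \<in> ?W" using p U.open_U V.open_U by auto
  have up: "u p \<in> u ` ?W" using pW by simp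
  have X: "smooth_vfield A ?W ?X" and Y: "smooth_vfield A ?W ?Y"
    by (auto intro: U.smooth_vfield_subset[OF U.smooth_vfield_coords_tvec])
  have Xp: "?X p \<in> tangent_space A p" using U.coords_tvec_mem[OF p(1)] .
  have sm: "smooth_near A p (\<lambda>q. ?Y q (\<lambda>r. v r $ l))"
    by (rule U.smooth_vfield_apply[OF Y pW V.coord_fun_smooth[OF p(2)]])
  have "?X p (\<lambda>q. ?Y q (\<lambda>r. v r $ l)) = frechet_derivative (\<lambda>x. ?Y (U.ui x) (\<lambda>r. v r $ l)) (at (u p)) a"
    by (rule U.coords_tvec_apply[OF sm p(1)])
  also have "frechet_derivative (\<lambda>x. ?Y (U.ui x) (\<lambda>r. v r $ l)) (at (u p)) =
      frechet_derivative (\<lambda>x. frechet_derivative (\<lambda>x. transition x $ l) (at x) b) (at (u p))"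
    by (rule frechet_derivative_cong_open[OF open_overlap up]) (auto simp: coords_tvec_transition)
  finally have 1: "?X p (\<lambda>q. ?Y q (\<lambda>r. v r $ l)) = hessian (\<lambda>x. transition x $ l) (u p) b a"
    by (simp add: hessian_def)
  have "?X p (\<lambda>q. ?Y q (\<lambda>r. u r $ k)) = ?X p (\<lambda>q. b $ k)" for k
    by (rule U.tangent_cong[OF Xp U.open_U p(1)]) (rule U.coord_fun_derivative)
  then have "fibre_coords u (D ?X ?Y p) $ k = U.Gam p a b $ k" for k
    unfolding U.D_coords[OF op pW p(1) X Y] U.fibre_coords_coords_tvec[OF p(1)]
    by (simp add: U.tangent_const[OF Xp])
  then have "fibre_coords u (D ?X ?Y p) = U.Gam p a b" by (simp add: vec_eq_iff)
  then have "fibre_coords v (D ?X ?Y p) = jac p (U.Gam p a b)"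
    using fibre_coords_change'[OF p U.smooth_vfield_mem[OF U.smooth_D[OF op X Y] pW]] by simp
  then show ?thesis
    using V.D_coords[OF op pW p(2) X Y, of l] by (simp only: 1 fibre_coords_change[OF p])
qed

end

lemma bounded_linear_matrix_vector_mult_left: "bounded_linear (\<lambda>M :: real^'n^'m. M *v y)"
proof -
  have "linear (\<lambda>M :: real^'n^'m. M *v y)"
    by (rule linearI) (simp_all add: matrix_vector_mult_add_rdistrib flip: scaleR_matrix_vector_assoc)
  then show ?thesis by (simp add: linear_conv_bounded_linear)
qed

lemma minus_matrix_vector_mult: "(- M) *v z = - (M *v z)" for M :: "real^'n^'m"
  by (simp add: matrix_vector_mult_def vec_eq_iff sum_negf)

text \<open>Base point and direction move together; expanding the direction in the basis reduces
  this to the ordinary product rule. It serves to differentiate the components of a transported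
  vector in a second chart.\<close>

lemma frechet_derivative_along_curve:
  fixes f :: "'b::euclidean_space \<Rightarrow> real"
  assumes "open S" "smooth_on S f" "x t \<in> S"
    and x: "(x has_vector_derivative w) (at t)" and z: "(z has_vector_derivative z') (at t)"
  shows "((\<lambda>s. frechet_derivative f (at (x s)) (z s)) has_real_derivative
    hessian f (x t) (z t) w + frechet_derivative f (at (x t)) z') (at t)"
proof -
  let ?d = "\<lambda>y. frechet_derivative f (at y)"
  have d: "((\<lambda>s. ?d (x s) b) has_vector_derivative hessian f (x t) b w) (at t)" for b
  proof -
    have "(x has_derivative (\<lambda>h. h *\<^sub>R w)) (at t)" using x by (simp add: has_vector_derivative_def)
    from has_derivative_compose[OF this smooth_on_imp_has_derivative[OF smooth_on_frechet[OF assms(2), of b] assms(3)]]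
    show ?thesis
      using hessian_linear_right[OF assms(2,3), of b]
      by (simp add: has_vector_derivative_def hessian_def[symmetric] linear_scale)
  qed
  have zb: "((\<lambda>s. z s \<bullet> b) has_vector_derivative z' \<bullet> b) (at t)" for b
    by (rule bounded_linear.has_vector_derivative[OF bounded_linear_inner_left z])
  have "((\<lambda>s. \<Sum>b\<in>Basis. (z s \<bullet> b) * ?d (x s) b) has_vector_derivative
      (\<Sum>b\<in>Basis. (z t \<bullet> b) * hessian f (x t) b w + (z' \<bullet> b) * ?d (x t) b)) (at t)"
    by (intro has_vector_derivative_sum has_vector_derivative_mult zb d)
  moreover have "(\<Sum>b\<in>Basis. (z t \<bullet> b) * hessian f (x t) b w + (z' \<bullet> b) * ?d (x t) b) =
      hessian f (x t) (z t) w + ?d (x t) z'"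
    using linear_sum_Basis[OF hessian_linear_left[OF assms(1,2,3)], of "z t" w]
      linear_sum_Basis[OF smooth_on_imp_linear_frechet[OF assms(2,3)], of z']
    by (simp add: sum.distrib)
  ultimately have sum: "((\<lambda>s. \<Sum>b\<in>Basis. (z s \<bullet> b) * ?d (x s) b) has_vector_derivative
      hessian f (x t) (z t) w + ?d (x t) z') (at t)" by simp
  have "\<exists>T. open T \<and> t \<in> T \<and> (\<forall>s\<in>T. x s \<in> S)"
    using has_vector_derivative_continuous[OF x] assms(1,3)
    unfolding continuous_at_open by (elim allE[of _ S]) simp
  then obtain T where T: "open T" "t \<in> T" "\<And>s. s \<in> T \<Longrightarrow> x s \<in> S" by blast
  have "((\<lambda>s. ?d (x s) (z s)) has_vector_derivative hessian f (x t) (z t) w + ?d (x t) z') (at t)"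
  proof (rule has_vector_derivative_transform_within_open[OF sum T(1,2)])
    show "(\<Sum>b\<in>Basis. (z s \<bullet> b) * ?d (x s) b) = ?d (x s) (z s)" if "s \<in> T" for s
      using linear_sum_Basis[OF smooth_on_imp_linear_frechet[OF assms(2) T(3)[OF that]], of "z s"] by simp
  qed
  then show ?thesis by (simp add: has_real_derivative_iff_has_vector_derivative)
qed

section \<open>Parallel transport along coordinate lines\<close>

context connection
begin

definition Gmat :: "real^3 \<Rightarrow> real^3 \<Rightarrow> real^3^3" where
  "Gmat x w = matrix (Gam (ui x) w)"

lemma Gmat_mult: "Gmat x w *v b = Gam (ui x) w b"
  unfolding Gmat_def using Gam_linear(2)[of "ui x" w] by (simp add: matrix_works)

lemma christoffel_ui_smooth: "smooth_on (u ` U) (\<lambda>x. christoffel A U u D i j l (ui x))"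
  using smooth_on_iff_smooth_near[of "christoffel A U u D i j l"] christoffel_smooth by blast

lemma continuous_Gmat: "continuous_on (u ` U) (\<lambda>x. Gmat x w)"
  unfolding Gmat_def matrix_def Gam_def
  by (intro continuous_intros smooth_on_imp_continuous_on[OF christoffel_ui_smooth])

text \<open>\<open>parallel_along\<close> demands the transport equation in every chart that meets
  the curve, whereas the flow \<open>N\<close> solves it in one. The transformation law of the
  Christoffel symbols carries the equation over.\<close>

lemma line_parallel:
  fixes N :: "real \<Rightarrow> real^3^3"
  assumes e: "e > 0" and line: "\<And>t. t \<in> {-e<..<e} \<Longrightarrow> x0 + t *\<^sub>R w \<in> u ` U"
    and N: "\<And>t. t \<in> {-e<..<e} \<Longrightarrow> (N has_vector_derivative - Gmat (x0 + t *\<^sub>R w) w ** N t) (at t)"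
  shows "smooth_curve_on A {-e<..<e} (\<lambda>t. ui (x0 + t *\<^sub>R w))"
    and "parallel_along A D {-e<..<e} (\<lambda>t. ui (x0 + t *\<^sub>R w))
      (\<lambda>t. coords_tvec A U u (ui (x0 + t *\<^sub>R w)) (N t *v y))"
proof -
  let ?I = "{-e<..<e}" and ?x = "\<lambda>t. x0 + t *\<^sub>R w" and ?c = "\<lambda>t. ui (x0 + t *\<^sub>R w)"
  have cx: "continuous_on T ?x" for T by (intro continuous_intros)
  have set_eq: "{t\<in>?I. ?c t \<in> V} = ?I \<inter> ?x -` (u ` (U \<inter> V))" for V
    using line by (force simp: image_iff)
  show "smooth_curve_on A ?I ?c"
    unfolding smooth_curve_on_def
  proof (intro conjI)
    show "continuous_on ?I ?c"
      by (rule continuous_on_compose2[OF continuous_ui cx]) (use line in auto)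
    show "\<forall>(V, v)\<in>charts A. smooth_on {t\<in>?I. ?c t \<in> V} (v \<circ> ?c)"
    proof clarify
      fix V v assume V: "(V, v) \<in> charts A"
      interpret V: chart A V v by (rule chartI[OF V])
      interpret two_charts A U u V v by unfold_locales
      have op: "open {t\<in>?I. ?c t \<in> V}"
        unfolding set_eq by (intro open_Int open_vimage open_overlap cx) auto
      have "smooth_on {t\<in>?I. ?c t \<in> V} (\<lambda>t. transition (?x t))"
      proof (rule smooth_on_compose[OF op open_overlap _ _ transition_smooth])
        show "smooth_on {t\<in>?I. ?c t \<in> V} ?x"
          by (intro smooth_on_add smooth_on_const smooth_on_scaleR smooth_on_id op)
      qed (use set_eq[of V] in blast)
      then show "smooth_on {t\<in>?I. ?c t \<in> V} (v \<circ> ?c)" by (simp add: o_def)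
    qed
  qed
  let ?z = "\<lambda>t. N t *v y"
  let ?X = "\<lambda>t. coords_tvec A U u (?c t) (?z t)"
  show "parallel_along A D ?I ?c ?X"
    unfolding parallel_along_def
  proof (intro ballI conjI, safe)
    fix t assume t: "t \<in> ?I"
    have c: "?c t \<in> U" using line[OF t] by simp
    show "?X t \<in> tangent_space A (?c t)" by (rule coords_tvec_mem[OF c])
    fix V v l assume V: "(V, v) \<in> charts A" and cV: "?c t \<in> V"
    interpret V: connection A V v D using D V by unfold_locales
    interpret connection_two_charts A U u V v D by unfold_locales
    have xt: "?x t \<in> u ` (U \<inter> V)" using t cV set_eq[of V] by blast
    have uc: "u (?c t) = ?x t" using line[OF t] by simp
    have dx: "(?x has_vector_derivative w) (at t)" by (auto intro!: derivative_eq_intros)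
    have dz: "(?z has_vector_derivative - Gam (?c t) w (?z t)) (at t)"
    proof -
      have "(- Gmat (?x t) w ** N t) *v y = - Gam (?c t) w (?z t)"
        by (simp only: matrix_vector_mul_assoc[symmetric] Gmat_mult[symmetric] minus_matrix_vector_mult)
      then show ?thesis
        using bounded_linear.has_vector_derivative[OF bounded_linear_matrix_vector_mult_left N[OF t], of y] by simp
    qed
    let ?K = "jac (?c t)"
    have linK: "linear ?K" by (rule linear_jacobian[OF c cV])
    let ?f = "\<lambda>x. transition x $ l"
    have "((\<lambda>s. frechet_derivative ?f (at (?x s)) (?z s)) has_real_derivative
        hessian ?f (?x t) (?z t) w + frechet_derivative ?f (at (?x t)) (- Gam (?c t) w (?z t))) (at t)"
      by (rule frechet_derivative_along_curve[OF open_overlap transition_nth_smooth xt dx dz])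
    \<comment> \<open>The Hessian from moving the base point is cancelled by the inhomogeneous term
      of \<open>Gam_change\<close>; symmetry of the roles of \<open>w\<close> and
      \<open>?z t\<close> there matches the order of the arguments.\<close>
    moreover have "hessian ?f (?x t) (?z t) w + frechet_derivative ?f (at (?x t)) (- Gam (?c t) w (?z t)) =
        - V.Gam (?c t) (?K w) (?K (?z t)) $ l"
      using Gam_change[OF c cV, of w "?z t" l] linK
      unfolding frechet_transition_nth[OF xt] uc by (simp add: linear_neg)
    ultimately have main: "((\<lambda>s. frechet_derivative ?f (at (?x s)) (?z s)) has_real_derivative
        - V.Gam (?c t) (?K w) (?K (?z t)) $ l) (at t)" by simp
    have op: "open {t\<in>?I. ?c t \<in> V}"
      unfolding set_eq by (intro open_Int open_vimage open_overlap cx) auto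
    have "((\<lambda>s. fibre_coords v (?X s) $ l) has_real_derivative
        - V.Gam (?c t) (?K w) (?K (?z t)) $ l) (at t)"
    proof (rule has_field_derivative_transform_within_open[OF main op])
      show "t \<in> {t\<in>?I. ?c t \<in> V}" using t cV by simp
      fix s assume s: "s \<in> {t\<in>?I. ?c t \<in> V}"
      then have cs: "?c s \<in> U" "u (?c s) = ?x s" "?c s \<in> V" using line[of s] by auto
      show "frechet_derivative ?f (at (?x s)) (?z s) = fibre_coords v (?X s) $ l"
        unfolding fibre_coords_def using coords_tvec_transition[OF cs(1,3), of "?z s" l] cs(2) by simp
    qed
    moreover have "deriv (\<lambda>s. v (?c s) $ i) t = ?K w $ i" for i
    proof -
      have "(?x has_derivative (\<lambda>h. h *\<^sub>R w)) (at t)" using dx by (simp add: has_vector_derivative_def)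
      from has_derivative_compose[OF this smooth_on_imp_has_derivative[OF transition_nth_smooth[of i] xt]]
      have "((\<lambda>s. v (?c s) $ i) has_derivative (\<lambda>h. frechet_derivative (\<lambda>x. transition x $ i) (at (?x t)) (h *\<^sub>R w))) (at t)" .
      moreover have "frechet_derivative (\<lambda>x. transition x $ i) (at (?x t)) (h *\<^sub>R w) = ?K w $ i * h" for h
        unfolding frechet_transition_nth[OF xt] using linK uc by (simp add: linear_scale)
      ultimately have "((\<lambda>s. v (?c s) $ i) has_real_derivative ?K w $ i) (at t)"
        by (simp add: has_field_derivative_def)
      then show ?thesis by (rule DERIV_imp_deriv)
    qed
    moreover have "fibre_coords v (?X t) = ?K (?z t)" by (rule fibre_coords_change[OF c cV])
    ultimately show "((\<lambda>s. fibre_coords v (?X s) $ l) has_real_derivative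
        - (\<Sum>i\<in>UNIV. \<Sum>j\<in>UNIV. christoffel A V v D i j l (?c t) *
               deriv (\<lambda>s. v (?c s) $ i) t * fibre_coords v (?X t) $ j)) (at t)"
      by (simp add: V.Gam_def mult_ac)
  qed
qed

text \<open>\<open>N t\<close> transports vectors from \<open>x0\<close> to
  \<open>x0 + t *\<^sub>R w\<close>, and compatibility makes it an isometry of the norms. Its
  inverse \<open>M t\<close> is kept alongside with its own derivative, since pulling data at the
  moving point back to \<open>x0\<close> involves the inverse.\<close>

lemma parallel_transport:
  assumes compat: "compatible_connection A F D" and x0: "x0 \<in> u ` U"
  obtains e N M where "e > 0" "N 0 = mat 1" "M 0 = mat 1"
    "\<And>t. t \<in> {-e<..<e} \<Longrightarrow> x0 + t *\<^sub>R w \<in> u ` U"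
    "\<And>t. t \<in> {-e<..<e} \<Longrightarrow> M t ** N t = mat 1"
    "\<And>t y. t \<in> {-e<..<e} \<Longrightarrow> in_chart A U u F (x0 + t *\<^sub>R w, N t *v y) = in_chart A U u F (x0, y)"
    "(N has_vector_derivative - Gmat x0 w) (at 0)"
    "(M has_vector_derivative Gmat x0 w) (at 0)"
proof -
  obtain r where r: "r > 0" "ball x0 r \<subseteq> u ` U" using open_uU x0 open_contains_ball by blast
  \<comment> \<open>The summand 1 avoids division by zero for \<open>w = 0\<close>; the choice of
    \<open>a\<close> keeps the line within half the radius of the ball.\<close>
  define n where "n = norm w + 1"
  define a where "a = r / (2 * n)"
  have nw: "n > 0" by (simp add: n_def add_nonneg_pos)
  have a: "a > 0" using r nw by (simp add: a_def)
  have line: "x0 + t *\<^sub>R w \<in> u ` U" if "t \<in> {-a..a}" for t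
  proof -
    have "norm (t *\<^sub>R w) \<le> a * n"
      unfolding norm_scaleR n_def by (rule mult_mono) (use that a in auto)
    also have "\<dots> = r / 2" using nw by (simp add: a_def)
    also have "\<dots> < r" using r by simp
    finally have "x0 + t *\<^sub>R w \<in> ball x0 r" by (simp add: dist_norm)
    then show ?thesis using r by blast
  qed
  let ?B = "\<lambda>t. - Gmat (x0 + t *\<^sub>R w) w"
  have "continuous_on {-a..a} ?B"
    by (rule continuous_on_minus, rule continuous_on_compose2[OF continuous_Gmat])
      (use line in \<open>auto intro!: continuous_intros\<close>)
  from linear_flow[OF a this] obtain e N M where e: "e > 0" "e \<le> a" "N 0 = mat 1" "M 0 = mat 1"
    and N: "\<And>t. t \<in> {-e<..<e} \<Longrightarrow> (N has_vector_derivative ?B t ** N t) (at t)"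
    and M: "\<And>t. t \<in> {-e<..<e} \<Longrightarrow> (M has_vector_derivative - (M t ** ?B t)) (at t)"
    and MN: "\<And>t. t \<in> {-e<..<e} \<Longrightarrow> M t ** N t = mat 1"
    by blast
  have 0: "0 \<in> {-e<..<e}" using e by simp
  have line': "x0 + t *\<^sub>R w \<in> u ` U" if "t \<in> {-e<..<e}" for t using line[of t] that e by auto
  have const: "in_chart A U u F (x0 + t *\<^sub>R w, N t *v y) = in_chart A U u F (x0, y)" if t: "t \<in> {-e<..<e}" for t y
  proof -
    have "open {-e<..<e}" "is_interval {-e<..<e}" by (auto simp: is_interval_oo)
    from compat[unfolded compatible_connection_def, rule_format, OF this
        line_parallel(1)[OF e(1) line' N] line_parallel(2)[OF e(1) line' N, of y] t 0]
    have "F (ui (x0 + t *\<^sub>R w)) (coords_tvec A U u (ui (x0 + t *\<^sub>R w)) (N t *v y)) =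
        F (ui (x0 + 0 *\<^sub>R w)) (coords_tvec A U u (ui (x0 + 0 *\<^sub>R w)) (N 0 *v y))" .
    then show ?thesis by (simp add: in_chart_def e(3))
  qed
  have "(N has_vector_derivative - Gmat x0 w) (at 0)" using N[OF 0] e(3) by simp
  moreover have "(M has_vector_derivative Gmat x0 w) (at 0)"
  proof -
    have "- (M 0 ** ?B 0) = Gmat x0 w" by (simp add: e(4))
    then show ?thesis using M[OF 0] by simp
  qed
  ultimately show ?thesis using that[of e N M] e line' MN const by blast
qed

end

section \<open>The averaged metric\<close>

definition averaged_matrix :: "(real^3 \<Rightarrow> real) \<Rightarrow> real^3^3" where
  "averaged_matrix \<phi> = (\<chi> i j. indicatrix_integral \<phi> (\<lambda>y. fundamental_matrix \<phi> y $ i $ j))"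

lemma inner_matrix_vector_sum:
  "a \<bullet> (M *v b) = (\<Sum>i\<in>UNIV. \<Sum>j\<in>UNIV. a $ i * b $ j * M $ i $ j)" for M :: "real^'n^'m"
  by (simp add: inner_vec_def matrix_vector_mult_def sum_distrib_left mult_ac)

lemma inner_matrix_axis: "axis i 1 \<bullet> (M *v axis j 1) = M $ i $ j" for M :: "real^'n^'m"
  by (simp add: matrix_vector_mul_component inner_axis' matrix_vector_mult_basis column_def)

context minkowski
begin

lemma continuous_quadratic: "continuous_on (UNIV - {0}) (\<lambda>y. a \<bullet> (fundamental_matrix \<phi> y *v b))"
  unfolding inner_matrix_vector_sum by (intro continuous_intros continuous_fundamental_nth)

lemma averaged_matrix_bilinear:
  "a \<bullet> (averaged_matrix \<phi> *v b) = indicatrix_integral \<phi> (\<lambda>y. a \<bullet> (fundamental_matrix \<phi> y *v b))"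
proof -
  have c: "continuous_on (UNIV - {0}) (\<lambda>y. a $ i * b $ j * fundamental_matrix \<phi> y $ i $ j)" for i j
    by (intro continuous_intros continuous_fundamental_nth)
  have "indicatrix_integral \<phi> (\<lambda>y. \<Sum>i\<in>UNIV. \<Sum>j\<in>UNIV. a $ i * b $ j * fundamental_matrix \<phi> y $ i $ j) =
      (\<Sum>i\<in>UNIV. \<Sum>j\<in>UNIV. indicatrix_integral \<phi> (\<lambda>y. a $ i * b $ j * fundamental_matrix \<phi> y $ i $ j))"
    by (subst indicatrix_integral_sum, simp, intro continuous_intros c,
        rule sum.cong[OF refl], subst indicatrix_integral_sum, simp, rule c, rule refl)
  then show ?thesis
    unfolding inner_matrix_vector_sum indicatrix_integral_cmult by (simp add: averaged_matrix_def)
qed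

lemma fundamental_matrix_sym: "y \<noteq> 0 \<Longrightarrow> a \<bullet> (fundamental_matrix \<phi> y *v b) = b \<bullet> (fundamental_matrix \<phi> y *v a)"
  unfolding fundamental_matrix_bilinear by (rule hessian_sym[OF open_punctured smooth_E]) simp

lemma averaged_matrix_sym: "a \<bullet> (averaged_matrix \<phi> *v b) = b \<bullet> (averaged_matrix \<phi> *v a)"
  unfolding averaged_matrix_bilinear by (rule indicatrix_integral_cong) (rule fundamental_matrix_sym)

lemma indicatrix_integral_nonneg:
  assumes "continuous_on (UNIV - {0}) h" "\<And>y. y \<noteq> 0 \<Longrightarrow> h y \<ge> 0"
  shows "indicatrix_integral \<phi> h \<ge> 0"
  unfolding indicatrix_integral_eq
proof (rule integral_nonneg[OF integrable_integrand[OF assms(1)]])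
  fix s :: "real \<times> real" assume "s \<in> cbox (0, 0) (pi, 2 * pi)"
  then have "sin (fst s) \<ge> 0" by (auto simp: mem_cbox_pair intro!: sin_ge_zero)
  moreover have "h (sphere_point s /\<^sub>R \<phi> (sphere_point s)) \<ge> 0"
    using pos[OF sphere_point_nz[of s]] by (intro assms(2)) (simp add: sphere_point_nz)
  ultimately show "0 \<le> sin (fst s) * (weight (sphere_point s) * h (sphere_point s /\<^sub>R \<phi> (sphere_point s)))"
    using weight_pos[OF sphere_point_nz[of s]] by simp
qed

lemma ex_unit: obtains y where "\<phi> y = 1"
proof -
  have "axis 1 1 \<noteq> (0 :: real^3)" by (simp add: axis_eq_0_iff)
  then have "\<phi> (axis 1 1) > 0" by (rule pos)
  then have "\<phi> (inverse (\<phi> (axis 1 1)) *\<^sub>R axis 1 1) = 1" using homog[of "inverse (\<phi> (axis 1 1))"] by simp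
  then show ?thesis by (rule that)
qed

lemma averaged_matrix_pos: assumes "a \<noteq> 0" shows "a \<bullet> (averaged_matrix \<phi> *v a) > 0"
proof -
  have nn: "a \<bullet> (fundamental_matrix \<phi> y *v a) \<ge> 0" if "y \<noteq> 0" for y
    using posdef[OF that assms] by simp
  have "indicatrix_integral \<phi> (\<lambda>y. a \<bullet> (fundamental_matrix \<phi> y *v a)) \<noteq> 0"
  proof
    assume z: "indicatrix_integral \<phi> (\<lambda>y. a \<bullet> (fundamental_matrix \<phi> y *v a)) = 0"
    obtain y where y: "\<phi> y = 1" by (rule ex_unit)
    then have "y \<noteq> 0" using zero by auto
    then show False
      using indicatrix_integral_nonneg_eq_0D[OF continuous_quadratic nn z y] posdef[OF _ assms, of y] by simp
  qed
  then show ?thesis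
    using indicatrix_integral_nonneg[OF continuous_quadratic nn] unfolding averaged_matrix_bilinear by simp
qed

text \<open>The form \<open>g\<close> transforms as a tensor and is homogeneous of degree 0 in the
  base vector, so \<open>indicatrix_integral_linear\<close> applies to it. Used twice: for
  independence of the chart and for invariance under parallel transport.\<close>

lemma averaged_matrix_change:
  assumes L: "linear L" "inj L"
  shows "a \<bullet> (averaged_matrix (\<lambda>y. \<phi> (L y)) *v b) = L a \<bullet> (averaged_matrix \<phi> *v L b)"
proof -
  interpret L: minkowski "\<lambda>y. \<phi> (L y)" by (rule minkowski_change[OF L])
  have "a \<bullet> (averaged_matrix (\<lambda>y. \<phi> (L y)) *v b) =
      indicatrix_integral (\<lambda>y. \<phi> (L y)) (\<lambda>y. L a \<bullet> (fundamental_matrix \<phi> (L y) *v L b))"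
    unfolding L.averaged_matrix_bilinear
    by (rule L.indicatrix_integral_cong)
      (simp add: L.fundamental_matrix_bilinear hessian_change[OF L] fundamental_matrix_bilinear L_nz[OF L])
  also have "\<dots> = L a \<bullet> (averaged_matrix \<phi> *v L b)"
    unfolding averaged_matrix_bilinear
    by (rule indicatrix_integral_linear[OF L continuous_quadratic]) (simp add: fundamental_matrix_scale)
  finally show ?thesis .
qed

end

text \<open>Turns fibrewise derivatives into derivatives on the bundle, where smoothness provides
  joint continuity in base point and vector.\<close>

lemma hessian_slice:
  assumes "open S" "smooth_on S H" "(x, y) \<in> S"
  shows "frechet_derivative (\<lambda>y. H (x, y)) (at y) a = frechet_derivative H (at (x, y)) (0, a)"
    and "hessian (\<lambda>y. H (x, y)) y a b = hessian H (x, y) (0, a) (0, b)"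
proof -
  have d: "(Pair x has_derivative Pair 0) (at y)" for y :: 'b
    using has_derivative_Pair[OF has_derivative_const has_derivative_ident, of x y UNIV] .
  have op: "open (Pair x -` S)" using assms(1) by (intro open_vimage) (auto intro!: continuous_intros)
  have 1: "frechet_derivative (\<lambda>y. H (x, y)) (at z) a = frechet_derivative H (at (x, z)) (0, a)"
    if "z \<in> Pair x -` S" for z a
    using frechet_derivative_at[OF has_derivative_compose[OF d smooth_on_imp_has_derivative[OF assms(2)]], of z] that
    by (simp add: fun_eq_iff)
  then show "frechet_derivative (\<lambda>y. H (x, y)) (at y) a = frechet_derivative H (at (x, y)) (0, a)"
    using assms(3) by simp
  have "frechet_derivative (\<lambda>z. frechet_derivative (\<lambda>y. H (x, y)) (at z) a) (at y) =
      frechet_derivative (\<lambda>z. frechet_derivative H (at (x, z)) (0, a)) (at y)"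
    by (rule frechet_derivative_cong_open[OF op]) (use 1 assms(3) in auto)
  also have "\<dots> = (\<lambda>b. frechet_derivative (\<lambda>z. frechet_derivative H (at z) (0, a)) (at (x, y)) (0, b))"
    using frechet_derivative_at[OF has_derivative_compose[OF d smooth_on_imp_has_derivative[OF
            smooth_on_frechet[OF assms(2)] assms(3)]], symmetric] .
  finally show "hessian (\<lambda>y. H (x, y)) y a b = hessian H (x, y) (0, a) (0, b)"
    by (simp add: hessian_def)
qed

section \<open>Finsler metrics in a chart\<close>

locale finsler_chart = chart A U u for A :: "'a::topological_space chart set" and U u +
  fixes F :: "'a \<Rightarrow> 'a tvec \<Rightarrow> real"
  assumes F: "finsler_metric A F"
begin

abbreviation "Fx x \<equiv> (\<lambda>y. in_chart A U u F (x, y))"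
abbreviation "S \<equiv> u ` U \<times> (UNIV - {0 :: real^3})"

lemma open_S: "open S"
  by (intro open_Times open_uU) (simp add: open_delete)

lemma smooth_F: "smooth_on S (in_chart A U u F)"
  using F chart unfolding finsler_metric_def by blast

lemma smooth_energy: "smooth_on S (energy A U u F)"
  unfolding energy_def power2_eq_square
  by (intro smooth_on_mult smooth_on_const open_S smooth_F)

lemma half_square_Fx: "half_square (Fx x) = (\<lambda>y. energy A U u F (x, y))"
  by (simp add: half_square_def energy_def)

lemma Fx_eq: "Fx x y = F (ui x) (coords_tvec A U u (ui x) y)"
  by (simp add: in_chart_def)

lemma minkowski_Fx: assumes x: "x \<in> u ` U" shows "minkowski (Fx x)"
proof
  have F0: "F p v \<ge> 0" "t > 0 \<Longrightarrow> F p (\<lambda>f. t * v f) = t * F p v" if "v \<in> tangent_space A p" for p v t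
    using F that unfolding finsler_metric_def by blast+
  have mem: "coords_tvec A U u (ui x) y \<in> tangent_space A (ui x)" for y
    by (rule coords_tvec_mem) (use x in simp)
  show "Fx x y \<ge> 0" for y unfolding Fx_eq by (rule F0(1)[OF mem])
  show "Fx x (t *\<^sub>R y) = t * Fx x y" if "t > 0" for t y
  proof -
    have "coords_tvec A U u (ui x) (t *\<^sub>R y) = (\<lambda>f. t * coords_tvec A U u (ui x) y f)"
      by (rule ext) (rule coords_tvec_scale)
    then show ?thesis unfolding Fx_eq by (simp only: F0(2)[OF mem that])
  qed
  show "smooth_on (UNIV - {0}) (Fx x)"
    by (rule smooth_on_compose[OF _ open_S _ _ smooth_F])
      (use x in \<open>auto intro!: smooth_on_Pair smooth_on_const smooth_on_id simp: open_delete\<close>)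
  show "w \<bullet> (fundamental_matrix (Fx x) y *v w) > 0" if "y \<noteq> 0" "w \<noteq> 0" for y w
    using F chart x that unfolding finsler_metric_def by blast
qed

lemma hessian_Fx:
  assumes "x \<in> u ` U" "y \<noteq> 0"
  shows "frechet_derivative (half_square (Fx x)) (at y) a = frechet_derivative (energy A U u F) (at (x, y)) (0, a)"
    and "hessian (half_square (Fx x)) y a b = hessian (energy A U u F) (x, y) (0, a) (0, b)"
  unfolding half_square_Fx using assms by (auto intro!: hessian_slice[OF open_S smooth_energy])

definition G :: "real^3 \<Rightarrow> real^3^3" where
  "G x = averaged_matrix (Fx x)"

lemma G_sym: "x \<in> u ` U \<Longrightarrow> a \<bullet> (G x *v b) = b \<bullet> (G x *v a)"
  unfolding G_def by (rule minkowski.averaged_matrix_sym[OF minkowski_Fx])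

lemma G_pos: "x \<in> u ` U \<Longrightarrow> a \<noteq> 0 \<Longrightarrow> a \<bullet> (G x *v a) > 0"
  unfolding G_def by (rule minkowski.averaged_matrix_pos[OF minkowski_Fx])

lemma det_G_pos: "x \<in> u ` U \<Longrightarrow> det (G x) > 0"
  by (rule det_pos_if_posdef) (rule G_pos)

text \<open>The integrand is jointly continuous in the base point and the angles, and the box of
  angles is compact. Only continuity is drawn from the integral; it starts the bootstrap to
  smoothness.\<close>

lemma continuous_G: "continuous_on (u ` U) (\<lambda>x. G x $ i $ j)"
proof -
  \<comment> \<open>By homogeneity of degree 0 the form \<open>g\<close> may be taken at the sphere
    point itself instead of its projection to the indicatrix.\<close>
  define K where "K = (\<lambda>x s. sin (fst s) * (sqrt (det (fundamental_matrix (Fx x) (sphere_point s))) /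
    Fx x (sphere_point s) ^ 3 * fundamental_matrix (Fx x) (sphere_point s) $ i $ j))"
  let ?D = "u ` U \<times> cbox (0, 0) (pi, 2 * pi :: real)"
  have eq: "G x $ i $ j = integral (cbox (0, 0) (pi, 2 * pi)) (K x)" if x: "x \<in> u ` U" for x
  proof -
    interpret minkowski "Fx x" by (rule minkowski_Fx[OF x])
    have "fundamental_matrix (Fx x) (sphere_point s /\<^sub>R Fx x (sphere_point s)) = fundamental_matrix (Fx x) (sphere_point s)" for s
      using pos[OF sphere_point_nz[of s]] sphere_point_nz by (intro fundamental_matrix_scale) auto
    then show ?thesis
      by (simp add: G_def averaged_matrix_def indicatrix_integral_eq weight_def K_def)
  qed
  let ?q = "\<lambda>z :: (real^3) \<times> real \<times> real. (fst z, sphere_point (snd z))"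
  have q: "continuous_on ?D ?q"
    by (intro continuous_intros continuous_on_compose2[OF continuous_sphere_point]) auto
  have qS: "?q ` ?D \<subseteq> S" using sphere_point_nz by auto
  have fm: "continuous_on ?D (\<lambda>z. fundamental_matrix (Fx (fst z)) (sphere_point (snd z)) $ k $ l)" for k l
  proof (rule continuous_on_eq)
    show "continuous_on ?D (\<lambda>z. hessian (energy A U u F) (?q z) (0, axis l 1) (0, axis k 1))"
      unfolding hessian_def
      by (rule continuous_on_compose2[OF smooth_on_imp_continuous_on[OF smooth_on_frechet[OF
                smooth_on_frechet[OF smooth_energy]]] q qS])
    show "hessian (energy A U u F) (?q z) (0, axis l 1) (0, axis k 1) =
      fundamental_matrix (Fx (fst z)) (sphere_point (snd z)) $ k $ l" if "z \<in> ?D" for z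
      unfolding fundamental_matrix_nth using that sphere_point_nz by (subst hessian_Fx(2)) auto
  qed
  have cF: "continuous_on ?D (\<lambda>z. Fx (fst z) (sphere_point (snd z)))"
    using continuous_on_compose2[OF smooth_on_imp_continuous_on[OF smooth_F] q qS] by simp
  have "continuous_on ?D (\<lambda>(x, s). K x s)"
    unfolding K_def split_beta det_def
    by (intro continuous_intros fm cF) (use minkowski.pos[OF minkowski_Fx sphere_point_nz] in \<open>force simp: less_le\<close>)
  then have "continuous_on (u ` U) (\<lambda>x. integral (cbox (0, 0) (pi, 2 * pi)) (K x))"
    by (rule integral_continuous_on_param)
  then show ?thesis by (rule continuous_on_eq) (simp add: eq)
qed

end

locale finsler_two_charts = U: finsler_chart A U u F + V: finsler_chart A V v F
  for A :: "'a::topological_space chart set" and U u V v F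

sublocale finsler_two_charts \<subseteq> two_charts A U u V v
  by unfold_locales

context finsler_two_charts
begin

lemma Fx_change:
  assumes "p \<in> U" "p \<in> V" shows "U.Fx (u p) y = V.Fx (v p) (jac p y)"
  using assms coords_tvec_change[OF assms] by (simp add: in_chart_def)

lemma inj_jac: assumes "p \<in> U" "p \<in> V" shows "inj (jac p)"
proof (rule injI)
  fix y z assume "jac p y = jac p z"
  then have "coords_tvec A U u p y = coords_tvec A U u p z" by (simp add: coords_tvec_change[OF assms])
  then show "y = z" using U.fibre_coords_coords_tvec[OF assms(1)] by metis
qed

lemma G_change:
  assumes "p \<in> U" "p \<in> V"
  shows "a \<bullet> (U.G (u p) *v b) = jac p a \<bullet> (V.G (v p) *v jac p b)"
proof -
  have "v p \<in> v ` V" using assms by simp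
  from minkowski.averaged_matrix_change[OF V.minkowski_Fx[OF this] linear_jacobian[OF assms] inj_jac[OF assms]]
  show ?thesis unfolding U.G_def V.G_def Fx_change[OF assms] .
qed

end

context finsler_chart
begin

text \<open>The definition selects an unknown chart around \<open>p\<close>; the tensorial law
  \<open>G_change\<close> moves the result to the given one.\<close>

lemma averaged_metric_eq:
  assumes p: "p \<in> U" and v: "v \<in> tangent_space A p" and w: "w \<in> tangent_space A p"
  shows "averaged_metric A F p v w = fibre_coords u v \<bullet> (G (u p) *v fibre_coords u w)"
proof -
  let ?P = "\<lambda>z. case z of (U, u) \<Rightarrow> (U, u) \<in> charts A \<and> p \<in> U"
  obtain V t where Vt: "(SOME z. ?P z) = (V, t)" by (cases "SOME z. ?P z")
  have "\<exists>z. ?P z" using chart p by auto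
  from someI_ex[OF this] have V: "(V, t) \<in> charts A" "p \<in> V" unfolding Vt by auto
  interpret V: finsler_chart A V t F using F V by unfold_locales
  interpret finsler_two_charts A U u V t F by unfold_locales
  have "averaged_metric A F p v w = fibre_coords t v \<bullet> (V.G (t p) *v fibre_coords t w)"
    unfolding averaged_metric_def Vt by (simp add: Let_def inner_matrix_vector_sum V.G_def averaged_matrix_def)
  then show ?thesis
    using G_change[OF p V(2)] fibre_coords_change'[OF p V(2) v] fibre_coords_change'[OF p V(2) w] by simp
qed

lemma gram_matrix_eq: assumes "p \<in> U" shows "gram_matrix A U u (averaged_metric A F) p = G (u p)"
  by (simp add: gram_matrix_def vec_eq_iff coord_vec_eq averaged_metric_eq[OF assms coords_tvec_mem[OF assms] coords_tvec_mem[OF assms]]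
      fibre_coords_coords_tvec[OF assms] inner_matrix_axis)

end

section \<open>Regularity of the averaged metric\<close>

text \<open>The mean value theorem on the segment from \<open>x\<close> to \<open>y\<close>
  expresses the increment by the coefficients at an intermediate point, and their continuity bounds
  the error. This is the usual passage from continuous partial derivatives to total
  differentiability.\<close>

lemma line_derivatives_imp_has_derivative:
  fixes g :: "real^'n \<Rightarrow> real"
  assumes S: "open S" "x \<in> S"
    and cont: "\<And>i. continuous_on S (r i)"
    and der: "\<And>x w. x \<in> S \<Longrightarrow> ((\<lambda>t. g (x + t *\<^sub>R w)) has_real_derivative (\<Sum>i\<in>UNIV. w $ i * r i x)) (at 0)"
  shows "(g has_derivative (\<lambda>w. \<Sum>i\<in>UNIV. w $ i * r i x)) (at x)"
  unfolding has_derivative_at_alt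
proof (intro conjI allI impI)
  let ?R = "\<lambda>w x. \<Sum>i\<in>UNIV. w $ i * r i x"
  show "bounded_linear (\<lambda>w. ?R w x)"
    by (intro bounded_linear_sum bounded_linear_mult_left bounded_linear_compose[OF bounded_linear_mult_left bounded_linear_vec_nth])
  fix e :: real assume e: "e > 0"
  have "continuous_on S (\<lambda>z. \<Sum>i\<in>UNIV. \<bar>r i z - r i x\<bar>)" by (intro continuous_intros cont)
  then have "isCont (\<lambda>z. \<Sum>i\<in>UNIV. \<bar>r i z - r i x\<bar>) x"
    using S by (simp add: continuous_on_eq_continuous_at)
  then obtain d1 where d1: "d1 > 0"
    "\<And>z. dist z x < d1 \<Longrightarrow> dist (\<Sum>i\<in>UNIV. \<bar>r i z - r i x\<bar>) (\<Sum>i\<in>UNIV. \<bar>r i x - r i x\<bar>) < e"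
    unfolding continuous_at_eps_delta using e by blast
  obtain d2 where d2: "d2 > 0" "ball x d2 \<subseteq> S" using S open_contains_ball by blast
  show "\<exists>d>0. \<forall>y. norm (y - x) < d \<longrightarrow> norm (g y - g x - ?R (y - x) x) \<le> e * norm (y - x)"
  proof (intro exI[of _ "min d1 d2"] conjI allI impI)
    show "min d1 d2 > 0" using d1 d2 by simp
    fix y assume y: "norm (y - x) < min d1 d2"
    define w where "w = y - x"
    have near: "dist (x + t *\<^sub>R w) x < min d1 d2" if "0 \<le> t" "t \<le> 1" for t
    proof -
      have "norm (t *\<^sub>R w) \<le> 1 * norm w" unfolding norm_scaleR by (rule mult_right_mono) (use that in auto)
      then show ?thesis using y by (simp add: dist_norm w_def)
    qed
    have "((\<lambda>t. g (x + t *\<^sub>R w)) has_real_derivative ?R w (x + t *\<^sub>R w)) (at t)" if "0 \<le> t" "t \<le> 1" for t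
    proof -
      have "x + t *\<^sub>R w \<in> S" using near[OF that] d2(2) by (auto simp: dist_commute)
      \<comment> \<open>The assumption gives derivatives at parameter 0 only; moving the base point
        to \<open>x + t *\<^sub>R w\<close> turns this into the derivative at
        \<open>t\<close>.\<close>
      from der[OF this, of w] have "((\<lambda>s. g (x + (s + t) *\<^sub>R w)) has_real_derivative ?R w (x + t *\<^sub>R w)) (at 0)"
        by (simp add: algebra_simps)
      then show ?thesis using DERIV_shift[of "\<lambda>t. g (x + t *\<^sub>R w)" "?R w (x + t *\<^sub>R w)" 0 t] by simp
    qed
    then have "\<exists>t. 0 < t \<and> t < 1 \<and> g (x + 1 *\<^sub>R w) - g (x + 0 *\<^sub>R w) = (1 - 0) * ?R w (x + t *\<^sub>R w)"
      by (intro MVT2) auto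
    then obtain t where t: "0 < t" "t < 1" "g y - g x = ?R w (x + t *\<^sub>R w)" by (auto simp: w_def)
    let ?z = "x + t *\<^sub>R w"
    have "norm (g y - g x - ?R w x) = \<bar>\<Sum>i\<in>UNIV. w $ i * (r i ?z - r i x)\<bar>"
      unfolding t(3) by (simp add: sum_subtractf right_diff_distrib)
    also have "\<dots> \<le> (\<Sum>i\<in>UNIV. \<bar>w $ i * (r i ?z - r i x)\<bar>)" by (rule sum_abs)
    also have "\<dots> \<le> (\<Sum>i\<in>UNIV. norm w * \<bar>r i ?z - r i x\<bar>)"
      unfolding abs_mult by (intro sum_mono mult_right_mono component_le_norm_cart) auto
    also have "\<dots> = norm w * (\<Sum>i\<in>UNIV. \<bar>r i ?z - r i x\<bar>)" by (simp add: sum_distrib_left)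
    also have "\<dots> \<le> norm w * e"
    proof (rule mult_left_mono)
      have "dist ?z x < d1" using near[of t] t by simp
      from d1(2)[OF this] show "(\<Sum>i\<in>UNIV. \<bar>r i ?z - r i x\<bar>) \<le> e" by (simp add: dist_real_def)
    qed simp
    finally show "norm (g y - g x - ?R (y - x) x) \<le> e * norm (y - x)" by (simp add: w_def mult.commute)
  qed
qed

text \<open>The derivatives \<open>r i j\<close> are as regular as the unknowns \<open>g k\<close>, so regularity bootstraps from continuity.\<close>

lemma line_derivatives_imp_smooth:
  fixes g :: "'j \<Rightarrow> real^'n \<Rightarrow> real"
  assumes S: "open S"
    and cont: "\<And>j. continuous_on S (g j)"
    and r: "\<And>n i j. (\<And>k. times_differentiable_on n S (g k)) \<Longrightarrow> times_differentiable_on n S (r i j)"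
    and der: "\<And>x w j. x \<in> S \<Longrightarrow> ((\<lambda>t. g j (x + t *\<^sub>R w)) has_real_derivative (\<Sum>i\<in>UNIV. w $ i * r i j x)) (at 0)"
  shows "smooth_on S (g j)"
    and "x \<in> S \<Longrightarrow> (g j has_derivative (\<lambda>w. \<Sum>i\<in>UNIV. w $ i * r i j x)) (at x)"
proof -
  have cr: "continuous_on S (r i j)" for i j using r[of 0 i j] cont by simp
  show d: "(g j has_derivative (\<lambda>w. \<Sum>i\<in>UNIV. w $ i * r i j x)) (at x)" if "x \<in> S" for x j
    by (rule line_derivatives_imp_has_derivative[OF S that cr der])
  have "times_differentiable_on n S (g j)" for n j
  proof (induction n arbitrary: j)
    case 0
    then show ?case using cont by simp
  next
    case (Suc n)
    show ?case
      by (rule times_differentiable_on_SucI[OF S d], assumption)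
        (intro times_differentiable_on_sum[OF S] times_differentiable_on_bilinear[OF bounded_bilinear_mult S]
          times_differentiable_on_const[OF S] r Suc.IH)
  qed
  then show "smooth_on S (g j)" by (simp add: smooth_on_def)
qed

context connection
begin

lemma Gam_axis: "Gam p w (axis j 1) $ l = (\<Sum>i\<in>UNIV. w $ i * christoffel A U u D i j l p)"
proof -
  have "(\<Sum>m\<in>UNIV. w $ i * axis j 1 $ m * christoffel A U u D i m l p) =
      (\<Sum>m\<in>UNIV. if m = j then w $ i * christoffel A U u D i m l p else 0)" for i
    by (rule sum.cong) (auto simp: axis_def)
  then show ?thesis by (simp add: Gam_def)
qed

lemma Gam_axis_axis: "Gam p (axis i 1) (axis j 1) $ l = christoffel A U u D i j l p"
proof -
  have "(\<Sum>m\<in>UNIV. axis i 1 $ m * christoffel A U u D m j l p) =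
      (\<Sum>m\<in>UNIV. if m = i then christoffel A U u D m j l p else 0)"
    by (rule sum.cong) (auto simp: axis_def)
  then show ?thesis by (simp add: Gam_axis)
qed

end

locale finsler_connection = finsler_chart A U u F + connection A U u D
  for A :: "'a::topological_space chart set" and U u F D +
  assumes compat: "compatible_connection A F D"
begin

lemma energy_horizontal:
  assumes x: "x \<in> u ` U" and y: "y \<noteq> 0"
  shows "frechet_derivative (energy A U u F) (at (x, y)) (w, - Gam (ui x) w y) = 0"
proof -
  obtain e N M where e: "e > 0" "N 0 = mat 1" "M 0 = mat 1"
    "\<And>t. t \<in> {-e<..<e} \<Longrightarrow> x + t *\<^sub>R w \<in> u ` U"
    "\<And>t. t \<in> {-e<..<e} \<Longrightarrow> M t ** N t = mat 1"
    "\<And>t y. t \<in> {-e<..<e} \<Longrightarrow> in_chart A U u F (x + t *\<^sub>R w, N t *v y) = in_chart A U u F (x, y)"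
    "(N has_vector_derivative - Gmat x w) (at 0)"
    by (rule parallel_transport[OF compat x, of w]) (rule that)
  have "((\<lambda>t. N t *v y) has_vector_derivative - Gam (ui x) w y) (at 0)"
    using bounded_linear.has_vector_derivative[OF bounded_linear_matrix_vector_mult_left e(7), of y] by (simp add: minus_matrix_vector_mult Gmat_mult)
  then have "((\<lambda>t. (x + t *\<^sub>R w, N t *v y)) has_derivative (\<lambda>h. (h *\<^sub>R w, h *\<^sub>R (- Gam (ui x) w y)))) (at 0)"
    unfolding has_vector_derivative_def by (intro has_derivative_Pair) (auto intro!: derivative_eq_intros)
  moreover have "(energy A U u F has_derivative frechet_derivative (energy A U u F) (at (x, y)))
      (at (x + 0 *\<^sub>R w, N 0 *v y))"
    using smooth_on_imp_has_derivative[OF smooth_energy, of "(x, y)"] x y by (simp add: e(2))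
  ultimately have "((\<lambda>t. energy A U u F (x + t *\<^sub>R w, N t *v y)) has_derivative
      (\<lambda>h. frechet_derivative (energy A U u F) (at (x, y)) (h *\<^sub>R w, h *\<^sub>R (- Gam (ui x) w y)))) (at 0)"
    by (rule has_derivative_compose)
  moreover have "((\<lambda>t. energy A U u F (x + t *\<^sub>R w, N t *v y)) has_derivative (\<lambda>h. 0)) (at 0)"
  proof (rule has_derivative_cong_open[of "{-e<..<e}", THEN iffD1])
    show "((\<lambda>t::real. energy A U u F (x, y)) has_derivative (\<lambda>h. 0)) (at 0)" by simp
  qed (use e(1,6) in \<open>auto simp: energy_def\<close>)
  ultimately have "(\<lambda>h::real. frechet_derivative (energy A U u F) (at (x, y)) (h *\<^sub>R w, h *\<^sub>R (- Gam (ui x) w y))) = (\<lambda>h. 0)"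
    by (rule has_derivative_unique)
  from fun_cong[OF this, of 1] show ?thesis by simp
qed

text \<open>The form \<open>G\<close> at \<open>x + t *\<^sub>R w\<close> is the form at
  \<open>x\<close> pulled back by \<open>M t\<close>. So \<open>t\<close> enters through
  \<open>M\<close> alone, and the derivative at 0 is read off from that of \<open>M\<close>; the
  integral is never differentiated.\<close>

lemma G_line_derivative:
  assumes x: "x \<in> u ` U"
  shows "((\<lambda>t. a \<bullet> (G (x + t *\<^sub>R w) *v b)) has_real_derivative
    Gam (ui x) w a \<bullet> (G x *v b) + a \<bullet> (G x *v Gam (ui x) w b)) (at 0)"
proof -
  obtain e N M where e: "e > 0" "N 0 = mat 1" "M 0 = mat 1"
    "\<And>t. t \<in> {-e<..<e} \<Longrightarrow> x + t *\<^sub>R w \<in> u ` U"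
    "\<And>t. t \<in> {-e<..<e} \<Longrightarrow> M t ** N t = mat 1"
    "\<And>t y. t \<in> {-e<..<e} \<Longrightarrow> in_chart A U u F (x + t *\<^sub>R w, N t *v y) = in_chart A U u F (x, y)"
    "(M has_vector_derivative Gmat x w) (at 0)"
    by (rule parallel_transport[OF compat x, of w]) (rule that)
  have dM: "((\<lambda>t. M t *v y) has_vector_derivative Gam (ui x) w y) (at 0)" for y
    using bounded_linear.has_vector_derivative[OF bounded_linear_matrix_vector_mult_left e(7), of y] by (simp add: Gmat_mult)
  have dGM: "((\<lambda>t. G x *v (M t *v y)) has_vector_derivative G x *v Gam (ui x) w y) (at 0)" for y
    by (rule bounded_linear.has_vector_derivative[OF matrix_vector_mul_bounded_linear dM])
  have "((\<lambda>t. (M t *v a) \<bullet> (G x *v (M t *v b))) has_vector_derivative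
      (M 0 *v a) \<bullet> (G x *v Gam (ui x) w b) + Gam (ui x) w a \<bullet> (G x *v (M 0 *v b))) (at 0)"
    by (rule bounded_bilinear.has_vector_derivative[OF bounded_bilinear_inner dM dGM])
  then have "((\<lambda>t. (M t *v a) \<bullet> (G x *v (M t *v b))) has_real_derivative
      Gam (ui x) w a \<bullet> (G x *v b) + a \<bullet> (G x *v Gam (ui x) w b)) (at 0)"
    by (simp add: e(3) has_real_derivative_iff_has_vector_derivative add.commute)
  then show ?thesis
  proof (rule has_field_derivative_transform_within_open[of _ _ _ "{-e<..<e}"])
    fix t assume t: "t \<in> {-e<..<e}"
    let ?L = "\<lambda>y. N t *v y"
    have L: "linear ?L" by simp
    have MN: "M t *v (N t *v y) = y" for y using e(5)[OF t] by (simp add: matrix_vector_mul_assoc)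
    then have "inj ?L" by (metis injI)
    have "N t ** M t = mat 1" using e(5)[OF t] by (simp add: matrix_left_right_inverse)
    then have NM: "N t *v (M t *v y) = y" for y by (simp add: matrix_vector_mul_assoc)
    have "(M t *v a) \<bullet> (averaged_matrix (\<lambda>y. Fx (x + t *\<^sub>R w) (N t *v y)) *v (M t *v b)) =
        (N t *v (M t *v a)) \<bullet> (averaged_matrix (Fx (x + t *\<^sub>R w)) *v (N t *v (M t *v b)))"
      by (rule minkowski.averaged_matrix_change[OF minkowski_Fx[OF e(4)[OF t]] L \<open>inj ?L\<close>])
    then show "(M t *v a) \<bullet> (G x *v (M t *v b)) = a \<bullet> (G (x + t *\<^sub>R w) *v b)"
      by (simp only: e(6)[OF t] NM G_def)
  qed (use e(1) in auto)
qed

lemma G_smooth: "smooth_on (u ` U) (\<lambda>x. G x $ j $ k)"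
  and G_has_derivative: "x \<in> u ` U \<Longrightarrow> ((\<lambda>x. G x $ j $ k) has_derivative
    (\<lambda>w. Gam (ui x) w (axis j 1) \<bullet> (G x *v axis k 1) + axis j 1 \<bullet> (G x *v Gam (ui x) w (axis k 1)))) (at x)"
proof -
  define g where "g = (\<lambda>(j, k) x. G x $ j $ k)"
  let ?c = "\<lambda>i j l x. christoffel A U u D i j l (ui x)"
  \<comment> \<open>The coefficient of \<open>w $ i\<close> in the derivative of the entry
    \<open>(j, k)\<close>. It is linear in the entries of \<open>G\<close> with smooth coefficients,
    hence exactly as regular as \<open>G\<close>, which is what the bootstrap requires.\<close>
  define r where "r = (\<lambda>i (j, k) x. (\<Sum>l\<in>UNIV. ?c i j l x * G x $ l $ k) + (\<Sum>l\<in>UNIV. ?c i k l x * G x $ j $ l))"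
  have left: "v \<bullet> (G x *v axis k 1) = (\<Sum>l\<in>UNIV. v $ l * G x $ l $ k)" for v x k
    by (simp add: inner_vec_def matrix_vector_mult_basis column_def)
  have right: "axis j 1 \<bullet> (G x *v v) = (\<Sum>l\<in>UNIV. v $ l * G x $ j $ l)" for v x j
    by (simp add: inner_axis' matrix_vector_mult_def mult.commute)
  have eq: "Gam (ui x) w (axis j 1) \<bullet> (G x *v axis k 1) + axis j 1 \<bullet> (G x *v Gam (ui x) w (axis k 1)) =
      (\<Sum>i\<in>UNIV. w $ i * r i (j, k) x)" for x w j k
  proof -
    have "(\<Sum>l\<in>UNIV. (\<Sum>i\<in>UNIV. w $ i * ?c i j l x) * h l) = (\<Sum>i\<in>UNIV. w $ i * (\<Sum>l\<in>UNIV. ?c i j l x * h l))" for h j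
      unfolding sum_distrib_right sum_distrib_left mult.assoc by (rule sum.swap)
    then show ?thesis
      unfolding left right Gam_axis r_def by (simp add: sum.distrib distrib_left)
  qed
  have cont: "continuous_on (u ` U) (g p)" for p
    by (cases p) (simp add: g_def continuous_G)
  have rs: "times_differentiable_on n (u ` U) (r i p)" if "\<And>p. times_differentiable_on n (u ` U) (g p)" for n i p
  proof (cases p)
    case (Pair j k)
    have tg: "times_differentiable_on n (u ` U) (\<lambda>x. G x $ j $ k)" for j k
      using that[of "(j, k)"] by (simp add: g_def)
    have tc: "times_differentiable_on n (u ` U) (?c i j l)" for i j l
      using christoffel_ui_smooth by (simp add: smooth_on_def)
    show ?thesis
      unfolding r_def Pair prod.case
      by (intro times_differentiable_on_add[OF open_uU] times_differentiable_on_sum[OF open_uU]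
          times_differentiable_on_bilinear[OF bounded_bilinear_mult open_uU] tg tc)
  qed
  have der: "((\<lambda>t. g p (x + t *\<^sub>R w)) has_real_derivative (\<Sum>i\<in>UNIV. w $ i * r i p x)) (at 0)"
    if "x \<in> u ` U" for x w p
  proof (cases p)
    case (Pair j k)
    show ?thesis
      using G_line_derivative[OF that, of "axis j 1" w "axis k 1"]
      unfolding eq inner_matrix_axis by (simp add: g_def Pair)
  qed
  have res1: "smooth_on (u ` U) (g p)" for p
    by (rule line_derivatives_imp_smooth(1)[where r = r, OF open_uU cont]) (blast intro: rs, blast intro: der)
  have res2: "(g p has_derivative (\<lambda>w. \<Sum>i\<in>UNIV. w $ i * r i p x)) (at x)" if "x \<in> u ` U" for p x
    by (rule line_derivatives_imp_smooth(2)[where r = r, OF open_uU cont])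
      (blast intro: rs, blast intro: der, fact that)
  show "smooth_on (u ` U) (\<lambda>x. G x $ j $ k)" using res1[of "(j, k)"] by (simp add: g_def)
  show "((\<lambda>x. G x $ j $ k) has_derivative
    (\<lambda>w. Gam (ui x) w (axis j 1) \<bullet> (G x *v axis k 1) + axis j 1 \<bullet> (G x *v Gam (ui x) w (axis k 1)))) (at x)"
    if "x \<in> u ` U"
    unfolding eq using res2[OF that, of "(j, k)"] by (simp add: g_def)
qed

end

section \<open>Cross products and alternating torsion\<close>

lemma bilinear_eq_on_axes:
  fixes B B' :: "real^'n \<Rightarrow> real^'n \<Rightarrow> real^'n"
  assumes B: "bilinear B" and B': "bilinear B'" and G: "det G \<noteq> 0"
    and eq: "\<And>i j k. B (axis i 1) (axis j 1) \<bullet> (G *v axis k 1) = B' (axis i 1) (axis j 1) \<bullet> (G *v axis k 1)"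
  shows "B = B'"
proof (rule bilinear_eq_stdbasis[OF B B'])
  fix a b :: "real^'n" assume "a \<in> Basis" "b \<in> Basis"
  then obtain i j where ij: "a = axis i 1" "b = axis j 1" by (auto simp: Basis_vec_def)
  define d where "d = B a b - B' a b"
  obtain G' where "G ** G' = mat 1" using G unfolding invertible_det_nz[symmetric] invertible_def by blast
  \<comment> \<open>As \<open>G\<close> is invertible, the difference \<open>d\<close> is itself of
    the form \<open>G *v z\<close>; being orthogonal to every such vector, it is orthogonal to
    itself.\<close>
  then have "d = G *v (G' *v d)" by (simp add: matrix_vector_mul_assoc)
  then obtain z where z: "d = G *v z" by blast
  have lin: "linear (\<lambda>z. d \<bullet> (G *v z))" by (rule linearI) (simp_all add: matrix_vector_right_distrib inner_add_right matrix_vector_mult_scaleR)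
  have "d \<bullet> (G *v axis k 1) = 0" for k using eq[of i j k] by (simp add: d_def ij inner_diff_left)
  then have "d \<bullet> (G *v z) = 0" using linear_sum_axis[OF lin, of z] by simp
  then have "d \<bullet> d = 0" using z by simp
  then show "B a b = B' a b" by (simp add: d_def)
qed

lemma cross3_axis: "cross3 (axis i 1) (axis j 1) $ k = eps i j k"
proof -
  have "\<forall>i j k. cross3 (axis i 1) (axis j 1) $ k = eps i j k"
    unfolding forall_3 by (simp add: cross3_def eps_def axis_def)
  then show ?thesis by blast
qed

text \<open>The defining equations say that \<open>transpose G\<close> maps the product to the
  Euclidean cross product times \<open>sqrt (det G)\<close>. Inverting \<open>transpose G\<close>
  gives a witness, and \<open>bilinear_eq_on_axes\<close> gives the uniqueness needed for the
  description operator.\<close>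

lemma gram_cross:
  fixes G :: "real^3^3"
  assumes G: "det G > 0"
  shows bilinear_gram_cross: "bilinear (gram_cross G)"
    and gram_cross_axes: "gram_cross G (axis i 1) (axis j 1) \<bullet> (G *v axis k 1) = eps i j k * sqrt (det G)"
    and transpose_gram_cross: "transpose G *v gram_cross G a b = sqrt (det G) *\<^sub>R cross3 a b"
proof -
  let ?P = "\<lambda>B. bilinear B \<and> (\<forall>i j k. B (axis i 1) (axis j 1) \<bullet> (G *v axis k 1) = eps i j k * sqrt (det G))"
  have "det (transpose G) \<noteq> 0" using G by simp
  then obtain H where H: "transpose G ** H = mat 1"
    unfolding invertible_det_nz[symmetric] invertible_def by blast
  define B where "B = (\<lambda>a b. sqrt (det G) *\<^sub>R (H *v cross3 a b))"
  have B: "bilinear B"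
    unfolding bilinear_def B_def
    by (auto intro!: linearI simp: cross_add_left cross_add_right cross_mult_left cross_mult_right
        matrix_vector_right_distrib scaleR_add_right matrix_vector_mult_scaleR)
  have tB: "transpose G *v B a b = sqrt (det G) *\<^sub>R cross3 a b" for a b
    by (simp add: B_def matrix_vector_mult_scaleR matrix_vector_mul_assoc H del: transpose_matrix_vector)
  have "B a b \<bullet> (G *v axis k 1) = sqrt (det G) * cross3 a b $ k" for a b k
  proof -
    have "B a b \<bullet> (G *v axis k 1) = axis k 1 \<bullet> (transpose G *v B a b)"
      unfolding inner_transpose by (rule inner_commute)
    then show ?thesis unfolding tB by (simp add: inner_axis')
  qed
  then have "?P B" using B cross3_axis by simp
  moreover have "B' = B" if "?P B'" for B'
    using that \<open>?P B\<close> G by (intro bilinear_eq_on_axes[of B' B G]) auto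
  ultimately have "gram_cross G = B" unfolding gram_cross_def by (rule the_equality)
  with \<open>?P B\<close> tB show "bilinear (gram_cross G)"
    and "gram_cross G (axis i 1) (axis j 1) \<bullet> (G *v axis k 1) = eps i j k * sqrt (det G)"
    and "transpose G *v gram_cross G a b = sqrt (det G) *\<^sub>R cross3 a b"
    by auto
qed

lemma gram_cross_surj:
  fixes G :: "real^3^3"
  assumes G: "det G > 0" and y: "y \<noteq> 0" and w: "w \<bullet> (G *v y) = 0"
  obtains a where "gram_cross G a y = w"
proof -
  let ?z = "transpose G *v w"
  \<comment> \<open>Since \<open>?z\<close> is orthogonal to \<open>y\<close> in the Euclidean
    sense, the triple product of \<open>y\<close>, \<open>?z\<close>, \<open>y\<close> is
    \<open>(y \<bullet> y) *\<^sub>R ?z\<close>. The scalar in front cancels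
    \<open>y \<bullet> y\<close> and the factor \<open>sqrt (det G)\<close>.\<close>
  define a where "a = (1 / ((y \<bullet> y) * sqrt (det G))) *\<^sub>R cross3 y ?z"
  have zy: "y \<bullet> ?z = 0" using w unfolding inner_transpose by (simp add: inner_commute)
  have triple: "cross3 (cross3 y z) y = (y \<bullet> y) *\<^sub>R z - (y \<bullet> z) *\<^sub>R y" for z
    by (simp add: cross3_simps forall_3)
  have "transpose G *v gram_cross G a y = ?z"
    using G y by (simp add: transpose_gram_cross[OF G] a_def cross_mult_left triple zy del: transpose_matrix_vector)
  then have "transpose G *v (gram_cross G a y - w) = 0"
    by (simp add: matrix_vector_mult_diff_distrib del: transpose_matrix_vector)
  moreover have "det (transpose G) \<noteq> 0" using G by simp
  then obtain H where "H ** transpose G = mat 1"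
    unfolding invertible_det_nz[symmetric] invertible_def by blast
  then have "H *v (transpose G *v v) = v" for v
    by (simp add: matrix_vector_mul_assoc del: transpose_matrix_vector)
  ultimately have "gram_cross G a y - w = 0" by (metis matrix_vector_mult_0_right)
  then show ?thesis using that by simp
qed

text \<open>In the torsion condition the terms with first index \<open>i\<close> cancel by skewness,
  and what remains is invariance under cyclic shifts. Together with skewness this makes the array
  alternating, and for three indices an alternating array is a multiple of
  \<open>eps\<close>.\<close>

lemma alternating_eps:
  fixes B :: "3 \<Rightarrow> 3 \<Rightarrow> 3 \<Rightarrow> real"
  assumes skew: "\<And>i j k. B i j k = - B i k j"
    and tors: "\<And>i j k. B i j k - B j i k = - (B i k j - B k i j)"
  shows "B i j k = B 1 2 3 * eps i j k"
proof -
  have cyc: "B j i k = B k j i" for i j k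
    using tors[of i j k] skew[of i j k] skew[of k i j] by linarith
  have d1: "B i i k = 0" for i k using cyc[of i i k] skew[of k i i] by linarith
  have d2: "B i k k = 0" for i k using skew[of i k k] by linarith
  have d3: "B i k i = 0" for i k using skew[of i k i] d1[of i k] by linarith
  have e: "B 2 3 1 = B 1 2 3" "B 3 1 2 = B 1 2 3" "B 1 3 2 = - B 1 2 3" "B 2 1 3 = - B 1 2 3" "B 3 2 1 = - B 1 2 3"
    using cyc[of 1 2 3] cyc[of 2 3 1] cyc[of 3 1 2] cyc[of 2 1 3] cyc[of 1 3 2] cyc[of 3 2 1]
      skew[of 1 2 3] skew[of 2 3 1] skew[of 3 1 2] by linarith+
  have "\<forall>i j k. B i j k = B 1 2 3 * eps i j k"
    unfolding forall_3 by (simp add: eps_def d1 d2 d3 e)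
  then show ?thesis by blast
qed

section \<open>Compatible connections with totally antisymmetric torsion\<close>

locale finsler_torsion = N: finsler_connection A U u F D + L: connection A U u Ds
  for A :: "'a::topological_space chart set" and U u F D Ds +
  assumes lc: "levi_civita_connection A (averaged_metric A F) Ds"
    and anti: "totally_antisymmetric_torsion A (averaged_metric A F) D"
begin

abbreviation "\<gamma> \<equiv> averaged_metric A F"
abbreviation "cv \<equiv> coord_vec A U u"
abbreviation "ui \<equiv> inv_into U u"
abbreviation "G \<equiv> N.G"

definition Diff :: "'a \<Rightarrow> real^3 \<Rightarrow> real^3 \<Rightarrow> real^3" where
  "Diff p a b = N.Gam p a b - L.Gam p a b"

lemma bilinear_Diff: "bilinear (Diff p)"
  unfolding bilinear_def Diff_def
  by (intro conjI allI linear_compose_sub N.Gam_linear L.Gam_linear)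

lemma fibre_coords_N: "p \<in> U \<Longrightarrow> fibre_coords u (D (cv i) (cv j) p) = N.Gam p (axis i 1) (axis j 1)"
  by (simp add: vec_eq_iff N.Gam_axis_axis christoffel_def)

lemma fibre_coords_L: "p \<in> U \<Longrightarrow> fibre_coords u (Ds (cv i) (cv j) p) = L.Gam p (axis i 1) (axis j 1)"
  by (simp add: vec_eq_iff L.Gam_axis_axis christoffel_def)

lemma fibre_coords_cv: "p \<in> U \<Longrightarrow> fibre_coords u (cv i p) = axis i 1"
  by (simp add: N.coord_vec_eq N.fibre_coords_coords_tvec)

lemma cv_mem: "p \<in> U \<Longrightarrow> cv i p \<in> tangent_space A p"
  by (simp add: N.coord_vec_eq N.coords_tvec_mem)

lemma gamma_cv: "p \<in> U \<Longrightarrow> v \<in> tangent_space A p \<Longrightarrow> \<gamma> p v (cv k p) = fibre_coords u v \<bullet> (G (u p) *v axis k 1)"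
  "p \<in> U \<Longrightarrow> v \<in> tangent_space A p \<Longrightarrow> \<gamma> p (cv k p) v = axis k 1 \<bullet> (G (u p) *v fibre_coords u v)"
  by (simp_all add: N.averaged_metric_eq cv_mem fibre_coords_cv)

lemma D_mem: "p \<in> U \<Longrightarrow> D (cv i) (cv j) p \<in> tangent_space A p"
  and Ds_mem: "p \<in> U \<Longrightarrow> Ds (cv i) (cv j) p \<in> tangent_space A p"
  by (rule N.smooth_vfield_mem[OF N.smooth_D[OF N.open_U N.smooth_vfield_coord_vec N.smooth_vfield_coord_vec]],
      assumption,
      rule N.smooth_vfield_mem[OF L.smooth_D[OF N.open_U N.smooth_vfield_coord_vec N.smooth_vfield_coord_vec]])

text \<open>Smoothness of \<open>G\<close>, obtained from the compatible connection, enters here: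
  without it the tangent vector applied to \<open>?h\<close> would be 0 by convention instead of a
  partial derivative.\<close>

lemma metric_L:
  assumes p: "p \<in> U"
  shows "frechet_derivative (\<lambda>x. G x $ j $ k) (at (u p)) (axis i 1) =
    L.Gam p (axis i 1) (axis j 1) \<bullet> (G (u p) *v axis k 1) + axis j 1 \<bullet> (G (u p) *v L.Gam p (axis i 1) (axis k 1))"
proof -
  let ?h = "\<lambda>q. \<gamma> q (cv j q) (cv k q)"
  have h: "?h q = G (u q) $ j $ k" if "q \<in> U" for q
    using gamma_cv(1)[OF that cv_mem[OF that]] fibre_coords_cv[OF that] inner_matrix_axis by metis
  have up: "u p \<in> u ` U" using p by simp
  have sm: "smooth_near A p ?h"
  proof (rule N.smooth_nearI[OF p N.open_uU up subset_refl])
    show "smooth_on (u ` U) (\<lambda>x. ?h (ui x))"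
      by (rule smooth_on_cong[OF N.open_uU, THEN iffD1, OF _ N.G_smooth[of j k]]) (simp add: h)
  qed
  have "cv i p ?h = frechet_derivative (\<lambda>x. ?h (ui x)) (at (u p)) (axis i 1)"
    unfolding N.coord_vec_eq[of i p] by (rule N.coords_tvec_apply[OF sm p])
  also have "frechet_derivative (\<lambda>x. ?h (ui x)) (at (u p)) = frechet_derivative (\<lambda>x. G x $ j $ k) (at (u p))"
    by (rule frechet_derivative_cong_open[OF N.open_uU up]) (simp add: h)
  finally have "frechet_derivative (\<lambda>x. G x $ j $ k) (at (u p)) (axis i 1) = cv i p ?h" by simp
  also have "\<dots> = \<gamma> p (Ds (cv i) (cv j) p) (cv k p) + \<gamma> p (cv j p) (Ds (cv i) (cv k) p)"
    using lc N.open_U N.smooth_vfield_coord_vec p unfolding levi_civita_connection_def by blast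
  finally show ?thesis
    by (simp add: gamma_cv[OF p Ds_mem[OF p]] fibre_coords_L[OF p])
qed

text \<open>Both connections reproduce the same partial derivatives of \<open>G\<close>,
  \<open>D\<close> through parallel transport and \<open>Ds\<close> through the Levi-Civita
  condition; subtracting the two expressions leaves skewness.\<close>

lemma Diff_skew:
  assumes p: "p \<in> U"
  shows "Diff p (axis i 1) (axis j 1) \<bullet> (G (u p) *v axis k 1) = - (Diff p (axis i 1) (axis k 1) \<bullet> (G (u p) *v axis j 1))"
proof -
  have up: "u p \<in> u ` U" using p by simp
  have "frechet_derivative (\<lambda>x. G x $ j $ k) (at (u p)) (axis i 1) =
    N.Gam p (axis i 1) (axis j 1) \<bullet> (G (u p) *v axis k 1) + axis j 1 \<bullet> (G (u p) *v N.Gam p (axis i 1) (axis k 1))"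
    using frechet_derivative_at[OF N.G_has_derivative[OF up], of j k, symmetric] p by simp
  then have "Diff p (axis i 1) (axis j 1) \<bullet> (G (u p) *v axis k 1) + axis j 1 \<bullet> (G (u p) *v Diff p (axis i 1) (axis k 1)) = 0"
    unfolding metric_L[OF p] Diff_def
    by (simp add: inner_diff_left inner_diff_right matrix_vector_mult_diff_distrib)
  then show ?thesis using N.G_sym[OF up, of "axis j 1" "Diff p (axis i 1) (axis k 1)"] by simp
qed

text \<open>The bracket of the coordinate fields is not computed but expressed by the torsion-free
  \<open>Ds\<close>. The torsion of \<open>D\<close> thereby becomes the antisymmetrisation of
  \<open>Diff\<close>.\<close>

lemma Diff_torsion:
  assumes p: "p \<in> U"
  shows "(Diff p (axis i 1) (axis j 1) - Diff p (axis j 1) (axis i 1)) \<bullet> (G (u p) *v axis k 1) =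
    - ((Diff p (axis i 1) (axis k 1) - Diff p (axis k 1) (axis i 1)) \<bullet> (G (u p) *v axis j 1))"
proof -
  have tors: "\<gamma> p (torsion A D (cv i) (cv j) p) (cv k p) =
      (Diff p (axis i 1) (axis j 1) - Diff p (axis j 1) (axis i 1)) \<bullet> (G (u p) *v axis k 1)" for i j k
  proof -
    have "torsion A Ds (cv i) (cv j) p = (\<lambda>f. 0)"
      using lc N.open_U N.smooth_vfield_coord_vec p unfolding levi_civita_connection_def by blast
    then have br: "lie_bracket A (cv i) (cv j) p f = Ds (cv i) (cv j) p f - Ds (cv j) (cv i) p f" for f
      unfolding torsion_def by (metis diff_eq_diff_eq diff_zero)
    have eq: "torsion A D (cv i) (cv j) p = (\<lambda>f. (D (cv i) (cv j) p f + (- 1) * D (cv j) (cv i) p f) +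
       ((- 1) * Ds (cv i) (cv j) p f + Ds (cv j) (cv i) p f))"
      by (rule ext) (simp add: torsion_def br)
    have mem: "torsion A D (cv i) (cv j) p \<in> tangent_space A p"
      unfolding eq by (intro N.tangent_space_add N.tangent_space_scale D_mem Ds_mem p)
    have "fibre_coords u (torsion A D (cv i) (cv j) p) = Diff p (axis i 1) (axis j 1) - Diff p (axis j 1) (axis i 1)"
      by (simp add: eq fibre_coords_def Diff_def vec_eq_iff flip: fibre_coords_N[OF p] fibre_coords_L[OF p])
    then show ?thesis by (simp add: gamma_cv(1)[OF p mem])
  qed
  have "\<gamma> p (torsion A D (cv i) (cv j) p) (cv k p) = - \<gamma> p (torsion A D (cv i) (cv k) p) (cv j p)"
    using anti N.open_U N.smooth_vfield_coord_vec p unfolding totally_antisymmetric_torsion_def Let_def by blast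
  then show ?thesis unfolding tors .
qed

lemma Diff_eq_cross:
  assumes p: "p \<in> U"
  obtains c where "\<And>a b. Diff p a b = c *\<^sub>R gram_cross (G (u p)) a b"
proof -
  define B where "B = (\<lambda>i j k. Diff p (axis i 1) (axis j 1) \<bullet> (G (u p) *v axis k 1))"
  \<comment> \<open>The axes of the cross product carry the factor \<open>sqrt (det G)\<close>,
    which is divided out.\<close>
  define c where "c = B 1 2 3 / sqrt (det (G (u p)))"
  have det: "det (G (u p)) > 0" using p by (intro N.det_G_pos) simp
  have alt: "B i j k = B 1 2 3 * eps i j k" for i j k
  proof (rule alternating_eps)
    show "B i j k = - B i k j" for i j k unfolding B_def by (rule Diff_skew[OF p])
    show "B i j k - B j i k = - (B i k j - B k i j)" for i j k
      using Diff_torsion[OF p, of i j k] by (simp add: B_def inner_diff_left)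
  qed
  have B: "B i j k = c * (eps i j k * sqrt (det (G (u p))))" for i j k
    using det by (simp add: alt[of i j k] c_def)
  have "bilinear (\<lambda>a b. c *\<^sub>R gram_cross (G (u p)) a b)"
    using bilinear_gram_cross[OF det] unfolding bilinear_def by (auto intro!: linear_compose_scale_right)
  then have "Diff p = (\<lambda>a b. c *\<^sub>R gram_cross (G (u p)) a b)"
    by (rule bilinear_eq_on_axes[where G = "G (u p)", OF bilinear_Diff]) (use det B in \<open>auto simp: gram_cross_axes[OF det] B_def\<close>)
  then show ?thesis by (intro that[of c]) simp
qed

end

section \<open>Quadratic Finsler norms\<close>

abbreviation quadratic :: "(real^3 \<Rightarrow> real) \<Rightarrow> bool" where
  "quadratic \<phi> \<equiv> (\<exists>Q :: real^3^3. \<forall>y. (\<phi> y)\<^sup>2 = y \<bullet> (Q *v y))"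

lemma quadratic_compose:
  assumes "quadratic \<phi>" shows "quadratic (\<lambda>y. \<phi> (M *v y))"
proof -
  obtain Q where Q: "\<And>y. (\<phi> y)\<^sup>2 = y \<bullet> (Q *v y)" using assms by blast
  have "(\<phi> (M *v y))\<^sup>2 = y \<bullet> ((transpose M ** Q ** M) *v y)" for y
    by (simp only: Q matrix_vector_mul_assoc[symmetric] inner_transpose)
  then show ?thesis by blast
qed

text \<open>The vectors \<open>gram_cross G a y\<close> fill the orthogonal complement of \<open>y\<close>, so \<open>dE\<close> is proportional to
  the differential of the quadratic form, and the quotient of both functions is constant.\<close>

lemma (in minkowski) quadratic_if_cross_invariant:
  fixes G :: "real^3^3"
  assumes sym: "\<And>a b. a \<bullet> (G *v b) = b \<bullet> (G *v a)" and pos: "\<And>a. a \<noteq> 0 \<Longrightarrow> a \<bullet> (G *v a) > 0"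
    and inv: "\<And>y a. y \<noteq> 0 \<Longrightarrow> dE y (gram_cross G a y) = 0"
  shows "quadratic \<phi>"
proof -
  have det: "det G > 0" by (rule det_pos_if_posdef[OF pos])
  let ?q = "\<lambda>y. y \<bullet> (G *v y)"
  have dE_eq: "dE y w * ?q y = E y * (2 * (w \<bullet> (G *v y)))" if y: "y \<noteq> 0" for y w
  proof -
    \<comment> \<open>\<open>c\<close> is the coefficient of the component of \<open>w\<close> along
      \<open>y\<close> for the form \<open>G\<close>. The remainder of \<open>w\<close> is a cross
      product with \<open>y\<close>, on which \<open>dE y\<close> vanishes, so Euler's identity
      determines \<open>dE y w\<close>.\<close>
    define c where "c = (w \<bullet> (G *v y)) / ?q y"
    have "(w - c *\<^sub>R y) \<bullet> (G *v y) = 0" using pos[OF y] by (simp add: inner_diff_left c_def)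
    then obtain a where "gram_cross G a y = w - c *\<^sub>R y" using gram_cross_surj[OF det y] by blast
    then have "dE y (w - c *\<^sub>R y) = 0" using inv[OF y, of a] by simp
    then have "dE y w = c * (2 * E y)"
      using linear_dE[OF y] euler[OF y] by (simp add: linear_diff linear_scale)
    then show ?thesis using pos[OF y] by (simp add: c_def)
  qed
  have dq: "(?q has_derivative (\<lambda>w. 2 * (w \<bullet> (G *v y)))) (at y)" for y
  proof -
    have "((*v) G has_derivative (*v) G) (at y)"
      by (rule bounded_linear_imp_has_derivative) (rule matrix_vector_mul_bounded_linear)
    from has_derivative_inner[OF has_derivative_ident this]
    have "(?q has_derivative (\<lambda>w. y \<bullet> (G *v w) + w \<bullet> (G *v y))) (at y)" .
    then show ?thesis by (simp add: sym[of y])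
  qed
  let ?R = "\<lambda>y. E y / ?q y"
  have dR: "(?R has_derivative (\<lambda>w. 0)) (at y)" if y: "y \<noteq> 0" for y
  proof -
    have "(?R has_derivative (\<lambda>w. (dE y w * ?q y - E y * (2 * (w \<bullet> (G *v y)))) / (?q y * ?q y))) (at y)"
      by (rule has_derivative_divide'[OF dE[OF y] dq]) (use pos[OF y] in simp)
    then show ?thesis by (simp add: dE_eq[OF y])
  qed
  \<comment> \<open>The punctured space is connected because the dimension exceeds 1.\<close>
  have "?R constant_on (- {0})"
  proof (rule has_derivative_zero_connected_constant_on[where K = "{}"])
    show "connected (- {0 :: real^3})" by (rule connected_punctured_universe) simp
    show "continuous_on (- {0}) ?R"
      using dR by (auto intro!: continuous_at_imp_continuous_on has_derivative_continuous)
    show "\<forall>y\<in>- {0} - {}. (?R has_derivative (\<lambda>h. 0)) (at y within - {0})"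
      using dR by (auto intro: has_derivative_at_withinI)
  qed auto
  then obtain k where k: "\<And>y. y \<noteq> 0 \<Longrightarrow> ?R y = k" unfolding constant_on_def by auto
  have "(\<phi> y)\<^sup>2 = y \<bullet> (((2 * k) *\<^sub>R G) *v y)" for y
  proof (cases "y = 0")
    case False
    have "E y = k * ?q y" using k[OF False] pos[OF False] by (simp add: field_simps)
    then show ?thesis by (simp add: half_square_def flip: scaleR_matrix_vector_assoc)
  qed (simp add: zero)
  then show ?thesis by blast
qed

context finsler_two_charts
begin

lemma quadratic_change:
  assumes "p \<in> U" "p \<in> V" "quadratic (V.Fx (v p))" shows "quadratic (U.Fx (u p))"
proof -
  have "U.Fx (u p) y = V.Fx (v p) (matrix (jac p) *v y)" for y
    using Fx_change[OF assms(1,2)] linear_jacobian[OF assms(1,2)] by (simp add: matrix_works)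
  then show ?thesis using quadratic_compose[OF assms(3), of "matrix (jac p)"] by (simp only:)
qed

end

definition quadratic_at :: "'a::topological_space chart set \<Rightarrow> ('a \<Rightarrow> 'a tvec \<Rightarrow> real) \<Rightarrow> 'a \<Rightarrow> bool" where
  "quadratic_at A F p \<longleftrightarrow> (\<exists>(U, u)\<in>charts A. p \<in> U \<and> quadratic (\<lambda>y. in_chart A U u F (u p, y)))"

lemma (in finsler_chart) quadratic_at_iff:
  assumes p: "p \<in> U" shows "quadratic_at A F p \<longleftrightarrow> quadratic (Fx (u p))"
proof
  assume "quadratic_at A F p"
  then obtain V v where V: "(V, v) \<in> charts A" "p \<in> V" "quadratic (\<lambda>y. in_chart A V v F (v p, y))"
    unfolding quadratic_at_def by blast
  interpret V: finsler_chart A V v F using F V by unfold_locales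
  interpret finsler_two_charts A U u V v F by unfold_locales
  show "quadratic (Fx (u p))" by (rule quadratic_change[OF p V(2,3)])
next
  assume "quadratic (Fx (u p))"
  then show "quadratic_at A F p" unfolding quadratic_at_def using chart p by blast
qed

context finsler_connection
begin

text \<open>Linear isometries in both directions preserve being quadratic, but transport is
  available only for a short time depending on the point. So the property is shown to be locally
  constant along the segment, and connectedness of the unit interval finishes.\<close>

lemma quadratic_along_line:
  assumes line: "\<And>t. t \<in> {0..1} \<Longrightarrow> x + t *\<^sub>R w \<in> u ` U"
  shows "quadratic (Fx x) \<longleftrightarrow> quadratic (Fx (x + w))"
proof -
  let ?f = "\<lambda>t. quadratic (Fx (x + t *\<^sub>R w))"
  have "eventually (\<lambda>b. ?f a = ?f b) (at a within {0..1})" if a: "a \<in> {0..1}" for a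
  proof -
    obtain e N M where e: "e > 0" "N 0 = mat 1" "M 0 = mat 1"
      "\<And>t. t \<in> {-e<..<e} \<Longrightarrow> x + a *\<^sub>R w + t *\<^sub>R w \<in> u ` U"
      "\<And>t. t \<in> {-e<..<e} \<Longrightarrow> M t ** N t = mat 1"
      "\<And>t y. t \<in> {-e<..<e} \<Longrightarrow> in_chart A U u F (x + a *\<^sub>R w + t *\<^sub>R w, N t *v y) = in_chart A U u F (x + a *\<^sub>R w, y)"
      by (rule parallel_transport[OF compat line[OF a], of w]) (rule that)
    have "?f a = ?f b" if "dist b a < e" for b
    proof -
      have t: "b - a \<in> {-e<..<e}" using that by (auto simp: dist_real_def)
      have xb: "x + a *\<^sub>R w + (b - a) *\<^sub>R w = x + b *\<^sub>R w" by (simp add: algebra_simps)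
      have 1: "Fx (x + a *\<^sub>R w) y = Fx (x + b *\<^sub>R w) (N (b - a) *v y)" for y
        using e(6)[OF t] unfolding xb by simp
      have "N (b - a) ** M (b - a) = mat 1" using e(5)[OF t] by (simp add: matrix_left_right_inverse)
      then have NM: "N (b - a) *v (M (b - a) *v y) = y" for y by (simp add: matrix_vector_mul_assoc)
      have 2: "Fx (x + b *\<^sub>R w) y = Fx (x + a *\<^sub>R w) (M (b - a) *v y)" for y
        using 1[of "M (b - a) *v y"] NM by simp
      show ?thesis
      proof
        assume "?f a"
        from quadratic_compose[OF this, of "M (b - a)"] show "?f b" by (simp only: 2)
      next
        assume "?f b"
        from quadratic_compose[OF this, of "N (b - a)"] show "?f a" by (simp only: 1)
      qed
    qed
    then show ?thesis unfolding eventually_at using e(1) by blast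
  qed
  then have "?f 0 = ?f 1"
    by (intro connected_local_const[of "{0..1}"]) auto
  then show ?thesis by simp
qed

lemma quadratic_at_locally_const:
  assumes p: "p \<in> U" shows "eventually (\<lambda>q. quadratic_at A F p = quadratic_at A F q) (at p)"
proof -
  obtain r where r: "r > 0" "ball (u p) r \<subseteq> u ` U"
    using open_uU p open_contains_ball by (metis imageI)
  have "quadratic_at A F p = quadratic_at A F q" if q: "q \<in> U \<inter> u -` ball (u p) r" for q
  proof -
    have "u p + t *\<^sub>R (u q - u p) \<in> u ` U" if "t \<in> {0..1}" for t
    proof -
      have "norm (t *\<^sub>R (u q - u p)) \<le> 1 * norm (u q - u p)"
        unfolding norm_scaleR by (rule mult_right_mono) (use that in auto)
      then have "u p + t *\<^sub>R (u q - u p) \<in> ball (u p) r"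
        using q by (simp add: dist_norm norm_minus_commute)
      then show ?thesis using r(2) by blast
    qed
    from quadratic_along_line[OF this] show ?thesis using q quadratic_at_iff[OF p] quadratic_at_iff[of q] by simp
  qed
  moreover have "open (U \<inter> u -` ball (u p) r)" by (rule open_preimage) simp
  moreover have "p \<in> U \<inter> u -` ball (u p) r" using p r by simp
  ultimately show ?thesis unfolding eventually_at_topological by blast
qed

end

context finsler_torsion
begin

context
  fixes p :: 'a and c :: real
  assumes p: "p \<in> U" and c: "\<And>a b. Diff p a b = c *\<^sub>R gram_cross (G (u p)) a b"
begin

interpretation phi: minkowski "N.Fx (u p)"
  by (rule N.minkowski_Fx) (use p in simp)

lemma det: "det (G (u p)) > 0"
  by (rule N.det_G_pos) (use p in simp)

abbreviation "Vc i y \<equiv> apply_field (V_field A U u \<gamma> i) (energy A U u F) (u p, y)"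

lemma linear_dEnergy: "y \<noteq> 0 \<Longrightarrow> linear (frechet_derivative (energy A U u F) (at (u p, y)))"
  by (rule smooth_on_imp_linear_frechet[OF N.smooth_energy]) (use p in simp)

lemma Vc_eq:
  "Vc i y = frechet_derivative (energy A U u F) (at (u p, y)) (0, (1/2) *\<^sub>R gram_cross (G (u p)) (axis i 1) y)"
  using p by (simp add: apply_field_def V_field_def N.gram_matrix_eq)

lemma Vc_slice:
  assumes "y \<noteq> 0" shows "Vc i y = phi.dE y ((1/2) *\<^sub>R gram_cross (G (u p)) (axis i 1) y)"
proof -
  have up: "u p \<in> u ` U" using p by simp
  show ?thesis unfolding Vc_eq N.hessian_Fx(1)[OF up assms] ..
qed

lemma bounded_linear_cross: "bounded_linear (\<lambda>y. (1/2) *\<^sub>R gram_cross (G (u p)) a y)"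
proof -
  have "linear (\<lambda>y. gram_cross (G (u p)) a y)"
    using bilinear_gram_cross[OF det] by (simp add: bilinear_def)
  then show ?thesis
    by (intro bounded_linear_scaleR_right[THEN bounded_linear_compose]) (simp add: linear_conv_bounded_linear)
qed

lemma continuous_Vc: "continuous_on (UNIV - {0}) (Vc i)"
proof (rule continuous_on_eq)
  show "continuous_on (UNIV - {0}) (\<lambda>y. phi.dE y ((1/2) *\<^sub>R gram_cross (G (u p)) (axis i 1) y))"
    by (rule smooth_on_imp_continuous_on, rule smooth_on_frechet_apply[OF phi.open_punctured phi.open_punctured phi.smooth_E])
      (auto intro!: smooth_on_id smooth_on_linear[OF bounded_linear_cross] phi.open_punctured)
qed (simp add: Vc_slice)

lemma horizontal_field_eq: "horizontal_field A U u Ds i (u p, y) = (axis i 1, - L.Gam p (axis i 1) y)"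
proof -
  have "L.Gam p (axis i 1) y $ l = (\<Sum>j\<in>UNIV. y $ j * christoffel A U u Ds i j l p)" for l
  proof -
    have "L.Gam p (axis i 1) y $ l = (\<Sum>m\<in>UNIV. if m = i then \<Sum>j\<in>UNIV. y $ j * christoffel A U u Ds i j l p else 0)"
      unfolding L.Gam_def vec_lambda_beta by (rule sum.cong) (auto simp: axis_def)
    then show ?thesis by simp
  qed
  then show ?thesis using p by (simp add: horizontal_field_def vec_eq_iff)
qed

text \<open>The horizontal fields of \<open>Ds\<close> and \<open>D\<close> differ by the vertical
  vector \<open>c\<close> times the cross product with \<open>y\<close>, that is
  \<open>2 * c\<close> times \<open>V_i\<close>. The horizontal part of \<open>D\<close> annihilates
  the energy.\<close>

lemma horizontal_energy:
  assumes y: "y \<noteq> 0"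
  shows "frechet_derivative (energy A U u F) (at (u p, y)) (horizontal_field A U u Ds i (u p, y)) = 2 * c * Vc i y"
proof -
  let ?d = "frechet_derivative (energy A U u F) (at (u p, y))"
  have up: "u p \<in> u ` U" using p by simp
  have "N.Gam p (axis i 1) y - L.Gam p (axis i 1) y = c *\<^sub>R gram_cross (G (u p)) (axis i 1) y"
    using c[of "axis i 1" y] unfolding Diff_def .
  then have "horizontal_field A U u Ds i (u p, y) =
      (axis i 1, - N.Gam p (axis i 1) y) + (2 * c) *\<^sub>R (0, (1/2) *\<^sub>R gram_cross (G (u p)) (axis i 1) y)"
    unfolding horizontal_field_eq by (simp add: algebra_simps)
  moreover have "?d (axis i 1, - N.Gam p (axis i 1) y) = 0"
    using N.energy_horizontal[OF up y, of "axis i 1"] p by simp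
  ultimately show ?thesis
    unfolding Vc_eq using linear_dEnergy[OF y] by (simp only: linear_add linear_scale) simp
qed

lemma V_total_energy:
  assumes y: "y \<noteq> 0"
  shows "apply_field (V_total A U u F \<gamma> Ds) (energy A U u F) (u p, y) = 2 * c * (\<Sum>i\<in>UNIV. (Vc i y)\<^sup>2)"
proof -
  have "apply_field (V_total A U u F \<gamma> Ds) (energy A U u F) (u p, y) =
      (\<Sum>i\<in>UNIV. Vc i y * frechet_derivative (energy A U u F) (at (u p, y)) (horizontal_field A U u Ds i (u p, y)))"
    using linear_dEnergy[OF y]
    unfolding apply_field_def[of "V_total A U u F \<gamma> Ds"] V_total_def by (simp add: linear_sum linear_scale)
  also have "\<dots> = (\<Sum>i\<in>UNIV. 2 * c * (Vc i y)\<^sup>2)"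
    unfolding horizontal_energy[OF y] by (simp add: power2_eq_square mult_ac)
  finally show ?thesis by (simp add: sum_distrib_left)
qed

lemma sigma_times_coeff:
  "indicatrix_integral (N.Fx (u p)) (\<lambda>y. apply_field (V_total A U u F \<gamma> Ds) (energy A U u F) (u p, y)) =
    2 * c * sigma A U u F \<gamma> p"
proof -
  have "indicatrix_integral (N.Fx (u p)) (\<lambda>y. apply_field (V_total A U u F \<gamma> Ds) (energy A U u F) (u p, y)) =
      indicatrix_integral (N.Fx (u p)) (\<lambda>y. 2 * c * (\<Sum>i\<in>UNIV. (Vc i y)\<^sup>2))"
    by (rule phi.indicatrix_integral_cong) (rule V_total_energy)
  also have "\<dots> = 2 * c * (\<Sum>i\<in>UNIV. indicatrix_integral (N.Fx (u p)) (\<lambda>y. (Vc i y)\<^sup>2))"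
    unfolding phi.indicatrix_integral_cmult
    by (subst phi.indicatrix_integral_sum) (auto intro!: continuous_on_power continuous_Vc)
  finally show ?thesis by (simp add: sigma_def)
qed

lemma sigma_nonzero: assumes nq: "\<not> quadratic (N.Fx (u p))" shows "sigma A U u F \<gamma> p \<noteq> 0"
proof
  assume "sigma A U u F \<gamma> p = 0"
  then have "(\<Sum>i\<in>UNIV. indicatrix_integral (N.Fx (u p)) (\<lambda>y. (Vc i y)\<^sup>2)) = 0" by (simp add: sigma_def)
  moreover have cont: "continuous_on (UNIV - {0}) (\<lambda>y. (Vc i y)\<^sup>2)" for i
    by (intro continuous_on_power continuous_Vc)
  moreover have "indicatrix_integral (N.Fx (u p)) (\<lambda>y. (Vc i y)\<^sup>2) \<ge> 0" for i
    by (rule phi.indicatrix_integral_nonneg[OF cont]) simp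
  ultimately have I0: "indicatrix_integral (N.Fx (u p)) (\<lambda>y. (Vc i y)\<^sup>2) = 0" for i
    by (simp add: sum_nonneg_eq_0_iff)
  have V1: "Vc i y = 0" if "N.Fx (u p) y = 1" for i y
    using phi.indicatrix_integral_nonneg_eq_0D[OF cont _ I0 that] by simp
  have up: "u p \<in> u ` U" using p by simp
  \<comment> \<open>The derivative of \<open>E\<close> and the cross product with \<open>y\<close>
    both scale by \<open>t\<close> along rays, so vanishing on the indicatrix extends to all nonzero
    vectors.\<close>
  have axis0: "phi.dE y (gram_cross (G (u p)) (axis i 1) y) = 0" if y: "y \<noteq> 0" for i y
  proof -
    let ?t = "inverse (N.Fx (u p) y)"
    have t: "?t > 0" using phi.pos[OF y] by simp
    have "N.Fx (u p) (?t *\<^sub>R y) = 1" using phi.homog[OF t, of y] phi.pos[OF y] by simp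
    then have "0 = Vc i (?t *\<^sub>R y)" using V1 by simp
    also have "\<dots> = phi.dE (?t *\<^sub>R y) ((1/2) *\<^sub>R gram_cross (G (u p)) (axis i 1) (?t *\<^sub>R y))"
      using y t by (intro Vc_slice) auto
    also have "\<dots> = ?t * phi.dE y ((1/2) *\<^sub>R gram_cross (G (u p)) (axis i 1) (?t *\<^sub>R y))"
      by (rule phi.dE_scale[OF t y])
    also have "gram_cross (G (u p)) (axis i 1) (?t *\<^sub>R y) = ?t *\<^sub>R gram_cross (G (u p)) (axis i 1) y"
      by (rule bilinear_rmul[OF bilinear_gram_cross[OF det]])
    also have "phi.dE y ((1/2) *\<^sub>R (?t *\<^sub>R gram_cross (G (u p)) (axis i 1) y)) =
        ?t / 2 * phi.dE y (gram_cross (G (u p)) (axis i 1) y)"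
      using phi.linear_dE[OF y] by (simp add: linear_scale)
    finally show ?thesis using t by auto
  qed
  have inv: "phi.dE y (gram_cross (G (u p)) a y) = 0" if y: "y \<noteq> 0" for a y
  proof -
    have "linear (\<lambda>a. gram_cross (G (u p)) a y)"
      using bilinear_gram_cross[OF det] by (simp add: bilinear_def)
    from linear_compose[OF this phi.linear_dE[OF y]]
    have "linear (\<lambda>a. phi.dE y (gram_cross (G (u p)) a y))" by (simp add: o_def)
    from linear_sum_axis[OF this, of a] show ?thesis using axis0[OF y] by simp
  qed
  have "quadratic (N.Fx (u p))"
    by (rule phi.quadratic_if_cross_invariant, rule N.G_sym[OF up], erule N.G_pos[OF up], erule inv)
  with nq show False by blast
qed

lemma torsion_coeff_eq:
  assumes "\<not> quadratic (N.Fx (u p))" shows "torsion_coeff A U u F \<gamma> Ds p = 2 * c"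
  using sigma_nonzero[OF assms] by (simp add: torsion_coeff_def sigma_times_coeff)

end

text \<open>In coordinates both connections contain the same derivative of the components of
  \<open>Y\<close>; it cancels, and the difference at \<open>p\<close> is \<open>Diff\<close>
  applied to the values of the fields.\<close>

lemma connection_difference:
  assumes p: "p \<in> U" and nq: "\<not> quadratic_at A F p"
    and X: "smooth_vfield A U X" and Y: "smooth_vfield A U Y"
  shows "D X Y p = (\<lambda>h. Ds X Y p h + torsion_coeff A U u F \<gamma> Ds p / 2 * tangent_cross A U u \<gamma> p (X p) (Y p) h)"
proof
  fix h
  obtain c where c: "\<And>a b. Diff p a b = c *\<^sub>R gram_cross (G (u p)) a b" using Diff_eq_cross[OF p] by blast
  have coeff: "torsion_coeff A U u F \<gamma> Ds p = 2 * c"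
    using torsion_coeff_eq[OF p c] nq N.quadratic_at_iff[OF p] by simp
  let ?a = "fibre_coords u (X p)" and ?b = "fibre_coords u (Y p)"
  have "fibre_coords u (D X Y p) = fibre_coords u (Ds X Y p) + Diff p ?a ?b"
    by (simp add: vec_eq_iff N.D_coords[OF N.open_U p p X Y] L.D_coords[OF N.open_U p p X Y] Diff_def)
  then have "D X Y p = coords_tvec A U u p (fibre_coords u (Ds X Y p) + c *\<^sub>R gram_cross (G (u p)) ?a ?b)"
    using N.tangent_expand[OF p N.smooth_vfield_mem[OF N.smooth_D[OF N.open_U X Y] p]] c by simp
  then have "D X Y p h = coords_tvec A U u p (fibre_coords u (Ds X Y p)) h +
      c * coords_tvec A U u p (gram_cross (G (u p)) ?a ?b) h"
    by (simp only: N.coords_tvec_add N.coords_tvec_scale)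
  also have "coords_tvec A U u p (fibre_coords u (Ds X Y p)) = Ds X Y p"
    using N.tangent_expand[OF p N.smooth_vfield_mem[OF L.smooth_D[OF N.open_U X Y] p]] by simp
  finally show "D X Y p h = Ds X Y p h + torsion_coeff A U u F \<gamma> Ds p / 2 * tangent_cross A U u \<gamma> p (X p) (Y p) h"
    by (simp add: coeff tangent_cross_def N.gram_matrix_eq[OF p])
qed

end

theorem theorem2:
  fixes A :: "'a::{t2_space, second_countable_topology} chart set"
    and F :: "'a \<Rightarrow> 'a tvec \<Rightarrow> real"
    and \<gamma> :: "'a \<Rightarrow> 'a tvec \<Rightarrow> 'a tvec \<Rightarrow> real"
    and nabla nabla_star :: "'a vfield \<Rightarrow> 'a vfield \<Rightarrow> 'a vfield"
    and U :: "'a set" and u :: "'a \<Rightarrow> real^3"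
    and f :: "'a \<Rightarrow> real"
  defines "\<gamma> \<equiv> averaged_metric A F"
    and "f \<equiv> torsion_coeff A U u F \<gamma> nabla_star"
  assumes "smooth_atlas A"
    and "connected (UNIV :: 'a set)"
    and "finsler_metric A F"
    and "\<not> riemannian A F"
    and "levi_civita_connection A \<gamma> nabla_star"
    and "linear_connection A nabla"
    and "compatible_connection A F nabla"
    and "totally_antisymmetric_torsion A \<gamma> nabla"
    and "(U, u) \<in> charts A"
  shows "\<forall>X Y. smooth_vfield A U X \<longrightarrow> smooth_vfield A U Y \<longrightarrow> (\<forall>p\<in>U.
           nabla X Y p =
             (\<lambda>h. nabla_star X Y p h + f p / 2 * tangent_cross A U u \<gamma> p (X p) (Y p) h))"
proof -
  have lc: "levi_civita_connection A (averaged_metric A F) nabla_star"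
    and anti: "totally_antisymmetric_torsion A (averaged_metric A F) nabla"
    using assms(7,10) by (simp_all only: \<gamma>_def)
  have lin: "linear_connection A nabla_star"
    using lc by (simp add: levi_civita_connection_def)
  interpret manifold3 A using assms(3) by unfold_locales
  interpret finsler_torsion A U u F nabla nabla_star
    using assms(3,5,8,9,11) lin lc anti by unfold_locales
  have "\<not> quadratic_at A F p" for p
  proof
    assume q: "quadratic_at A F p"
    \<comment> \<open>Local constancy is needed at every point of the manifold, so a chart around
      the current point is used rather than \<open>(U, u)\<close>.\<close>
    have "eventually (\<lambda>q. quadratic_at A F p = quadratic_at A F q) (at p)" for p
    proof -
      obtain V v where V: "(V, v) \<in> charts A" "p \<in> V" by (rule ex_chart)
      interpret V: finsler_connection A V v F nabla
        using assms(3,5,8,9) V(1) by unfold_locales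
      show ?thesis by (rule V.quadratic_at_locally_const[OF V(2)])
    qed
    then have all: "quadratic_at A F r" for r
      using connected_local_const[OF assms(4), of p r "quadratic_at A F"] q by simp
    have "riemannian A F"
      unfolding riemannian_def
    proof (clarify)
      fix V v q assume V: "(V, v) \<in> charts A" and "q \<in> V"
      interpret V: finsler_chart A V v F using assms(3,5) V by unfold_locales
      show "quadratic (V.Fx (v q))" using V.quadratic_at_iff[OF \<open>q \<in> V\<close>] all by simp
    qed
    with assms(6) show False by blast
  qed
  then show ?thesis
    unfolding f_def \<gamma>_def using connection_difference by blast
qed

end
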